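(* One has $$\dim_{\mathbb F_2}[(QP_6)_{15}]^{GL(6,\mathbb F_2)}=1,\qquad [(QP_6)_{15}]^{GL(6,\mathbb F_2)}=\mathbb F_2\cdot[\xi],$$ where $$\xi=M_{(15)}^{(6)}+M_{(1,14)}^{(6)}+M_{(1,2,12)}^{(6)}+M_{(1,2,4,8)}^{(6)}+M_{(1,2,4,4,4)}^{(6)}+M_{(1,2,2,2,4,4)}^{(6)}.$$ The support, partition-type and stabilizer data of the six blocks are as follows (block $\alpha$; partition type $\lambda$; number of monomials of $\xi$ of type $\lambda$; size of the full $\Sigma_6$-orbit of a monomial of type $\lambda$; order and isomorphism type of its stabilizer in $\Sigma_6$): $(15)$; $(15,0,0,0,0,0)$; $6$; $6$; $120$, $\Sigma_5$. $(1,14)$; $(14,1,0,0,0,0)$; $15$; $30$; $24$, $\Sigma_4$. $(1,2,12)$; $(12,2,1,0,0,0)$; $20$; $120$; $6$, $\Sigma_3$. $(1,2,4,8)$; $(8,4,2,1,0,0)$; $15$; $360$; $2$, $\Sigma_2$. $(1,2,4,4,4)$; $(4,4,4,2,1,0)$; $6$; $120$; $6$, $\Sigma_3$. $(1,2,2,2,4,4)$; $(4,4,2,2,2,1)$; $1$; $60$; $12$, $\Sigma_3\times\Sigma_2$.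
   Context: $P_6=\mathbb F_2[x_1,\dots,x_6]$, $|x_i|=1$, with the usual action of the mod-2 Steenrod algebra $\mathscr A$ ($Sq^1x_i=x_i^2$, $Sq^rx_i=0$ for $r>1$, Cartan formula). $QP_6=P_6/(\mathscr A^{>0}\cdot P_6)$, where $\mathscr A^{>0}$ is the augmentation ideal; $[f]$ is the class of $f$; the subscript $15$ denotes the degree-15 part. $GL(6,\mathbb F_2)$ acts by linear substitutions of the variables. For a composition $\alpha=(\alpha_1,\dots,\alpha_r)$ with $r\le 6$, $M_\alpha^{(6)}=\sum_{1\le i_1<\cdots<i_r\le 6}x_{i_1}^{\alpha_1}\cdots x_{i_r}^{\alpha_r}$. The partition type of a monomial $x_1^{a_1}\cdots x_6^{a_6}$ is the non-increasing rearrangement of $(a_1,\dots,a_6)$. $\Sigma_6$ acts on monomials by permuting variables. *)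

theory Defs
  imports
    "HOL-Library.Poly_Mapping"
    "HOL-Library.Z2"
    "HOL-Library.Numeral_Type"
    "HOL-Computational_Algebra.Polynomial"
    "HOL-Analysis.Cartesian_Space"
    "HOL-Algebra.Group_Action"
    "HOL-Algebra.Sym_Groups"
begin

text \<open>
  \<^typ>\<open>bit\<close> is the field with two elements.  The six variables are indexed by the ordered
  six-element type \<^typ>\<open>6\<close>.
\<close>

type_synonym mon6 = "6 \<Rightarrow>\<^sub>0 nat"
type_synonym P6 = "mon6 \<Rightarrow>\<^sub>0 bit"

definition X :: "6 \<Rightarrow> P6" where
  "X i = Poly_Mapping.single (Poly_Mapping.single i 1) 1"

definition scaleP :: "bit \<Rightarrow> P6 \<Rightarrow> P6" where
  "scaleP c f = Poly_Mapping.single 0 c * f"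

interpretation P: vector_space scaleP
proof
  show "scaleP (a + b) f = scaleP a f + scaleP b f" for a b f
    unfolding scaleP_def single_add by (rule distrib_right)
  show "scaleP a (scaleP b f) = scaleP (a * b) f" for a b f
    by (simp add: scaleP_def mult_single flip: mult.assoc)
qed (simp_all add: scaleP_def distrib_left)

definition mon_degree :: "mon6 \<Rightarrow> nat" where
  "mon_degree m = (\<Sum>i\<in>UNIV. Poly_Mapping.lookup m i)"

definition homogeneous :: "nat \<Rightarrow> P6 set" where
  "homogeneous d = {f. \<forall>m\<in>Poly_Mapping.keys f. mon_degree m = d}"


subsection \<open>Evaluation in algebras over the field with two elements\<close>

text \<open>
  \<open>eval_mon \<phi> m\<close> and \<open>eval_poly \<phi> f\<close> substitute \<open>\<phi> i\<close> for the \<open>i\<close>-th variable; all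
  coefficients at \<^term>\<open>Poly_Mapping.keys f\<close> are \<open>1\<close>.
\<close>

definition eval_mon :: "(6 \<Rightarrow> 'r::comm_ring_1) \<Rightarrow> mon6 \<Rightarrow> 'r" where
  "eval_mon \<phi> m = (\<Prod>i\<in>UNIV. \<phi> i ^ Poly_Mapping.lookup m i)"

definition eval_poly :: "(6 \<Rightarrow> 'r::comm_ring_1) \<Rightarrow> P6 \<Rightarrow> 'r" where
  "eval_poly \<phi> f = (\<Sum>m\<in>Poly_Mapping.keys f. eval_mon \<phi> m)"

lemma P6_char2: "(1::P6) + 1 = 0"
proof -
  have "(1::P6) + 1 = Poly_Mapping.single 0 1 + Poly_Mapping.single 0 1"
    unfolding single_one ..
  also have "\<dots> = Poly_Mapping.single 0 (1 + 1)"
    by (rule single_add[symmetric])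
  finally show ?thesis by simp
qed

lemma P6_poly_char2: "(1::P6 poly) + 1 = 0"
  unfolding one_pCons by (simp add: P6_char2 del: one_add_one)

lemma char2_add_self:
  fixes x :: "'r::comm_ring_1"
  assumes "(1::'r) + 1 = 0"
  shows "x + x = 0"
proof -
  have "x + x = x * (1 + 1)" by (simp add: distrib_left)
  then show ?thesis using assms by simp
qed

lemma eval_mon_0 [simp]: "eval_mon \<phi> 0 = 1"
  by (simp add: eval_mon_def)

lemma eval_mon_add: "eval_mon \<phi> (m + n) = eval_mon \<phi> m * eval_mon \<phi> n"
  by (simp add: eval_mon_def lookup_add power_add prod.distrib)

lemma eval_mon_single: "eval_mon \<phi> (Poly_Mapping.single i 1) = \<phi> i"
proof -
  have "eval_mon \<phi> (Poly_Mapping.single i 1) = (\<Prod>j\<in>UNIV. if j = i then \<phi> i else 1)"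
    unfolding eval_mon_def by (rule prod.cong) (auto simp: lookup_single_not_eq)
  also have "\<dots> = \<phi> i"
    by (simp add: prod.delta)
  finally show ?thesis .
qed

lemma eval_poly_superset:
  assumes "finite S" "Poly_Mapping.keys f \<subseteq> S"
  shows "eval_poly \<phi> f = (\<Sum>m\<in>S. if Poly_Mapping.lookup f m = 1 then eval_mon \<phi> m else 0)"
proof -
  have "eval_poly \<phi> f = (\<Sum>m\<in>Poly_Mapping.keys f. if Poly_Mapping.lookup f m = 1 then eval_mon \<phi> m else 0)"
    unfolding eval_poly_def by (rule sum.cong) (auto simp: in_keys_iff)
  also have "\<dots> = (\<Sum>m\<in>S. if Poly_Mapping.lookup f m = 1 then eval_mon \<phi> m else 0)"
    using assms by (intro sum.mono_neutral_left) (auto simp: in_keys_iff)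
  finally show ?thesis .
qed

lemma eval_poly_0 [simp]: "eval_poly \<phi> 0 = 0"
  by (simp add: eval_poly_def)

lemma eval_poly_single [simp]: "eval_poly \<phi> (Poly_Mapping.single m 1) = eval_mon \<phi> m"
  by (simp add: eval_poly_def)

lemma eval_poly_1 [simp]: "eval_poly \<phi> 1 = 1"
  using eval_poly_single[of \<phi> 0] by (simp del: eval_poly_single)

lemma eval_poly_X [simp]: "eval_poly \<phi> (X i) = \<phi> i"
  using eval_mon_single[of \<phi> i] by (simp add: X_def)

lemma eval_poly_add:
  fixes \<phi> :: "6 \<Rightarrow> 'r::comm_ring_1"
  assumes "(1::'r) + 1 = 0"
  shows "eval_poly \<phi> (f + g) = eval_poly \<phi> f + eval_poly \<phi> g"
proof -
  let ?S = "Poly_Mapping.keys f \<union> Poly_Mapping.keys g"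
  have fin: "finite ?S" by simp
  have "eval_poly \<phi> (f + g) = (\<Sum>m\<in>?S. if Poly_Mapping.lookup (f + g) m = 1 then eval_mon \<phi> m else 0)"
    using fin by (rule eval_poly_superset) (rule keys_add)
  also have "\<dots> = (\<Sum>m\<in>?S. (if Poly_Mapping.lookup f m = 1 then eval_mon \<phi> m else 0)
                          + (if Poly_Mapping.lookup g m = 1 then eval_mon \<phi> m else 0))"
    by (rule sum.cong) (auto simp: lookup_add char2_add_self[OF assms])
  also have "\<dots> = eval_poly \<phi> f + eval_poly \<phi> g"
    by (simp add: sum.distrib flip: eval_poly_superset[OF fin])
  finally show ?thesis .
qed

lemma P6_induct [case_names zero add]:
  fixes f :: P6
  assumes "Q 0" and "\<And>m f. Q f \<Longrightarrow> Q (Poly_Mapping.single m 1 + f)"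
  shows "Q f"
proof (induction f rule: update_induct)
  case const
  then show ?case by (rule assms)
next
  case (update f a b)
  have "Poly_Mapping.update a b f = Poly_Mapping.single a 1 + f"
    using update by (intro poly_mapping_eqI)
      (auto simp: lookup_update lookup_add lookup_single when_def in_keys_iff)
  then show ?case using assms(2) update by simp
qed

lemma eval_poly_mult:
  fixes \<phi> :: "6 \<Rightarrow> 'r::comm_ring_1"
  assumes "(1::'r) + 1 = 0"
  shows "eval_poly \<phi> (f * g) = eval_poly \<phi> f * eval_poly \<phi> g"
proof -
  have mono: "eval_poly \<phi> (Poly_Mapping.single m 1 * g) = eval_mon \<phi> m * eval_poly \<phi> g" for m g
  proof (induction g rule: P6_induct)
    case zero
    then show ?case by simp
  next
    case (add n g)
    then show ?case
      by (simp add: distrib_left eval_poly_add[OF assms] mult_single eval_mon_add)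
  qed
  show ?thesis
    by (induction f rule: P6_induct)
      (simp_all add: distrib_right eval_poly_add[OF assms] mono)
qed

lemma P6_ring_induct [case_names zero one var add mult]:
  fixes f :: P6
  assumes "Q 0" "Q 1" "\<And>i. Q (X i)"
    and add: "\<And>f g. Q f \<Longrightarrow> Q g \<Longrightarrow> Q (f + g)"
    and mult: "\<And>f g. Q f \<Longrightarrow> Q g \<Longrightarrow> Q (f * g)"
  shows "Q f"
proof -
  have pow: "Q (Poly_Mapping.single (Poly_Mapping.single i k) 1)" for i k
  proof (induction k)
    case 0
    then show ?case using assms(2) by simp
  next
    case (Suc k)
    have "Poly_Mapping.single (Poly_Mapping.single i (Suc k)) 1
        = X i * Poly_Mapping.single (Poly_Mapping.single i k) 1"
      by (simp add: X_def mult_single flip: single_add)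
    then show ?case using assms(3) mult Suc by simp
  qed
  have mon: "Q (Poly_Mapping.single m 1)" for m
  proof (induction m rule: update_induct)
    case const
    then show ?case using assms(2) by simp
  next
    case (update m i k)
    have "Poly_Mapping.update i k m = Poly_Mapping.single i k + m"
      using update by (intro poly_mapping_eqI)
        (auto simp: lookup_update lookup_add lookup_single when_def in_keys_iff)
    then have "Poly_Mapping.single (Poly_Mapping.update i k m) (1::bit)
        = Poly_Mapping.single (Poly_Mapping.single i k) 1 * Poly_Mapping.single m 1"
      by (simp add: mult_single)
    then show ?case using pow mult update by simp
  qed
  show ?thesis
    by (induction f rule: P6_induct) (use assms(1) add mon in auto)
qed


subsection \<open>Steenrod operations\<close>

text \<open>
  The total operation is the ring homomorphism from \<^typ>\<open>P6\<close> to polynomials in an auxiliary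
  variable \<open>t\<close> over \<^typ>\<open>P6\<close> with \<open>x\<^sub>i \<mapsto> x\<^sub>i + x\<^sub>i\<^sup>2 t\<close>; its \<open>t\<^sup>k\<close>-coefficient is
  \<open>Sq k\<close>.  The lemmas below are the defining properties of the action of the Steenrod
  squares on polynomials.
\<close>

definition total_Sq :: "P6 \<Rightarrow> P6 poly" where
  "total_Sq = eval_poly (\<lambda>i. [:X i, (X i)\<^sup>2:])"

definition Sq :: "nat \<Rightarrow> P6 \<Rightarrow> P6" where
  "Sq k f = poly.coeff (total_Sq f) k"

lemma Sq_add: "Sq k (f + g) = Sq k f + Sq k g"
  by (simp add: Sq_def total_Sq_def eval_poly_add[OF P6_poly_char2])

lemma Sq_zero [simp]: "Sq k 0 = 0"
  by (simp add: Sq_def total_Sq_def)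

lemma Sq_one: "Sq k 1 = (if k = 0 then 1 else 0)"
  by (simp add: Sq_def total_Sq_def)

lemma Sq_Cartan: "Sq k (f * g) = (\<Sum>i\<le>k. Sq i f * Sq (k - i) g)"
  by (simp add: Sq_def total_Sq_def eval_poly_mult[OF P6_poly_char2] coeff_mult)

lemma Sq_0_X: "Sq 0 (X i) = X i"
  by (simp add: Sq_def total_Sq_def)

lemma Sq_1_X: "Sq 1 (X i) = (X i)\<^sup>2"
  by (simp add: Sq_def total_Sq_def)

lemma Sq_gt_1_X: "k > 1 \<Longrightarrow> Sq k (X i) = 0"
  by (simp add: Sq_def total_Sq_def coeff_pCons split: nat.splits)

lemma Sq_0: "Sq 0 f = f"
  by (induction f rule: P6_ring_induct) (simp_all add: Sq_one Sq_0_X Sq_add Sq_Cartan)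

text \<open>
  The operators by which the augmentation ideal of the Steenrod algebra acts: that algebra is
  generated by the squares \<open>Sq k\<close> with \<open>k > 0\<close>, so its augmentation ideal is the subalgebra
  without unit which they generate.
\<close>

inductive_set steenrod_aug :: "(P6 \<Rightarrow> P6) set" where
  Sq: "k > 0 \<Longrightarrow> Sq k \<in> steenrod_aug"
| zero: "(\<lambda>f. 0) \<in> steenrod_aug"
| add: "\<theta> \<in> steenrod_aug \<Longrightarrow> \<eta> \<in> steenrod_aug \<Longrightarrow> (\<lambda>f. \<theta> f + \<eta> f) \<in> steenrod_aug"
| comp: "\<theta> \<in> steenrod_aug \<Longrightarrow> \<eta> \<in> steenrod_aug \<Longrightarrow> \<theta> \<circ> \<eta> \<in> steenrod_aug"

definition hit :: "P6 set" where
  "hit = P.span {\<theta> f | \<theta> f. \<theta> \<in> steenrod_aug}"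


subsection \<open>The space of indecomposables\<close>

lemma hit_zero: "0 \<in> hit"
  unfolding hit_def by (rule P.span_zero)

lemma hit_add: "f \<in> hit \<Longrightarrow> g \<in> hit \<Longrightarrow> f + g \<in> hit"
  unfolding hit_def by (rule P.span_add)

lemma hit_diff: "f \<in> hit \<Longrightarrow> g \<in> hit \<Longrightarrow> f - g \<in> hit"
  unfolding hit_def by (rule P.span_diff)

lemma hit_scale: "f \<in> hit \<Longrightarrow> scaleP c f \<in> hit"
  unfolding hit_def by (rule P.span_scale)

quotient_type QP6 = P6 / "\<lambda>f g. f - g \<in> hit"
  morphisms rep_QP6 abs_QP6
proof (rule equivpI)
  show "reflp (\<lambda>f g. f - g \<in> hit)"
    by (rule reflpI) (simp add: hit_zero)
  show "symp (\<lambda>f g. f - g \<in> hit)"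
    using hit_diff[OF hit_zero] by (intro sympI) fastforce
  show "transp (\<lambda>f g. f - g \<in> hit)"
    using hit_add by (intro transpI) fastforce
qed

lifting_forget poly_mapping.lifting

lift_definition qclass :: "P6 \<Rightarrow> QP6" is "\<lambda>f. f" .

instantiation QP6 :: ab_group_add
begin

lift_definition zero_QP6 :: QP6 is 0 .

lift_definition plus_QP6 :: "QP6 \<Rightarrow> QP6 \<Rightarrow> QP6" is "(+)"
proof -
  fix f f' g g' :: P6
  assume "f - f' \<in> hit" "g - g' \<in> hit"
  then have "(f - f') + (g - g') \<in> hit" by (rule hit_add)
  then show "(f + g) - (f' + g') \<in> hit" by (simp only: add_diff_add)
qed

lift_definition uminus_QP6 :: "QP6 \<Rightarrow> QP6" is uminus
proof -
  fix f f' :: P6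
  assume "f - f' \<in> hit"
  then have "0 - (f - f') \<in> hit" by (rule hit_diff[OF hit_zero])
  then show "- f - - f' \<in> hit" by simp
qed

lift_definition minus_QP6 :: "QP6 \<Rightarrow> QP6 \<Rightarrow> QP6" is "(-)"
proof -
  fix f f' g g' :: P6
  assume "f - f' \<in> hit" "g - g' \<in> hit"
  then have "(f - f') - (g - g') \<in> hit" by (rule hit_diff)
  moreover have "(f - f') - (g - g') = (f - g) - (f' - g')" by algebra
  ultimately show "(f - g) - (f' - g') \<in> hit" by (simp only:)
qed

instance
proof
  fix a b c :: QP6
  show "a + b + c = a + (b + c)"
    by transfer (simp add: add.assoc hit_zero)
  show "a + b = b + a"
    by transfer (simp add: add.commute hit_zero)
  show "0 + a = a"
    by transfer (simp add: hit_zero)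
  show "- a + a = 0"
    by transfer (simp add: hit_zero)
  show "a - b = a + - b"
    by transfer (simp add: hit_zero)
qed

end

lift_definition scaleQ :: "bit \<Rightarrow> QP6 \<Rightarrow> QP6" is scaleP
  unfolding P.scale_right_diff_distrib[symmetric] by (rule hit_scale)

interpretation Q: vector_space scaleQ
proof
  fix a b :: bit and p q :: QP6
  show "scaleQ a (p + q) = scaleQ a p + scaleQ a q"
    by transfer (simp only: P.scale_right_distrib diff_self hit_zero)
  show "scaleQ (a + b) p = scaleQ a p + scaleQ b p"
    by transfer (simp only: P.scale_left_distrib diff_self hit_zero)
  show "scaleQ a (scaleQ b p) = scaleQ (a * b) p"
    by transfer (simp only: P.scale_scale diff_self hit_zero)
  show "scaleQ 1 p = p"
    by transfer (simp only: P.scale_one diff_self hit_zero)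
qed

definition QP6_deg :: "nat \<Rightarrow> QP6 set" where
  "QP6_deg d = qclass ` homogeneous d"


subsection \<open>Linear substitutions\<close>

definition lin_subst :: "bit^6^6 \<Rightarrow> P6 \<Rightarrow> P6" where
  "lin_subst A = eval_poly (\<lambda>j. \<Sum>i\<in>UNIV. scaleP (A $ i $ j) (X i))"

lemma lin_subst_add: "lin_subst A (f + g) = lin_subst A f + lin_subst A g"
  by (simp add: lin_subst_def eval_poly_add[OF P6_char2])

lemma lin_subst_mult: "lin_subst A (f * g) = lin_subst A f * lin_subst A g"
  by (simp add: lin_subst_def eval_poly_mult[OF P6_char2])

lemma lin_subst_zero [simp]: "lin_subst A 0 = 0"
  by (simp add: lin_subst_def)

lemma lin_subst_one [simp]: "lin_subst A 1 = 1"
  by (simp add: lin_subst_def)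

lemma lin_subst_sum: "lin_subst A (\<Sum>i\<in>I. f i) = (\<Sum>i\<in>I. lin_subst A (f i))"
  by (induction I rule: infinite_finite_induct) (simp_all add: lin_subst_add)

lemma lin_subst_X: "lin_subst A (X j) = (\<Sum>i\<in>UNIV. scaleP (A $ i $ j) (X i))"
  by (simp add: lin_subst_def)

lemma lin_subst_scale: "lin_subst A (scaleP c f) = scaleP c (lin_subst A f)"
  by (cases c) simp_all

lemma lin_subst_uminus: "lin_subst A (- f) = - lin_subst A f"
  using lin_subst_add[of A f "- f"] by (simp add: eq_neg_iff_add_eq_0 add.commute)

lemma lin_subst_diff: "lin_subst A (f - g) = lin_subst A f - lin_subst A g"
  using lin_subst_add[of A f "- g"] by (simp add: lin_subst_uminus)

lemma Sq_sum: "Sq k (\<Sum>i\<in>I. f i) = (\<Sum>i\<in>I. Sq k (f i))"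
  by (induction I rule: infinite_finite_induct) (simp_all add: Sq_add)

lemma Sq_scale: "Sq k (scaleP c f) = scaleP c (Sq k f)"
  by (cases c) simp_all

lemma P6_square_add: "(f + g)\<^sup>2 = f\<^sup>2 + (g::P6)\<^sup>2"
proof -
  have "(f + g)\<^sup>2 = f\<^sup>2 + g\<^sup>2 + (f * g + f * g)"
    by (simp add: power2_eq_square algebra_simps)
  then show ?thesis by (simp add: char2_add_self[OF P6_char2])
qed

lemma P6_square_sum: "(\<Sum>i\<in>I. f i)\<^sup>2 = (\<Sum>i\<in>I. (f i :: P6)\<^sup>2)"
  by (induction I rule: infinite_finite_induct) (simp_all add: P6_square_add)

lemma P6_square_scale: "(scaleP c f)\<^sup>2 = scaleP c (f\<^sup>2)"
  by (cases c) simp_all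

lemma lin_subst_Sq: "lin_subst A (Sq k f) = Sq k (lin_subst A f)"
proof (induction f arbitrary: k rule: P6_ring_induct)
  case (var j)
  consider "k = 0" | "k = 1" | "k > 1" by linarith
  then show ?case
  proof cases
    case 1
    then show ?thesis by (simp add: Sq_0)
  next
    case 2
    then show ?thesis
      by (simp add: Sq_1_X[simplified] power2_eq_square lin_subst_mult)
        (simp add: lin_subst_X Sq_sum Sq_scale Sq_1_X[simplified] P6_square_sum P6_square_scale
          flip: power2_eq_square)
  next
    case 3
    then show ?thesis by (simp add: lin_subst_X Sq_sum Sq_scale Sq_gt_1_X)
  qed
qed (simp_all add: Sq_one lin_subst_add Sq_add lin_subst_mult Sq_Cartan lin_subst_sum)

lemma lin_subst_steenrod_aug:
  assumes "\<theta> \<in> steenrod_aug"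
  shows "lin_subst A (\<theta> f) = \<theta> (lin_subst A f)"
  using assms by (induction arbitrary: f) (simp_all add: lin_subst_Sq lin_subst_add)

lemma lin_subst_hit:
  assumes "f \<in> hit"
  shows "lin_subst A f \<in> hit"
  using assms unfolding hit_def
proof (induction rule: P.span_induct_alt)
  case base
  then show ?case by (simp add: P.span_zero)
next
  case (step c h g)
  then obtain \<theta> f where \<theta>: "\<theta> \<in> steenrod_aug" and h: "h = \<theta> f" by auto
  have "lin_subst A h \<in> {\<theta> f | \<theta> f. \<theta> \<in> steenrod_aug}"
    unfolding h lin_subst_steenrod_aug[OF \<theta>] using \<theta> by blast
  then show ?case
    using step by (simp add: lin_subst_add lin_subst_scale P.span_add P.span_scale P.span_base)
qed

lift_definition GL_act :: "bit^6^6 \<Rightarrow> QP6 \<Rightarrow> QP6" is lin_subst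
  using lin_subst_hit by (simp flip: lin_subst_diff)

definition QP6_invariants :: "nat \<Rightarrow> QP6 set" where
  "QP6_invariants d = {q \<in> QP6_deg d. \<forall>A. invertible A \<longrightarrow> GL_act A q = q}"


subsection \<open>Monomial quasisymmetric polynomials\<close>

definition M :: "nat list \<Rightarrow> P6" where
  "M \<alpha> = (\<Sum>is | length is = length \<alpha> \<and> sorted_wrt (<) is.
            \<Prod>j<length \<alpha>. X (is ! j) ^ (\<alpha> ! j))"

definition \<xi> :: P6 where
  "\<xi> = M [15] + M [1, 14] + M [1, 2, 12] + M [1, 2, 4, 8] + M [1, 2, 4, 4, 4]
      + M [1, 2, 2, 2, 4, 4]"


subsection \<open>Partition types, orbits and stabilizers\<close>

definition partition_type :: "mon6 \<Rightarrow> nat list" where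
  "partition_type m = rev (sorted_list_of_multiset (image_mset (Poly_Mapping.lookup m) (mset_set UNIV)))"

abbreviation \<Sigma>\<^sub>6 :: "(6 \<Rightarrow> 6) monoid" where
  "\<Sigma>\<^sub>6 \<equiv> BijGroup UNIV"

text \<open>The permutation \<open>\<sigma>\<close> sends the variable \<open>x\<^sub>i\<close> to \<open>x\<^sub>\<sigma>\<^sub>(\<^sub>i\<^sub>)\<close>.\<close>

definition perm_mon :: "(6 \<Rightarrow> 6) \<Rightarrow> mon6 \<Rightarrow> mon6" where
  "perm_mon \<sigma> m = Abs_poly_mapping (\<lambda>i. Poly_Mapping.lookup m (inv_into UNIV \<sigma> i))"

lemma lookup_perm_mon:
  "Poly_Mapping.lookup (perm_mon \<sigma> m) i = Poly_Mapping.lookup m (inv_into UNIV \<sigma> i)"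
  by (simp add: perm_mon_def)

lemma perm_mon_single:
  assumes "bij \<sigma>"
  shows "perm_mon \<sigma> (Poly_Mapping.single i k) = Poly_Mapping.single (\<sigma> i) k"
  using assms
  by (intro poly_mapping_eqI)
    (auto simp: lookup_perm_mon lookup_single when_def bij_is_inj bij_is_surj surj_f_inv_f
      inv_f_eq)

lemma perm_mon_group_action: "group_action \<Sigma>\<^sub>6 UNIV perm_mon"
proof -
  have comp: "perm_mon (\<sigma> \<circ> \<tau>) m = perm_mon \<sigma> (perm_mon \<tau> m)" if "bij \<sigma>" "bij \<tau>" for \<sigma> \<tau> m
    using that by (intro poly_mapping_eqI) (simp add: lookup_perm_mon o_inv_distrib)
  have one: "perm_mon id m = m" for m
    by (intro poly_mapping_eqI) (simp add: lookup_perm_mon)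
  have bij: "bij (perm_mon \<sigma>)" if "bij \<sigma>" for \<sigma>
  proof (rule o_bij)
    show "perm_mon (inv_into UNIV \<sigma>) \<circ> perm_mon \<sigma> = id"
      using that comp[of "inv_into UNIV \<sigma>" \<sigma>] one
      by (auto simp: fun_eq_iff bij_imp_bij_inv bij_is_inj inv_o_cancel)
    show "perm_mon \<sigma> \<circ> perm_mon (inv_into UNIV \<sigma>) = id"
      using that comp[of \<sigma> "inv_into UNIV \<sigma>"] one
      by (auto simp: fun_eq_iff bij_imp_bij_inv bij_is_surj surj_iff[THEN iffD1])
  qed
  have "perm_mon \<in> hom \<Sigma>\<^sub>6 (BijGroup UNIV)"
    using bij comp by (auto simp: hom_def BijGroup_def Bij_def compose_def restrict_def o_def)
  then show ?thesis
    unfolding group_action_def group_hom_def group_hom_axioms_def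
    by (simp add: group_BijGroup)
qed

text \<open>
  The data of one block of \<^const>\<open>\<xi>\<close>: composition \<open>\<alpha>\<close>, partition type \<open>\<nu>\<close> of its monomials,
  number \<open>n\<close> of monomials of \<^const>\<open>\<xi>\<close> of that type, and, for every monomial of that type, the
  size \<open>N\<close> of its orbit and the order \<open>s\<close> and isomorphism type \<open>H\<close> of its stabilizer.
\<close>

definition block_data ::
  "nat list \<Rightarrow> nat list \<Rightarrow> nat \<Rightarrow> nat \<Rightarrow> nat \<Rightarrow> 'b monoid \<Rightarrow> bool" where
  "block_data \<alpha> \<nu> n N s H \<longleftrightarrow>
     (\<forall>m\<in>Poly_Mapping.keys (M \<alpha>). partition_type m = \<nu>) \<and>
     card {m \<in> Poly_Mapping.keys \<xi>. partition_type m = \<nu>} = n \<and>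
     (\<forall>m. partition_type m = \<nu> \<longrightarrow>
        card (Group_Action.orbit \<Sigma>\<^sub>6 perm_mon m) = N \<and>
        order (\<Sigma>\<^sub>6\<lparr>carrier := stabilizer \<Sigma>\<^sub>6 perm_mon m\<rparr>) = s \<and>
        \<Sigma>\<^sub>6\<lparr>carrier := stabilizer \<Sigma>\<^sub>6 perm_mon m\<rparr> \<cong> H)"

end

theory Submission
  imports Defs "HOL-Algebra.Algebraic_Closure_Type" "HOL-Library.Code_Binary_Nat"
begin

text \<open>
  \<^bold>\<open>Invariance of \<open>[\<xi>]\<close>.\<close>  For linear forms \<open>y\<^sub>1, \<dots>, y\<^sub>s\<close> let \<open>block [y\<^sub>1, \<dots>, y\<^sub>s]\<close> be the class of
  the product of the \<open>y\<^sub>j\<close> with the exponents of the \<open>s\<close>-th block.  Explicit squares show that a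
  block is symmetric, that a repeated form may be dropped (\<open>block_merge\<close>), and that it is additive
  in each argument (\<open>block_add\<close>).  A block of variables therefore depends only on the set of its
  variables, and \<open>[\<xi>]\<close> is the sum of these classes over all nonempty sets.  After a substitution,
  multilinearity expands each block into blocks of variables, and for an invertible matrix every
  nonempty set occurs an odd number of times (\<open>odd_column_choices_eq\<close>).  In other words, the
  symmetric, idempotent and multilinear blocks form a functional on Boolean functions on the
  six-dimensional space, under which \<open>\<xi>\<close> corresponds to the indicator of the nonzero vectors; this
  function is invariant under every invertible map.

  \<^bold>\<open>No other invariant.\<close>  Scalars are extended to an algebraic closure, and the variables are
  replaced by the eigenbasis \<open>Z\<^sub>0, \<dots>, Z\<^sub>5\<close> of a cyclic subgroup of order 63 of the general linear
  group, namely multiplication by a generator \<open>\<beta>\<close> of the field with 64 elements.  Here the total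
  square is \<open>Z\<^sub>j \<mapsto> Z\<^sub>j + Z\<^sub>j\<^sub>-\<^sub>1\<^sup>2 t\<close>.  The generator of the subgroup multiplies a monomial by a power of
  \<open>\<beta>\<close>, so averaging over the subgroup, which has odd order, makes every invariant class a class of
  monomials of weight divisible by 63 (\<open>torus_average\<close>).  The tables of squares below reduce these
  monomials to 31 of them: the monomial \<open>bottom\<close> and the six cyclic rotations of each of five others
  (\<open>weight_zero_part_spanned\<close>).  Invariance under the Frobenius automorphism, tested by functionals
  that vanish on hit elements, makes the coefficients constant on rotations (\<open>frobenius_coeffs\<close>);
  invariance under a circulant matrix, tested in the same way, gives five linear equations which
  make these five constants vanish (\<open>circulant_coeffs\<close>).  So every invariant of degree 15 is a
  multiple of the class of \<open>bottom\<close> over the large field (\<open>invariant_toK\<close>).  The element \<open>\<xi>\<close> is not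
  hit, because no square produces \<open>x\<^sub>0\<^sup>1\<^sup>5\<close> (\<open>\<xi>_not_hit\<close>); hence every invariant is a multiple of the
  class of \<open>\<xi>\<close> over the large field.  A linear retraction of that field to the field with two
  elements sends hit elements to hit elements (\<open>descend_hitK\<close>) and turns the multiple into one over
  the small field.

  \<^bold>\<open>The blocks.\<close>  A permutation fixes a monomial if and only if it preserves the fibres of its
  exponent function, so the stabilizer is the product of the symmetric groups of those fibres that
  have several points, and the size of the orbit follows from the orbit-stabilizer theorem.
\<close>

(* The letter X denotes the variables of P6 throughout. *)
no_notation Polynomials.var (\<open>X\<index>\<close>)

abbreviation lookup :: "('a \<Rightarrow>\<^sub>0 'b::zero) \<Rightarrow> 'a \<Rightarrow> 'b" where
  "lookup \<equiv> Poly_Mapping.lookup"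

abbreviation single :: "'a \<Rightarrow> 'b::zero \<Rightarrow> 'a \<Rightarrow>\<^sub>0 'b" where
  "single \<equiv> Poly_Mapping.single"

abbreviation keys :: "('a \<Rightarrow>\<^sub>0 'b::zero) \<Rightarrow> 'a set" where
  "keys \<equiv> Poly_Mapping.keys"

section \<open>Steenrod squares of monomials\<close>

lemma of_nat_char2:
  assumes "(1::'r::comm_ring_1) + 1 = 0"
  shows "(of_nat n :: 'r) = of_bool (odd n)"
  using assms by (induction n) (auto simp: add.commute)

lemma odd_binomial_le: "odd (n choose j) \<Longrightarrow> j \<le> n"
  by (metis binomial_eq_0 even_zero not_le)

text \<open>The digit rule of Lucas for the prime two: the last binary digits of both arguments split off.\<close>

lemma odd_binomial_double:
  "odd ((2 * n) choose (2 * m)) \<longleftrightarrow> odd (n choose m)"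
  "even ((2 * n) choose (Suc (2 * m)))"
  "odd (Suc (2 * n) choose (2 * m)) \<longleftrightarrow> odd (n choose m)"
  "odd (Suc (2 * n) choose (Suc (2 * m))) \<longleftrightarrow> odd (n choose m)"
proof (induction n arbitrary: m)
  case 0
  { case 1 show ?case by (cases m) auto
  next case 2 show ?case by simp
  next case 3 show ?case by (cases m) auto
  next case 4 show ?case by (cases m) auto }
next
  case (Suc n)
  have A: "odd ((2 * Suc n) choose (2 * m)) \<longleftrightarrow> odd (Suc n choose m)" for m
  proof (cases m)
    case (Suc m')
    then show ?thesis
      using Suc.IH(3)[of m] Suc.IH(4)[of m'] binomial_Suc_Suc[of "Suc (2 * n)" "Suc (2 * m')"]
        binomial_Suc_Suc[of n m'] by (simp del: binomial_Suc_Suc)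
  qed simp
  have B: "even ((2 * Suc n) choose (Suc (2 * m)))" for m
    using Suc.IH(3)[of m] Suc.IH(4)[of m] binomial_Suc_Suc[of "Suc (2 * n)" "2 * m"]
    by (simp del: binomial_Suc_Suc)
  { case 1 show ?case by (rule A)
  next case 2 show ?case by (rule B)
  next case 3 show ?case
    proof (cases m)
      case (Suc m')
      then show ?thesis using A[of m] B[of m'] binomial_Suc_Suc[of "2 * Suc n" "Suc (2 * m')"]
        by (simp del: binomial_Suc_Suc)
    qed simp
  next case 4 show ?case using A[of m] B[of m] binomial_Suc_Suc[of "2 * Suc n" "2 * m"]
      by (simp del: binomial_Suc_Suc) }
qed

text \<open>A list rather than a set, built by the digit rule, so that the tables of squares can be evaluated by rewriting.\<close>

fun odd_binoms :: "nat \<Rightarrow> nat list" where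
  "odd_binoms n = (if n = 0 then [0]
     else if even n then map (\<lambda>j. 2 * j) (odd_binoms (n div 2))
     else concat (map (\<lambda>j. [2 * j, Suc (2 * j)]) (odd_binoms (n div 2))))"

declare odd_binoms.simps [simp del]

lemma set_odd_binoms: "set (odd_binoms n) = {j. odd (n choose j)}"
proof (induction n rule: odd_binoms.induct)
  case (1 n)
  have *: "(\<forall>j. P j) \<longleftrightarrow> (\<forall>m. P (2 * m) \<and> P (Suc (2 * m)))" for P :: "nat \<Rightarrow> bool"
    by (metis evenE oddE Suc_eq_plus1)
  consider "n = 0" | m where "n = 2 * m" "n \<noteq> 0" | m where "n = Suc (2 * m)"
    by (metis evenE oddE Suc_eq_plus1)
  then show ?case
  proof cases
    case 1
    then show ?thesis by (auto simp: odd_binoms.simps dest: odd_binomial_le)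
  next
    case (2 m)
    then have "set (odd_binoms m) = {j. odd (m choose j)}" using "1.IH"(1) by simp
    then have "set (odd_binoms n) = (\<lambda>j. 2 * j) ` {j. odd (m choose j)}"
      using 2 by (subst odd_binoms.simps) simp
    then show ?thesis
      by (subst set_eq_iff, subst *) (auto simp: 2 odd_binomial_double, presburger)
  next
    case (3 m)
    then have "set (odd_binoms m) = {j. odd (m choose j)}" using "1.IH"(2) by simp
    then have "set (odd_binoms n) = (\<Union>j\<in>{j. odd (m choose j)}. {2 * j, Suc (2 * j)})"
      using 3 by (subst odd_binoms.simps) simp
    then show ?thesis
      by (subst set_eq_iff, subst *) (auto simp: 3 odd_binomial_double simp del: binomial_Suc_Suc, presburger+)
  qed
qed

lemma distinct_odd_binoms: "distinct (odd_binoms n)"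
proof (induction n rule: odd_binoms.induct)
  case (1 n)
  have "distinct (concat (map (\<lambda>j. [2 * j, Suc (2 * j)]) xs))" if "distinct xs" for xs
    using that by (induction xs) (auto, presburger+)
  with 1 show ?case
    by (subst odd_binoms.simps) (auto simp: distinct_map inj_on_def)
qed

lemma odd_binoms_table:
  "odd_binoms 0 = [0]" "odd_binoms (Suc 0) = [0,1]" "odd_binoms 2 = [0,2]" "odd_binoms 3 = [0,1,2,3]"
  "odd_binoms 4 = [0,4]" "odd_binoms 5 = [0,1,4,5]" "odd_binoms 6 = [0,2,4,6]"
  "odd_binoms 7 = [0,1,2,3,4,5,6,7]" "odd_binoms 8 = [0,8]" "odd_binoms 9 = [0,1,8,9]"
  "odd_binoms 10 = [0,2,8,10]" "odd_binoms 11 = [0,1,2,3,8,9,10,11]" "odd_binoms 12 = [0,4,8,12]"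
  "odd_binoms 13 = [0,1,4,5,8,9,12,13]" "odd_binoms 14 = [0,2,4,6,8,10,12,14]"
  by (simp_all add: odd_binoms.simps)

lemma odd_binoms_le: "j \<in> set (odd_binoms n) \<Longrightarrow> j \<le> n"
  by (auto simp: set_odd_binoms odd_binomial_le)

text \<open>The exponent patterns that contribute to one coefficient of a product: one choice from each list, with prescribed sum.\<close>

fun lists_with_sum :: "nat \<Rightarrow> nat list list \<Rightarrow> nat list list" where
  "lists_with_sum k [] = (if k = 0 then [[]] else [])"
| "lists_with_sum k (xs # xss) =
     concat (map (\<lambda>x. if x \<le> k then map ((#) x) (lists_with_sum (k - x) xss) else []) xs)"

lemma set_lists_with_sum:
  "js \<in> set (lists_with_sum k xss) \<longleftrightarrow> list_all2 (\<lambda>j xs. j \<in> set xs) js xss \<and> sum_list js = k"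
  by (induction xss arbitrary: k js) (auto simp: list_all2_Cons2 image_iff)

definition pw :: "'r::comm_monoid_mult list \<Rightarrow> nat list \<Rightarrow> 'r" where
  "pw ys a = prod_list (map2 power ys a)"

lemma pw_Nil [simp]: "pw [] a = 1" "pw ys [] = 1"
  by (simp_all add: pw_def)

lemma pw_Cons [simp]: "pw (y # ys) (n # a) = y ^ n * pw ys a"
  by (simp add: pw_def)

lemma coeff_linear_power:
  "poly.coeff ([:y, w:] ^ n) j = of_nat (n choose j) * (y ^ (n - j) * (w::'r::comm_ring_1) ^ j)"
proof (cases "j \<le> n")
  case True
  then show ?thesis by (simp add: coeff_linear_poly_power ac_simps)
next
  case False
  have "Polynomial.degree ([:y, w:] ^ n) \<le> n"
    using degree_power_le[of "[:y, w:]" n] by (rule order_trans) (simp add: degree_pCons_le)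
  then have "poly.coeff ([:y, w:] ^ n) j = 0" using False by (intro coeff_eq_0) simp
  then show ?thesis using False by (simp add: binomial_eq_0)
qed

text \<open>Modulo two only the odd binomial coefficients survive in a product of powers of linear
  polynomials; the exponent list \<open>js\<close> records how often the second coefficient is chosen.\<close>

lemma coeff_pw_linear:
  fixes ys ws :: "'r::comm_ring_1 list"
  assumes char2: "(1::'r) + 1 = 0" and "length ys = length b" "length ws = length b"
  shows "poly.coeff (pw (map2 (\<lambda>y w. [:y, w:]) ys ws) b) k =
    (\<Sum>js\<leftarrow>lists_with_sum k (map odd_binoms b). pw ys (map2 (-) b js) * pw ws js)"
  using assms(2,3)
proof (induction b arbitrary: ys ws k)
  case Nil
  then show ?case by (simp add: coeff_1)
next
  case (Cons n b)
  then obtain y ys' w ws' where eq: "ys = y # ys'" "ws = w # ws'"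
      "length ys' = length b" "length ws' = length b"
    by (auto simp: length_Suc_conv)
  let ?Q = "pw (map2 (\<lambda>y w. [:y, w:]) ys' ws') b"
  let ?h = "\<lambda>j. y ^ (n - j) * w ^ j * poly.coeff ?Q (k - j)"
  have fin: "finite {j. odd (n choose j)}"
    using set_odd_binoms by (metis List.finite_set)
  have "poly.coeff (pw (map2 (\<lambda>y w. [:y, w:]) ys ws) (n # b)) k
      = (\<Sum>j\<le>k. of_bool (odd (n choose j)) * ?h j)"
    by (simp add: eq coeff_mult coeff_linear_power of_nat_char2[OF char2] mult.assoc)
  also have "\<dots> = (\<Sum>j\<in>{j. odd (n choose j) \<and> j \<le> k}. ?h j)"
    by (rule sum.mono_neutral_cong_right)
       auto
  also have "\<dots> = (\<Sum>j\<in>set (odd_binoms n). if j \<le> k then ?h j else 0)"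
    using fin by (intro sum.mono_neutral_cong_left) (auto simp: set_odd_binoms)
  also have "\<dots> = (\<Sum>j\<leftarrow>odd_binoms n. if j \<le> k then ?h j else 0)"
    by (simp add: sum_list_distinct_conv_sum_set distinct_odd_binoms)
  also have "\<dots> = (\<Sum>j\<leftarrow>odd_binoms n. if j \<le> k then
      (\<Sum>js\<leftarrow>lists_with_sum (k - j) (map odd_binoms b).
         y ^ (n - j) * w ^ j * (pw ys' (map2 (-) b js) * pw ws' js)) else 0)"
    by (simp add: Cons.IH[OF eq(3,4)] sum_list_const_mult cong: if_cong)
  also have "\<dots> = (\<Sum>js\<leftarrow>lists_with_sum k (map odd_binoms (n # b)).
      pw ys (map2 (-) (n # b) js) * pw ws js)"
  proof -
    have "(\<Sum>js\<leftarrow>concat (map (\<lambda>j. if j \<le> k then map ((#) j) (f (k - j)) else []) xs). g js)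
        = (\<Sum>j\<leftarrow>xs. if j \<le> k then (\<Sum>js\<leftarrow>f (k - j). g (j # js)) else 0)"
      for f :: "nat \<Rightarrow> nat list list" and g :: "nat list \<Rightarrow> 'r" and xs
      by (induction xs) (auto simp: o_def)
    from this[where f = "\<lambda>k. lists_with_sum k (map odd_binoms b)" and xs = "odd_binoms n"
        and g = "\<lambda>js. pw ys (map2 (-) (n # b) js) * pw ws js"]
    show ?thesis by (simp add: eq mult_ac cong: if_cong)
  qed
  finally show ?case .
qed

subsection \<open>Squares of monomials in linear forms\<close>

definition Sq_exponents :: "nat \<Rightarrow> nat list \<Rightarrow> nat list list" where
  "Sq_exponents k b = map (map2 (+) b) (lists_with_sum k (map odd_binoms b))"

text \<open>The forms of degree one, characterized by the only property of them that matters for the squares.\<close>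

definition linear_form :: "P6 \<Rightarrow> bool" where
  "linear_form y \<longleftrightarrow> total_Sq y = [:y, y\<^sup>2:]"

lemma total_Sq_mult: "total_Sq (f * g) = total_Sq f * total_Sq g"
  by (simp add: total_Sq_def eval_poly_mult[OF P6_poly_char2])

lemma total_Sq_add: "total_Sq (f + g) = total_Sq f + total_Sq g"
  by (simp add: total_Sq_def eval_poly_add[OF P6_poly_char2])

lemma total_Sq_power: "total_Sq (f ^ n) = total_Sq f ^ n"
  by (induction n) (simp_all add: total_Sq_mult, simp add: total_Sq_def)

lemma total_Sq_pw: "length ys = length b \<Longrightarrow> total_Sq (pw ys b) = pw (map total_Sq ys) b"
  by (induction ys b rule: list_induct2) (simp_all add: total_Sq_mult total_Sq_power, simp add: total_Sq_def)

lemma linear_form_X: "linear_form (X i)"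
  by (simp add: linear_form_def total_Sq_def)

lemma linear_form_0: "linear_form 0"
  by (simp add: linear_form_def total_Sq_def)

lemma linear_form_add: "linear_form y \<Longrightarrow> linear_form z \<Longrightarrow> linear_form (y + z)"
  by (simp add: linear_form_def total_Sq_add P6_square_add)

lemma linear_form_sum: "(\<And>i. i \<in> I \<Longrightarrow> linear_form (f i)) \<Longrightarrow> linear_form (\<Sum>i\<in>I. f i)"
  by (induction I rule: infinite_finite_induct) (simp_all add: linear_form_0 linear_form_add)

lemma pw_sub_square:
  assumes "length ys = length b" "list_all2 (\<lambda>j n. j \<le> n) js b"
  shows "pw ys (map2 (-) b js) * pw (map (\<lambda>y. y\<^sup>2) ys) js = pw ys (map2 (+) b js)"
  using assms
proof (induction ys b arbitrary: js rule: list_induct2)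
  case (Cons y ys n b)
  then obtain j js' where js: "js = j # js'" "j \<le> n" "list_all2 (\<lambda>j n. j \<le> n) js' b"
    by (auto simp: list_all2_Cons2)
  have "y ^ (n - j) * (y\<^sup>2) ^ j = y ^ (n + j)"
    using js(2) by (simp add: add.commute flip: power_mult power_add)
  with Cons.IH[OF js(3)] show ?case
    by (simp add: js(1)) (metis (no_types, lifting) mult.assoc mult.left_commute)
qed simp

text \<open>The total square of a linear form \<open>y\<close> is \<open>y + y\<^sup>2 t\<close>, so a square of a monomial in linear forms is
  again a sum of such monomials, with the same exponents as for variables.  All relations below are
  therefore relations between lists of exponents that hold for arbitrary linear forms.\<close>

lemma Sq_pw:
  assumes "list_all linear_form ys" "length ys = length b"
  shows "Sq k (pw ys b) = (\<Sum>a\<leftarrow>Sq_exponents k b. pw ys a)"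
proof -
  have "map total_Sq ys = map2 (\<lambda>y w. [:y, w:]) ys (map (\<lambda>y. y\<^sup>2) ys)"
    using assms(1) by (induction ys) (auto simp: linear_form_def)
  then have "Sq k (pw ys b) = (\<Sum>js\<leftarrow>lists_with_sum k (map odd_binoms b).
      pw ys (map2 (-) b js) * pw (map (\<lambda>y. y\<^sup>2) ys) js)"
    by (simp add: Sq_def total_Sq_pw assms(2) coeff_pw_linear[OF P6_char2])
  also have "\<dots> = (\<Sum>js\<leftarrow>lists_with_sum k (map odd_binoms b). pw ys (map2 (+) b js))"
    by (intro arg_cong[where f = sum_list] map_cong refl pw_sub_square assms)
       (auto simp: set_lists_with_sum list_all2_map2 elim!: list_all2_mono odd_binoms_le)
  finally show ?thesis by (simp add: Sq_exponents_def o_def)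
qed

section \<open>Relations between classes of monomials in linear forms\<close>

lemma qclass_eq_iff: "qclass f = qclass g \<longleftrightarrow> f - g \<in> hit"
  by transfer (rule refl)

lemma qclass_add: "qclass (f + g) = qclass f + qclass g"
  by transfer (simp add: hit_zero)

lemma qclass_zero [simp]: "qclass 0 = 0"
  by transfer (simp add: hit_zero)

lemma qclass_sum_list: "qclass (sum_list fs) = sum_list (map qclass fs)"
  by (induction fs) (simp_all add: qclass_add)

lemma qclass_sum: "qclass (\<Sum>i\<in>I. f i) = (\<Sum>i\<in>I. qclass (f i))"
  by (induction I rule: infinite_finite_induct) (simp_all add: qclass_add)

lemma steenrod_aug_hit: "\<theta> \<in> steenrod_aug \<Longrightarrow> \<theta> f \<in> hit"
  unfolding hit_def by (rule P.span_base) blast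

lemma qclass_eq_0_iff: "qclass f = 0 \<longleftrightarrow> f \<in> hit"
  using qclass_eq_iff[of f 0] by simp

lemma qclass_Sq: "k > 0 \<Longrightarrow> qclass (Sq k f) = 0"
  by (simp add: qclass_eq_0_iff steenrod_aug_hit steenrod_aug.Sq)

lemma P6_add_self: "f + f = (0::P6)"
  by (rule char2_add_self[OF P6_char2])

lemma QP6_add_self: "q + q = (0::QP6)"
proof -
  obtain f where "q = qclass f"
    by (induction q rule: QP6.abs_induct) (auto simp flip: qclass.abs_eq)
  then show ?thesis by (metis qclass_add P6_add_self qclass_zero)
qed

lemma QP6_eq_iff: "p = q \<longleftrightarrow> p + q = (0::QP6)"
  by (metis QP6_add_self add_left_imp_eq)

text \<open>A decidable form of vanishing in characteristic two: a sum is zero as soon as its terms cancel in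
  pairs.  Every explicit computation below is the verification of one instance by rewriting.\<close>

function pairs_off :: "'a list \<Rightarrow> bool" where
  "pairs_off [] = True"
| "pairs_off (x # xs) = (x \<in> set xs \<and> pairs_off (remove1 x xs))"
  by pat_completeness auto
termination
  by (relation "measure length") (auto simp: length_remove1)

lemma sum_list_pairs_off:
  fixes h :: "'a \<Rightarrow> 'b::ab_group_add"
  assumes "\<And>x. h x + h x = 0" "pairs_off xs"
  shows "sum_list (map h xs) = 0"
  using assms(2)
proof (induction xs rule: pairs_off.induct)
  case (2 x xs)
  then have "sum_list (map h xs) = h x + sum_list (map h (remove1 x xs))"
    using sum_list_map_remove1[of x xs h] by simp
  with 2 assms(1)[of x] show ?case by simp
qed simp

text \<open>To verify a relation between classes it suffices to name the squares \<open>cs\<close> whose terms cancel it.\<close>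

lemma qclass_relation:
  assumes "list_all linear_form ys"
    "list_all (\<lambda>(k, b). k > 0 \<and> length b = length ys) cs"
    "pairs_off (as @ concat (map (\<lambda>(k, b). Sq_exponents k b) cs))"
  shows "qclass (\<Sum>a\<leftarrow>as. pw ys a) = 0"
proof -
  have "(\<Sum>a\<leftarrow>as @ concat (map (\<lambda>(k, b). Sq_exponents k b) cs). qclass (pw ys a)) = 0"
    by (rule sum_list_pairs_off[OF QP6_add_self assms(3)])
  moreover have "(\<Sum>a\<leftarrow>concat (map (\<lambda>(k, b). Sq_exponents k b) cs). qclass (pw ys a)) = 0"
    using assms(2)
  proof (induction cs)
    case (Cons c cs)
    obtain k b where "c = (k, b)" by force
    then show ?case
      using Cons qclass_Sq[of k "pw ys b"]
      by (simp add: Sq_pw[OF assms(1)] qclass_sum_list o_def)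
  qed simp
  ultimately show ?thesis by (simp add: qclass_sum_list o_def)
qed

lemma qclass_pw_eq:
  assumes "pairs_off (a # a' # concat (map (\<lambda>(k, b). Sq_exponents k b) cs))"
    "list_all (\<lambda>(k, b). k > 0 \<and> length b = length ys) cs" "list_all linear_form ys"
  shows "qclass (pw ys a) = qclass (pw ys a')"
  using qclass_relation[OF assms(3,2), of "[a, a']"] assms(1)
  by (subst QP6_eq_iff) (simp add: qclass_add)


subsection \<open>Blocks\<close>

text \<open>The blocks of \<open>\<xi>\<close>; an empty list in front makes the index of each block its length.\<close>

definition block_exps :: "nat \<Rightarrow> nat list" where
  "block_exps n = [[], [15], [1, 14], [1, 2, 12], [1, 2, 4, 8], [1, 2, 4, 4, 4], [1, 2, 2, 2, 4, 4]] ! n"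

lemma block_exps_simps [simp]:
  "block_exps 0 = []" "block_exps (Suc 0) = [15]" "block_exps 2 = [1, 14]" "block_exps 3 = [1, 2, 12]"
  "block_exps 4 = [1, 2, 4, 8]" "block_exps 5 = [1, 2, 4, 4, 4]" "block_exps 6 = [1, 2, 2, 2, 4, 4]"
  by (simp_all add: block_exps_def)

definition block :: "P6 list \<Rightarrow> QP6" where
  "block ys = qclass (pw ys (block_exps (length ys)))"

lemma list_cases_le_6:
  assumes "length ys \<le> 6"
  obtains "ys = []" | a where "ys = [a]" | a b where "ys = [a, b]" | a b c where "ys = [a, b, c]"
  | a b c d where "ys = [a, b, c, d]" | a b c d e where "ys = [a, b, c, d, e]"
  | a b c d e f where "ys = [a, b, c, d, e, f]"
proof -
  have "length ys = 0 \<or> length ys = 1 \<or> length ys = 2 \<or> length ys = 3 \<or> length ys = 4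
      \<or> length ys = 5 \<or> length ys = 6"
    using assms by arith
  then show thesis
    using that by (auto simp: length_Suc_conv numeral_eq_Suc)
qed

lemma length_block_exps: "n \<le> 6 \<Longrightarrow> length (block_exps n) = n"
proof -
  assume "n \<le> 6"
  then consider "n = 0" | "n = 1" | "n = 2" | "n = 3" | "n = 4" | "n = 5" | "n = 6" by linarith
  then show ?thesis by cases simp_all
qed

text \<open>Neighbouring unequal exponents in a block may be exchanged.  Together with the equal neighbours
  these transpositions generate all permutations, which is why blocks are symmetric.\<close>

lemma qclass_swap_exponents:
  assumes "list_all linear_form ys"
  shows
    "length ys = 2 \<Longrightarrow> qclass (pw ys [14, 1]) = qclass (pw ys [1, 14])"
    "length ys = 3 \<Longrightarrow> qclass (pw ys [2, 1, 12]) = qclass (pw ys [1, 2, 12])"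
    "length ys = 3 \<Longrightarrow> qclass (pw ys [1, 12, 2]) = qclass (pw ys [1, 2, 12])"
    "length ys = 4 \<Longrightarrow> qclass (pw ys [2, 1, 4, 8]) = qclass (pw ys [1, 2, 4, 8])"
    "length ys = 4 \<Longrightarrow> qclass (pw ys [1, 4, 2, 8]) = qclass (pw ys [1, 2, 4, 8])"
    "length ys = 4 \<Longrightarrow> qclass (pw ys [1, 2, 8, 4]) = qclass (pw ys [1, 2, 4, 8])"
    "length ys = 5 \<Longrightarrow> qclass (pw ys [2, 1, 4, 4, 4]) = qclass (pw ys [1, 2, 4, 4, 4])"
    "length ys = 5 \<Longrightarrow> qclass (pw ys [1, 4, 2, 4, 4]) = qclass (pw ys [1, 2, 4, 4, 4])"
    "length ys = 6 \<Longrightarrow> qclass (pw ys [2, 1, 2, 2, 4, 4]) = qclass (pw ys [1, 2, 2, 2, 4, 4])"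
    "length ys = 6 \<Longrightarrow> qclass (pw ys [1, 2, 2, 4, 2, 4]) = qclass (pw ys [1, 2, 2, 2, 4, 4])"
proof -
  note simps = Sq_exponents_def odd_binoms_table
  show "qclass (pw ys [14, 1]) = qclass (pw ys [1, 14])" if "length ys = 2"
    by (rule qclass_pw_eq[OF _ _ assms, where cs = "[(1, [13, 1]), (2, [11, 2]), (4, [7, 4]), (1, [7, 7]), (4, [4, 7]), (2, [2, 11]), (1, [1, 13])]"])
       (use that in \<open>simp_all add: simps\<close>)
  show "qclass (pw ys [2, 1, 12]) = qclass (pw ys [1, 2, 12])" if "length ys = 3"
    by (rule qclass_pw_eq[OF _ _ assms, where cs = "[(1, [1, 1, 12])]"])
       (use that in \<open>simp_all add: simps\<close>)
  show "qclass (pw ys [1, 12, 2]) = qclass (pw ys [1, 2, 12])" if "length ys = 3"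
    by (rule qclass_pw_eq[OF _ _ assms, where cs = "[(2, [1, 10, 2]), (4, [1, 6, 4]), (2, [1, 6, 6]), (4, [1, 4, 6]), (2, [1, 2, 10])]"])
       (use that in \<open>simp_all add: simps\<close>)
  show "qclass (pw ys [2, 1, 4, 8]) = qclass (pw ys [1, 2, 4, 8])" if "length ys = 4"
    by (rule qclass_pw_eq[OF _ _ assms, where cs = "[(1, [1, 1, 4, 8])]"])
       (use that in \<open>simp_all add: simps\<close>)
  show "qclass (pw ys [1, 4, 2, 8]) = qclass (pw ys [1, 2, 4, 8])" if "length ys = 4"
    by (rule qclass_pw_eq[OF _ _ assms, where cs = "[(2, [1, 2, 2, 8])]"])
       (use that in \<open>simp_all add: simps\<close>)
  show "qclass (pw ys [1, 2, 8, 4]) = qclass (pw ys [1, 2, 4, 8])" if "length ys = 4"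
    by (rule qclass_pw_eq[OF _ _ assms, where cs = "[(4, [1, 2, 4, 4])]"])
       (use that in \<open>simp_all add: simps\<close>)
  show "qclass (pw ys [2, 1, 4, 4, 4]) = qclass (pw ys [1, 2, 4, 4, 4])" if "length ys = 5"
    by (rule qclass_pw_eq[OF _ _ assms, where cs = "[(1, [1, 1, 4, 4, 4])]"])
       (use that in \<open>simp_all add: simps\<close>)
  show "qclass (pw ys [1, 4, 2, 4, 4]) = qclass (pw ys [1, 2, 4, 4, 4])" if "length ys = 5"
    by (rule qclass_pw_eq[OF _ _ assms, where cs = "[(2, [1, 2, 2, 4, 4])]"])
       (use that in \<open>simp_all add: simps\<close>)
  show "qclass (pw ys [2, 1, 2, 2, 4, 4]) = qclass (pw ys [1, 2, 2, 2, 4, 4])" if "length ys = 6"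
    by (rule qclass_pw_eq[OF _ _ assms, where cs = "[(1, [1, 1, 2, 2, 4, 4])]"])
       (use that in \<open>simp_all add: simps\<close>)
  show "qclass (pw ys [1, 2, 2, 4, 2, 4]) = qclass (pw ys [1, 2, 2, 2, 4, 4])" if "length ys = 6"
    by (rule qclass_pw_eq[OF _ _ assms, where cs = "[(2, [1, 1, 1, 4, 2, 4]), (1, [2, 1, 1, 4, 2, 4]), (2, [1, 1, 1, 2, 4, 4]), (1, [2, 1, 1, 2, 4, 4])]"])
       (use that in \<open>simp_all add: simps\<close>)
qed

text \<open>If the first two forms of a block coincide, their exponents 1 and 2 add up to 3.  The result is
  congruent to the block that is shorter by one.\<close>

lemma qclass_merge_exponents:
  assumes "list_all linear_form ys"
  shows
    "length ys = 2 \<Longrightarrow> qclass (pw ys [3, 12]) = qclass (pw ys [1, 14])"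
    "length ys = 3 \<Longrightarrow> qclass (pw ys [3, 4, 8]) = qclass (pw ys [1, 2, 12])"
    "length ys = 4 \<Longrightarrow> qclass (pw ys [3, 4, 4, 4]) = qclass (pw ys [1, 2, 4, 8])"
    "length ys = 5 \<Longrightarrow> qclass (pw ys [3, 2, 2, 4, 4]) = qclass (pw ys [1, 2, 4, 4, 4])"
proof -
  note simps = Sq_exponents_def odd_binoms_table
  show "qclass (pw ys [3, 12]) = qclass (pw ys [1, 14])" if "length ys = 2"
    by (rule qclass_pw_eq[OF _ _ assms, where cs = "[(1, [3, 11]), (2, [2, 11]), (1, [1, 13])]"])
       (use that in \<open>simp_all add: simps\<close>)
  show "qclass (pw ys [3, 4, 8]) = qclass (pw ys [1, 2, 12])" if "length ys = 3"
    by (rule qclass_pw_eq[OF _ _ assms, where cs = "[(1, [3, 4, 7]), (2, [2, 4, 7]), (1, [1, 4, 9]), (2, [1, 2, 10])]"])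
       (use that in \<open>simp_all add: simps\<close>)
  show "qclass (pw ys [3, 4, 4, 4]) = qclass (pw ys [1, 2, 4, 8])" if "length ys = 4"
    by (rule qclass_pw_eq[OF _ _ assms, where cs = "[(1, [3, 4, 3, 4]), (1, [1, 2, 3, 8]), (4, [2, 2, 3, 4]), (2, [2, 2, 5, 4])]"])
       (use that in \<open>simp_all add: simps\<close>)
  show "qclass (pw ys [3, 2, 2, 4, 4]) = qclass (pw ys [1, 2, 4, 4, 4])" if "length ys = 5"
    by (rule qclass_pw_eq[OF _ _ assms, where cs = "[(1, [3, 1, 2, 4, 4]), (2, [2, 1, 2, 4, 4]), (1, [1, 1, 4, 4, 4])]"])
       (use that in \<open>simp_all add: simps\<close>)
qed

lemma pw_swap:
  assumes "length as = length es"
  shows "pw (as @ b # a # bs) (es @ m # n # fs) = pw (as @ a # b # bs) (es @ n # m # fs)"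
  using assms by (induction as es rule: list_induct2) (simp_all add: mult.left_commute)

lemma block_swap:
  assumes "list_all linear_form (as @ a # b # bs)" "length (as @ a # b # bs) \<le> 6"
  shows "block (as @ b # a # bs) = block (as @ a # b # bs)"
proof -
  define n i E where "n = length (as @ a # b # bs)" and "i = length as" and "E = block_exps n"
  have range: "n \<le> 6" "Suc i < n" using assms(2) by (auto simp: n_def i_def)
  have "length E = n"
    unfolding E_def using range(1) by (rule length_block_exps)
  then have E: "E = take i E @ E ! i # E ! Suc i # drop (Suc (Suc i)) E"
    using range(2) by (simp add: Cons_nth_drop_Suc)
  have upd: "E[i := E ! Suc i, Suc i := E ! i] = take i E @ E ! Suc i # E ! i # drop (Suc (Suc i)) E"
    using range(2) \<open>length E = n\<close>
    by (subst (1) E) (simp add: list_update_append min_def split: nat.splits)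
  have "block (as @ b # a # bs) = qclass (pw (as @ b # a # bs) E)"
    by (simp add: block_def E_def n_def)
  also have "\<dots> = qclass (pw (as @ a # b # bs) (E[i := E ! Suc i, Suc i := E ! i]))"
    unfolding upd by (subst (1) E, subst pw_swap) (use range \<open>length E = n\<close> in \<open>simp_all add: i_def\<close>)
  also have "\<dots> = qclass (pw (as @ a # b # bs) E)"
  proof -
    have "n = 2 \<or> n = 3 \<or> n = 4 \<or> n = 5 \<or> n = 6" using range by linarith
    then have *: "n = 2 \<and> i = 0 \<or> n = 3 \<and> (i = 0 \<or> i = 1) \<or> n = 4 \<and> (i = 0 \<or> i = 1 \<or> i = 2)
        \<or> n = 5 \<and> (i = 0 \<or> i = 1 \<or> i = 2 \<or> i = 3)
        \<or> n = 6 \<and> (i = 0 \<or> i = 1 \<or> i = 2 \<or> i = 3 \<or> i = 4)"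
      using range(2) by (elim disjE) (auto simp: numeral_eq_Suc less_Suc_eq)
    show ?thesis
    proof -
      define zs where "zs = as @ a # b # bs"
      have "length zs = n" by (simp add: zs_def n_def)
      then show ?thesis
        using qclass_swap_exponents[of zs] assms(1) * unfolding zs_def[symmetric]
        by (elim disjE conjE) (simp_all add: E_def)
    qed
  qed
  finally show ?thesis by (simp add: block_def E_def n_def)
qed

lemma list_all_linear_form_mset:
  "mset xs = mset ys \<Longrightarrow> list_all linear_form xs = list_all linear_form ys"
  by (metis list_all_iff mset_eq_setD)

text \<open>Induction along the list, one neighbouring exchange at a time.\<close>

lemma block_move_front:
  assumes "list_all linear_form (ps @ as @ x # bs)" "length (ps @ as @ x # bs) \<le> 6"
  shows "block (ps @ as @ x # bs) = block (ps @ x # as @ bs)"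
  using assms
proof (induction as arbitrary: bs rule: rev_induct)
  case (snoc a as)
  have "block (ps @ (as @ [a]) @ x # bs) = block ((ps @ as) @ x # a # bs)"
    using block_swap[of "ps @ as" x a bs] snoc.prems by simp
  also have "\<dots> = block (ps @ x # as @ a # bs)"
    using snoc.IH[of "a # bs"] snoc.prems by simp
  finally show ?case by simp
qed simp

lemma block_permute:
  assumes "mset xs = mset ys" "list_all linear_form xs" "length xs \<le> 6"
  shows "block xs = block ys"
proof -
  have "block (ps @ xs) = block (ps @ ys)"
    if "mset xs = mset ys" "list_all linear_form (ps @ xs)" "length (ps @ xs) \<le> 6" for ps
    using that
  proof (induction xs arbitrary: ps ys)
    case (Cons x xs)
    then have "x \<in> set ys" by (metis list.set_intros(1) mset_eq_setD)
    then obtain as bs where ys: "ys = as @ x # bs" by (auto simp: in_set_conv_decomp)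
    with Cons.prems(1) have m: "mset xs = mset (as @ bs)" by simp
    then have len: "length xs = length as + length bs" by (metis size_mset length_append)
    have "list_all linear_form (as @ bs)"
      using Cons.prems(2) list_all_linear_form_mset[OF m] by simp
    then have "block (ps @ ys) = block (ps @ x # as @ bs)"
      using block_move_front[of ps as x bs] Cons.prems(2,3) len by (simp add: ys)
    moreover have "block ((ps @ [x]) @ xs) = block ((ps @ [x]) @ as @ bs)"
      using Cons.IH[OF m, of "ps @ [x]"] Cons.prems(2,3) by simp
    ultimately show ?case by simp
  qed simp
  from this[of "[]"] show ?thesis using assms by simp
qed

lemma pw_merge: "pw (b # b # ys) (m # n # es) = pw (b # ys) ((m + n) # es)"
  by (simp add: power_add mult.assoc)

lemma block_merge:
  assumes "list_all linear_form (b # ys)" "length ys \<le> 4"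
  shows "block (b # b # ys) = block (b # ys)"
proof -
  have "length ys \<le> 6" using assms(2) by simp
  then show ?thesis
    using assms(2) qclass_merge_exponents[OF assms(1)]
    by (elim list_cases_le_6) (simp_all add: block_def block_exps_def pw_merge del: pw_Cons flip: numeral_3_eq_3)
qed

text \<open>In all blocks but the first the leading exponent is 1, and additivity is the distributive law.  For
  \<open>y\<^sup>1\<^sup>5\<close> all binomial coefficients are odd, and the mixed terms of \<open>(y + z)\<^sup>1\<^sup>5\<close> are the values of \<open>Sq 1\<close>
  on the \<open>y\<^sup>i z\<^sup>1\<^sup>4\<^sup>-\<^sup>i\<close> with odd \<open>i\<close>.\<close>

lemma block_add:
  assumes "list_all linear_form (y # z # ys)" "length ys \<le> 5"
  shows "block ((y + z) # ys) = block (y # ys) + block (z # ys)"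
proof (cases ys)
  case Nil
  have odd15: "odd ((15::nat) choose i) \<longleftrightarrow> i \<le> 15" for i
  proof -
    have "{i. odd ((15::nat) choose i)} = {..15}"
      by (simp add: odd_binoms.simps flip: set_odd_binoms) (auto simp: atMost_nat_numeral)
    then show ?thesis by auto
  qed
  have "(y + z) ^ 15 = (\<Sum>i\<le>15. y ^ i * z ^ (15 - i))"
    by (subst binomial_ring) (simp add: of_nat_char2[OF P6_char2] odd15)
  also have "\<dots> = (\<Sum>i\<leftarrow>[0..<16]. y ^ i * z ^ (15 - i))"
    by (subst sum_list_distinct_conv_sum_set) (auto intro!: sum.cong)
  also have "\<dots> = (\<Sum>a\<leftarrow>map (\<lambda>i. [i, 15 - i]) [0..<16]. pw [y, z] a)"
    by (simp add: o_def)
  finally have "qclass ((y + z) ^ 15 + y ^ 15 + z ^ 15)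
      = qclass (\<Sum>a\<leftarrow>map (\<lambda>i. [i, 15 - i]) [0..<16] @ [[15, 0], [0, 15]]. pw [y, z] a)"
    by (simp add: add.assoc)
  also have "\<dots> = 0"
    by (rule qclass_relation[where cs = "map (\<lambda>i. (1, [i, 14 - i])) [1, 3, 5, 7, 9, 11, 13]"])
       (use assms(1) in \<open>simp_all add: upt_rec Sq_exponents_def odd_binoms_table\<close>)
  finally show ?thesis
    by (subst QP6_eq_iff) (simp add: Nil block_def qclass_add add.assoc)
next
  case (Cons z' zs)
  have "length ys \<le> 6" using assms(2) by simp
  then have "\<exists>es. block_exps (Suc (length ys)) = 1 # es"
    using assms(2) Cons by (elim list_cases_le_6) (auto simp: block_exps_def)
  then show ?thesis
    by (auto simp: block_def distrib_right qclass_add)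
qed

section \<open>Invariance of the class of \<xi>\<close>

lemma block_0: "list_all linear_form ys \<Longrightarrow> length ys \<le> 5 \<Longrightarrow> block (0 # ys) = 0"
  using block_add[of 0 0 ys] by (simp add: linear_form_0)

definition var_sum :: "6 set \<Rightarrow> P6" where
  "var_sum T = (\<Sum>i\<in>T. X i)"

lemma linear_form_var_sum: "linear_form (var_sum T)"
  unfolding var_sum_def by (rule linear_form_sum) (rule linear_form_X)

lemma list_all_X: "list_all linear_form (map X is)"
  by (simp add: list_all_iff linear_form_X)

lemma list_all_var_sum: "list_all linear_form (map var_sum Ts)"
  by (simp add: list_all_iff linear_form_var_sum)

lemma block_var_sum_Cons:
  assumes "list_all linear_form ys" "length ys \<le> 5"
  shows "block (var_sum T # ys) = (\<Sum>i\<in>T. block (X i # ys))"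
proof (induction T rule: infinite_finite_induct)
  case (insert i T)
  have "block (var_sum (insert i T) # ys) = block ((X i + var_sum T) # ys)"
    using insert.hyps by (simp add: var_sum_def)
  then show ?case
    using insert block_add[of "X i" "var_sum T" ys] assms by (simp add: linear_form_X linear_form_var_sum)
qed (use block_0[OF assms] in \<open>auto simp: var_sum_def\<close>)

lemma finite_listset: "(\<And>T. T \<in> set Ts \<Longrightarrow> finite T) \<Longrightarrow> finite (listset Ts)"
  by (induction Ts) (auto simp: set_Cons_def intro: finite_subset[OF _ finite_imageI[of "_ \<times> _" "\<lambda>(x, xs). x # xs"]])

lemma sum_listset_Cons:
  "(\<Sum>js\<in>listset (T # Ts). f js) = (\<Sum>j\<in>T. \<Sum>js\<in>listset Ts. f (j # js))"
proof -
  have "listset (T # Ts) = (\<lambda>(j, js). j # js) ` (T \<times> listset Ts)"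
    by (auto simp: set_Cons_def)
  then show ?thesis
    by (simp add: sum.reindex inj_on_def sum.cartesian_product split_def)
qed

text \<open>Expansion by multilinearity; symmetry brings each argument to the front in turn.\<close>

lemma block_expand:
  "length is + length Ts \<le> 6 \<Longrightarrow>
     block (map X is @ map var_sum Ts) = (\<Sum>js\<in>listset Ts. block (map X (is @ js)))"
proof (induction Ts arbitrary: "is")
  case (Cons T Ts)
  have perm: "block (map X is @ y # map var_sum Ts) = block (y # map X is @ map var_sum Ts)"
    if "linear_form y" for y
    using Cons.prems that by (intro block_permute) (simp_all add: list_all_X list_all_var_sum)
  have "block (map X is @ map var_sum (T # Ts)) = block (var_sum T # map X is @ map var_sum Ts)"
    using perm[OF linear_form_var_sum] by simp
  also have "\<dots> = (\<Sum>i\<in>T. block (X i # map X is @ map var_sum Ts))"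
    using Cons.prems by (intro block_var_sum_Cons) (simp_all add: list_all_X list_all_var_sum)
  also have "\<dots> = (\<Sum>i\<in>T. block (map X (is @ [i]) @ map var_sum Ts))"
    by (simp add: perm[OF linear_form_X])
  also have "\<dots> = (\<Sum>i\<in>T. \<Sum>js\<in>listset Ts. block (map X ((is @ [i]) @ js)))"
    using Cons.prems by (intro sum.cong refl Cons.IH) simp
  finally show ?case by (simp add: sum_listset_Cons del: listset.simps)
qed simp

definition set_block :: "6 set \<Rightarrow> QP6" where
  "set_block I = block (map X (sorted_list_of_set I))"

text \<open>Repetitions can be moved together and dropped, so only the set of variables matters.\<close>

lemma block_eq_set_block: "length is \<le> 6 \<Longrightarrow> block (map X is) = set_block (set is)"
proof (induction "length is" arbitrary: "is" rule: less_induct)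
  case less
  show ?case
  proof (cases "distinct is")
    case True
    then show ?thesis unfolding set_block_def
      using less.prems by (intro block_permute)
        (simp_all add: list_all_X sorted_list_of_set_sort_remdups distinct_remdups_id)
  next
    case False
    then obtain as b bs cs where "is": "is = as @ [b] @ bs @ [b] @ cs"
      using not_distinct_decomp by blast
    have "block (map X is) = block (map X (b # b # as @ bs @ cs))"
      unfolding "is" using less.prems by (intro block_permute) (simp_all add: list_all_X "is" linear_form_X)
    also have "\<dots> = block (map X (b # as @ bs @ cs))"
      using block_merge[of "X b" "map X (as @ bs @ cs)"] less.prems "is"
      by (simp add: list_all_X linear_form_X)
    also have "\<dots> = set_block (set (b # as @ bs @ cs))"
      using less.prems "is" by (intro less.hyps) auto
    finally show ?thesis by (simp add: "is" insert_commute Un_left_commute Un_assoc)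
  qed
qed

lemma lin_subst_X_var_sum: "lin_subst A (X j) = var_sum {i. A $ i $ j = 1}"
proof -
  have "lin_subst A (X j) = (\<Sum>i\<in>UNIV. if A $ i $ j = 1 then X i else 0)"
    unfolding lin_subst_X
  proof (rule sum.cong)
    show "scaleP (A $ i $ j) (X i) = (if A $ i $ j = 1 then X i else 0)" for i
      by (cases "A $ i $ j") simp_all
  qed simp
  then show ?thesis by (simp add: var_sum_def sum.If_cases)
qed

lemma lin_subst_power: "lin_subst A (f ^ n) = lin_subst A f ^ n"
  by (induction n) (simp_all add: lin_subst_mult)

lemma lin_subst_pw: "lin_subst A (pw ys a) = pw (map (lin_subst A) ys) a"
proof (induction ys arbitrary: a)
  case (Cons y ys)
  then show ?case by (cases a) (simp_all add: lin_subst_mult lin_subst_power)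
qed simp

lemma sum_sorted_lists:
  fixes f :: "'a::{finite,linorder} list \<Rightarrow> 'b::comm_monoid_add"
  shows "(\<Sum>is | length is = n \<and> sorted_wrt (<) is. f is)
    = (\<Sum>I | card I = n. f (sorted_list_of_set I))"
proof (rule sum.reindex_bij_witness[where i = sorted_list_of_set and j = set])
  fix xs :: "'a list"
  assume "xs \<in> {xs. length xs = n \<and> sorted_wrt (<) xs}"
  then show "set xs \<in> {I. card I = n}" "sorted_list_of_set (set xs) = xs" "f (sorted_list_of_set (set xs)) = f xs"
    by (auto simp: strict_sorted_iff distinct_card sorted_list_of_set_sort_remdups
        distinct_remdups_id sorted_sort_id)
qed auto

lemma M_block_exps:
  "n \<le> 6 \<Longrightarrow> M (block_exps n) = (\<Sum>I | card I = n. pw (map X (sorted_list_of_set I)) (block_exps n))"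
proof -
  assume n: "n \<le> 6"
  note len = length_block_exps[OF n]
  have prod: "(\<Prod>j<length a. X (is ! j) ^ (a ! j)) = pw (map X is) a" if "length is = length a" for "is" a
    using that by (induction "is" a rule: list_induct2) (simp_all add: prod.lessThan_Suc_shift del: prod.lessThan_Suc)
  have "M (block_exps n) = (\<Sum>is | length is = n \<and> sorted_wrt (<) is. pw (map X is) (block_exps n))"
    unfolding M_def len by (intro sum.cong refl) (use prod[of _ "block_exps n"] in \<open>auto simp: len\<close>)
  then show ?thesis by (simp add: sum_sorted_lists)
qed

lemma \<xi>_blocks: "\<xi> = (\<Sum>n\<in>{1..6}. M (block_exps n))"
  by (simp add: \<xi>_def numeral_eq_Suc block_exps_def)

lemma sum_set_card:
  "(\<Sum>n\<in>{1..6}. \<Sum>I | card I = n. f (I::6 set)) = (\<Sum>I | I \<noteq> {}. f I)"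
proof -
  have "(\<Sum>I | I \<noteq> {}. f I) = (\<Sum>n\<in>{1..6}. \<Sum>I\<in>{I \<in> {I. I \<noteq> {}}. card I = n}. f I)"
  proof (rule sum.group[symmetric])
    show "card ` {I::6 set. I \<noteq> {}} \<subseteq> {1..6}"
      using card_mono[of "UNIV::6 set"] by (auto simp: Suc_le_eq card_gt_0_iff)
  qed auto
  also have "\<dots> = (\<Sum>n\<in>{1..6}. \<Sum>I | card I = n. f I)"
    by (intro sum.cong) auto
  finally show ?thesis ..
qed

lemma qclass_lin_subst_\<xi>:
  "qclass (lin_subst A \<xi>) =
     (\<Sum>I | I \<noteq> {}. block (map (\<lambda>j. var_sum {i. A $ i $ j = 1}) (sorted_list_of_set I)))"
proof -
  have "qclass (lin_subst A \<xi>) = (\<Sum>n\<in>{1..6}. \<Sum>I | card I = n.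
      qclass (pw (map (\<lambda>j. var_sum {i. A $ i $ j = 1}) (sorted_list_of_set I)) (block_exps n)))"
    by (simp add: \<xi>_blocks M_block_exps lin_subst_sum lin_subst_pw qclass_sum lin_subst_X_var_sum o_def)
  also have "\<dots> = (\<Sum>n\<in>{1..6}. \<Sum>I | card I = n.
      block (map (\<lambda>j. var_sum {i. A $ i $ j = 1}) (sorted_list_of_set I)))"
    by (intro sum.cong refl) (auto simp: block_def)
  finally show ?thesis by (simp only: sum_set_card)
qed

lemma qclass_\<xi>: "qclass \<xi> = (\<Sum>I | I \<noteq> {}. set_block I)"
proof -
  have "qclass \<xi> = (\<Sum>n\<in>{1..6}. \<Sum>I | card I = n. qclass (pw (map X (sorted_list_of_set I)) (block_exps n)))"
    by (simp add: \<xi>_blocks M_block_exps qclass_sum)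
  also have "\<dots> = (\<Sum>n\<in>{1..6}. \<Sum>I | card I = n. set_block I)"
    by (intro sum.cong refl) (auto simp: block_def set_block_def)
  finally show ?thesis by (simp only: sum_set_card)
qed

lemma sum_constant_QP6: "(\<Sum>x\<in>S. (q::QP6)) = (if odd (card S) then q else 0)"
  by (induction S rule: infinite_finite_induct) (auto simp: QP6_add_self)

lemma card_listset: "(\<And>T. T \<in> set Ts \<Longrightarrow> finite T) \<Longrightarrow> card (listset Ts) = (\<Prod>T\<leftarrow>Ts. card T)"
proof (induction Ts)
  case (Cons T Ts)
  have "card (listset (T # Ts)) = (\<Sum>js\<in>listset (T # Ts). 1)" by simp
  also have "\<dots> = card T * card (listset Ts)"
    by (subst sum_listset_Cons) simp
  finally show ?case using Cons by simp
qed simp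

lemma listset_Int: "listset (map (\<lambda>T. T \<inter> p) Ts) = {js \<in> listset Ts. set js \<subseteq> p}"
  by (induction Ts) (auto simp: set_Cons_def)

lemma length_listset: "js \<in> listset Ts \<Longrightarrow> length js = length Ts"
  by (induction Ts arbitrary: js) (auto simp: set_Cons_def)

text \<open>The terms of the expansion of the transformed \<open>\<xi>\<close>: a nonempty set of columns, and in each of them
  a row with a nonzero entry.\<close>

definition column_choices :: "bit^6^6 \<Rightarrow> (6 set \<times> 6 list) set" where
  "column_choices A = (SIGMA I:{I. I \<noteq> {}}. listset (map (\<lambda>j. {i. A $ i $ j = 1}) (sorted_list_of_set I)))"

lemma finite_column_choices: "finite (column_choices A)"
  unfolding column_choices_def by (intro finite_SigmaI finite_listset) auto

text \<open>Let \<open>n\<^sub>j\<close> be the number of nonzero entries of column \<open>j\<close> in rows from \<open>p\<close>.  The choices with rows in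
  \<open>p\<close> number \<open>\<Prod>\<^sub>j (n\<^sub>j + 1) - 1\<close>.  If all \<open>n\<^sub>j\<close> were even, the rows in \<open>p\<close> would sum to zero,
  against invertibility; so some factor is even.\<close>

lemma odd_column_choices_subset:
  assumes "invertible A" "p \<noteq> {}"
  shows "odd (card {c \<in> column_choices A. set (snd c) \<subseteq> p})"
proof -
  let ?T = "\<lambda>j. {i. A $ i $ j = 1}"
  let ?n = "\<lambda>j. card (?T j \<inter> p)"
  have "{c \<in> column_choices A. set (snd c) \<subseteq> p}
      = (SIGMA I:{I. I \<noteq> {}}. listset (map (\<lambda>j. ?T j \<inter> p) (sorted_list_of_set I)))"
    using listset_Int[of p "map ?T (sorted_list_of_set _)"]
    by (auto simp: column_choices_def o_def)
  then have "card {c \<in> column_choices A. set (snd c) \<subseteq> p}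
      = (\<Sum>I | I \<noteq> {}. card (listset (map (\<lambda>j. ?T j \<inter> p) (sorted_list_of_set I))))"
    by (simp add: card_SigmaI finite_listset)
  also have "\<dots> = (\<Sum>I | I \<noteq> {}. \<Prod>j\<in>I. ?n j)"
    by (intro sum.cong refl)
      (simp add: card_listset o_def prod.distinct_set_conv_list[symmetric])
  finally have card: "card {c \<in> column_choices A. set (snd c) \<subseteq> p} = (\<Sum>I | I \<noteq> {}. \<Prod>j\<in>I. ?n j)" .
  have "(\<Prod>j\<in>UNIV. ?n j + 1) = (\<Sum>I\<in>Pow UNIV. (\<Prod>j\<in>I. ?n j) * (\<Prod>j\<in>UNIV - I. 1))"
    by (rule prod_add) simp
  also have "\<dots> = (\<Sum>I | I \<noteq> {}. \<Prod>j\<in>I. ?n j) + 1"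
    by (simp add: sum.remove[of _ "{}"] Collect_neg_eq[symmetric] set_diff_eq)
  finally have prod: "(\<Prod>j\<in>UNIV. ?n j + 1) = (\<Sum>I | I \<noteq> {}. \<Prod>j\<in>I. ?n j) + 1" .
  have "\<exists>j. odd (?n j)"
  proof (rule ccontr)
    assume "\<nexists>j. odd (?n j)"
    then have even: "even (?n j)" for j by blast
    define v :: "bit^6" where "v = (\<chi> i. of_bool (i \<in> p))"
    have "(v v* A) $ j = 0" for j
    proof -
      have "(v v* A) $ j = (\<Sum>i\<in>UNIV. of_bool (i \<in> ?T j \<inter> p))"
        unfolding vector_matrix_mult_def v_def by (auto intro!: sum.cong simp: of_bool_def)
      also have "\<dots> = of_nat (?n j)"
      proof -
        have "(\<Sum>i\<in>UNIV. of_bool (i \<in> S)) = (of_nat (card S) :: bit)" for S :: "6 set"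
          by (simp add: sum_of_bool_eq)
        then show ?thesis .
      qed
      also have "\<dots> = 0" using even[of j] by (auto elim!: evenE)
      finally show ?thesis .
    qed
    then have vA: "v v* A = 0" by (simp add: vec_eq_iff)
    obtain B where "A ** B = mat 1" using assms(1) by (auto simp: invertible_def)
    then have "v = (v v* A) v* B"
      by (simp add: vector_matrix_mul_assoc)
    also have "\<dots> = 0"
      unfolding vA by (simp add: vector_matrix_mult_def vec_eq_iff)
    finally have "v = 0" .
    moreover obtain i where "i \<in> p" using assms(2) by blast
    then have "v $ i = 1" by (simp add: v_def)
    ultimately show False by simp
  qed
  then obtain j where "even (?n j + 1)" by auto
  then have "even (\<Prod>j\<in>UNIV. ?n j + 1)"
    using dvd_prodI[of UNIV j "\<lambda>j. ?n j + 1"] by (auto dest: dvd_trans)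
  with prod card show ?thesis by simp
qed

text \<open>Inversion over the nonempty subsets of \<open>p\<close>, by induction: the number of proper ones is even.\<close>

lemma odd_column_choices_eq:
  assumes "invertible A" "p \<noteq> {}"
  shows "odd (card {c \<in> column_choices A. set (snd c) = p})"
  using assms(2)
proof (induction "card p" arbitrary: p rule: less_induct)
  case less
  let ?N = "\<lambda>K. card {c \<in> column_choices A. set (snd c) = K}"
  have fin: "finite {c \<in> column_choices A. Q c}" for Q using finite_column_choices by simp
  have nonempty: "set (snd c) \<noteq> {}" if "c \<in> column_choices A" for c
    using that by (auto simp: column_choices_def dest!: length_listset)
  have "card {c \<in> column_choices A. set (snd c) \<subseteq> p} = (\<Sum>K\<in>Pow p - {{}}. ?N K)"
  proof -
    have "{c \<in> column_choices A. set (snd c) \<subseteq> p} = (\<Union>K\<in>Pow p - {{}}. {c \<in> column_choices A. set (snd c) = K})"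
      using nonempty by auto
    then show ?thesis
      by (simp only:) (subst card_UN_disjoint; auto simp: fin)
  qed
  also have "\<dots> = ?N p + (\<Sum>K\<in>Pow p - {{}} - {p}. ?N K)"
    using less.prems by (intro sum.remove) auto
  finally have *: "odd (?N p + (\<Sum>K\<in>Pow p - {{}} - {p}. ?N K))"
    using odd_column_choices_subset[OF assms(1) less.prems] by simp
  have "even (\<Sum>K\<in>Pow p - {{}} - {p}. ?N K) \<longleftrightarrow> even (card (Pow p - {{}} - {p}))"
  proof -
    have "odd (?N K)" if "K \<in> Pow p - {{}} - {p}" for K
      using that by (intro less.hyps) (auto intro!: psubset_card_mono)
    then show ?thesis
      by (subst even_sum_iff) (auto simp: Collect_conj_eq[symmetric] intro!: arg_cong[where f = even] arg_cong[where f = card])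
  qed
  moreover have "even (card (Pow p - {{}} - {p}))"
    using less.prems by (simp add: card_Diff_subset card_Pow card_gt_0_iff)
  ultimately show ?case using * by simp
qed

lemma qclass_lin_subst_\<xi>_eq:
  assumes "invertible A"
  shows "qclass (lin_subst A \<xi>) = qclass \<xi>"
proof -
  let ?Ts = "\<lambda>I. map (\<lambda>j. {i. A $ i $ j = 1}) (sorted_list_of_set I)"
  have le: "card (I::6 set) \<le> 6" for I
    using card_mono[of "UNIV::6 set" I] by simp
  have "qclass (lin_subst A \<xi>) = (\<Sum>I | I \<noteq> {}. \<Sum>js\<in>listset (?Ts I). set_block (set js))"
    unfolding qclass_lin_subst_\<xi>
  proof (rule sum.cong[OF refl])
    fix I :: "6 set"
    have "block (map var_sum (?Ts I)) = (\<Sum>js\<in>listset (?Ts I). block (map X js))"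
      using block_expand[of "[]" "?Ts I"] le by simp
    also have "\<dots> = (\<Sum>js\<in>listset (?Ts I). set_block (set js))"
      using le by (intro sum.cong refl block_eq_set_block) (simp add: length_listset)
    finally show "block (map (\<lambda>j. var_sum {i. A $ i $ j = 1}) (sorted_list_of_set I))
        = (\<Sum>js\<in>listset (?Ts I). set_block (set js))" by (simp add: o_def)
  qed
  also have "\<dots> = (\<Sum>c\<in>column_choices A. set_block (set (snd c)))"
    unfolding column_choices_def by (subst sum.Sigma) (auto intro: finite_listset simp: split_def)
  also have "\<dots> = (\<Sum>K | K \<noteq> {}. \<Sum>c\<in>{c \<in> column_choices A. set (snd c) = K}. set_block (set (snd c)))"
  proof (rule sum.group[symmetric])
    show "(\<lambda>c. set (snd c)) ` column_choices A \<subseteq> {K. K \<noteq> {}}"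
      by (auto simp: column_choices_def dest!: length_listset)
  qed (simp_all add: finite_column_choices)
  also have "\<dots> = (\<Sum>K | K \<noteq> {}. \<Sum>c\<in>{c \<in> column_choices A. set (snd c) = K}. set_block K)"
    by (intro sum.cong refl) simp
  also have "\<dots> = (\<Sum>K | K \<noteq> {}. set_block K)"
    by (intro sum.cong refl) (simp add: sum_constant_QP6 odd_column_choices_eq[OF assms])
  finally show ?thesis by (simp add: qclass_\<xi>)
qed

section \<open>A self-dual normal basis of the field with 64 elements\<close>

type_synonym K = "bit alg_closure"

lemma K_char2: "(1::K) + 1 = 0"
proof -
  have "(1::K) + 1 = to_ac (1 + 1)" by (simp only: to_ac_add to_ac_1)
  then show ?thesis by simp
qed

lemma K_two: "(2::K) = 0"
  using K_char2 by simp

lemma K_add_self: "x + x = (0::K)"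
  by (rule char2_add_self[OF K_char2])

lemma K_add_self_left: "x + (x + y) = (y::K)"
  by (simp add: K_add_self flip: add.assoc)

lemma K_square_add: "(x + y)\<^sup>2 = x\<^sup>2 + (y::K)\<^sup>2"
  by (simp add: power2_sum K_two)

text \<open>This primitive polynomial is chosen because the conjugates of its roots form a normal basis that is
  its own dual with respect to the trace form.\<close>

lemma ex_\<beta>: "\<exists>x::K. x ^ 6 = x ^ 5 + x ^ 4 + x + 1"
proof -
  have "\<exists>x::K. poly [:1, 1, 0, 0, 1, 1, 1:] x = 0"
    by (rule alg_closed_imp_poly_has_root) simp
  then obtain x :: K where "poly [:1, 1, 0, 0, 1, 1, 1:] x = 0" ..
  then have "x ^ 6 + (x ^ 5 + x ^ 4 + x + 1) = 0"
    by (simp add: algebra_simps numeral_eq_Suc)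
  then have "x ^ 6 = x ^ 5 + x ^ 4 + x + 1"
    by (metis K_add_self_left add.right_neutral)
  then show ?thesis ..
qed

definition \<beta> :: K where "\<beta> = (SOME x. x ^ 6 = x ^ 5 + x ^ 4 + x + 1)"

lemma \<beta>6: "\<beta> ^ 6 = \<beta> ^ 5 + \<beta> ^ 4 + \<beta> + 1"
  unfolding \<beta>_def by (rule someI_ex[OF ex_\<beta>])

lemma \<beta>_conjugates:
  "\<beta> ^ 8 = \<beta> ^ 5 + \<beta> ^ 3 + \<beta>" 
  "\<beta> ^ 16 = \<beta> ^ 3 + \<beta>"
  "\<beta> ^ 32 = \<beta> ^ 5 + \<beta> ^ 4 + \<beta>\<^sup>2 + \<beta> + 1"
  "\<beta> ^ 64 = \<beta>"
proof -
  have sq: "\<beta> ^ (2 * n) = (\<beta> ^ n)\<^sup>2" for n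
    by (simp add: power_mult[symmetric] mult.commute)
  have mul: "\<beta> ^ Suc n = \<beta> * \<beta> ^ n" for n by simp
  note cancel = K_add_self K_add_self_left add_ac
  note expand = K_square_add distrib_left power_mult[symmetric] power_Suc[symmetric]
  have 7: "\<beta> ^ 7 = \<beta> ^ 4 + \<beta>\<^sup>2 + 1"
    using mul[of 6] by (simp add: \<beta>6 expand cancel power2_eq_square[symmetric])
  show 8: "\<beta> ^ 8 = \<beta> ^ 5 + \<beta> ^ 3 + \<beta>"
    using mul[of 7] by (simp add: 7 expand cancel)
  have 9: "\<beta> ^ 9 = \<beta> ^ 6 + \<beta> ^ 4 + \<beta>\<^sup>2"
    using mul[of 8] by (simp add: 8 expand cancel power2_eq_square[symmetric])
  have 10: "\<beta> ^ 10 = \<beta> ^ 7 + \<beta> ^ 5 + \<beta> ^ 3"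
    using mul[of 9] by (simp add: 9 expand cancel)
  show 16: "\<beta> ^ 16 = \<beta> ^ 3 + \<beta>"
    using sq[of 8] by (simp add: 8 10 7 \<beta>6 expand cancel)
  show 32: "\<beta> ^ 32 = \<beta> ^ 5 + \<beta> ^ 4 + \<beta>\<^sup>2 + \<beta> + 1"
    using sq[of 16] by (simp add: 16 \<beta>6 expand cancel)
  show 64: "\<beta> ^ 64 = \<beta>"
    using sq[of 32] by (simp add: 32 10 8 7 \<beta>6 expand cancel)
qed

subsection \<open>Indices modulo six\<close>

lemma UNIV_6: "(UNIV :: 6 set) = {0, 1, 2, 3, 4, 5}"
proof -
  have "card {0, 1, 2, 3, 4, 5 :: 6} = card (UNIV :: 6 set)" by simp
  then show ?thesis by (metis card_subset_eq finite subset_UNIV)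
qed

lemma sum_UNIV_6: "(\<Sum>i\<in>(UNIV::6 set). f i) = f 0 + f 1 + f 2 + f 3 + f 4 + (f 5 :: 'a::comm_monoid_add)"
proof -
  have "distinct [0, 1, 2, 3, 4, 5::6]" by simp
  then show ?thesis unfolding UNIV_6 by (simp add: add.assoc del: One_nat_def)
qed

lemma prod_UNIV_6: "(\<Prod>i\<in>(UNIV::6 set). f i) = f 0 * f 1 * f 2 * f 3 * f 4 * (f 5 :: 'a::comm_monoid_mult)"
  unfolding UNIV_6 by (simp add: mult.assoc)

lemma exhaust_6: "(i::6) = 0 \<or> i = 1 \<or> i = 2 \<or> i = 3 \<or> i = 4 \<or> i = 5"
  using UNIV_I[of i] unfolding UNIV_6 by blast

lemma wrap_6 [simp]: "(6::6) = 0" "(7::6) = 1" "(8::6) = 2"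
  by simp_all

text \<open>The conjugates of \<open>\<beta>\<close>.  Their index is a residue modulo six, so that the Frobenius automorphism is
  the shift of the index.\<close>

definition cj :: "6 \<Rightarrow> K" where
  "cj i = (if i = 0 then \<beta> else if i = 1 then \<beta>\<^sup>2 else if i = 2 then \<beta> ^ 4 else
     if i = 3 then \<beta> ^ 8 else if i = 4 then \<beta> ^ 16 else \<beta> ^ 32)"

lemma cj_simps [simp]:
  "cj 0 = \<beta>" "cj 1 = \<beta>\<^sup>2" "cj 2 = \<beta> ^ 4" "cj 3 = \<beta> ^ 8" "cj 4 = \<beta> ^ 16" "cj 5 = \<beta> ^ 32"
  by (simp_all add: cj_def)

lemma cj_Suc: "cj (i + 1) = (cj i)\<^sup>2"
  using exhaust_6[of i] by (auto simp: \<beta>_conjugates(4) simp flip: power_mult)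

text \<open>To prove an identity between conjugates it suffices to prove it at index 0, if squaring transports it
  to the next index.\<close>

lemma frobenius_induct_6: "P (0::6) \<Longrightarrow> (\<And>i. P i \<Longrightarrow> P (i + 1)) \<Longrightarrow> P i"
proof -
  assume P: "P (0::6)" "\<And>i. P i \<Longrightarrow> P (i + 1)"
  have "P (of_nat n)" for n
  proof (induction n)
    case (Suc n)
    then show ?case using P(2)[of "of_nat n"] by (simp add: add.commute)
  qed (simp add: P(1))
  from this[of 0] this[of 1] this[of 2] this[of 3] this[of 4] this[of 5] show ?thesis
    using exhaust_6[of i] by auto
qed

lemma sum_cj: "(\<Sum>i\<in>UNIV. cj i) = 1"
  by (simp add: sum_UNIV_6 \<beta>_conjugates K_add_self K_add_self_left add_ac)

lemma cj_mult:
  "cj i * cj (i + 1) = cj i + cj (i + 4)"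
  "cj i * cj (i + 2) = cj (i + 3) + cj (i + 4)"
  "cj i * cj (i + 3) = cj (i + 2) + cj (i + 5)"
proof -
  note simps = \<beta>_conjugates K_add_self K_add_self_left add_ac
  have 0: "\<beta> * \<beta>\<^sup>2 = \<beta> + \<beta> ^ 16"
    by (simp add: simps power3_eq_cube power2_eq_square)
  have 1: "\<beta> * \<beta> ^ 4 = \<beta> ^ 8 + \<beta> ^ 16"
    by (simp add: simps power_Suc[symmetric])
  have "\<beta> * \<beta> ^ 8 = \<beta> ^ 6 + \<beta> ^ 4 + \<beta>\<^sup>2"
    by (simp add: simps power_Suc[symmetric] distrib_left power2_eq_square)
  then have 2: "\<beta> * \<beta> ^ 8 = \<beta> ^ 4 + \<beta> ^ 32"
    by (simp add: simps \<beta>6)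
  have step: "cj (i + 1) * cj (i + 1 + d) = cj (i + 1 + e) + cj (i + 1 + f)"
    if "cj i * cj (i + d) = cj (i + e) + cj (i + f)" for i d e f
  proof -
    have "cj (i + 1) * cj (i + 1 + d) = (cj i * cj (i + d))\<^sup>2"
      using cj_Suc[of i] cj_Suc[of "i + d"] by (simp add: ac_simps power_mult_distrib)
    also have "\<dots> = (cj (i + e))\<^sup>2 + (cj (i + f))\<^sup>2"
      by (simp add: that K_square_add)
    also have "\<dots> = cj (i + 1 + e) + cj (i + 1 + f)"
      using cj_Suc[of "i + e"] cj_Suc[of "i + f"] by (simp add: ac_simps)
    finally show ?thesis .
  qed
  show "cj i * cj (i + 1) = cj i + cj (i + 4)"
    by (induction i rule: frobenius_induct_6) (use 0 step[of _ 1 0 4] in auto)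
  show "cj i * cj (i + 2) = cj (i + 3) + cj (i + 4)"
    by (induction i rule: frobenius_induct_6) (use 1 step[of _ 2 3 4] in auto)
  show "cj i * cj (i + 3) = cj (i + 2) + cj (i + 5)"
    by (induction i rule: frobenius_induct_6) (use 2 step[of _ 3 2 5] in auto)
qed

lemma sum_shift_6: "(\<Sum>i\<in>UNIV. f (i + d)) = (\<Sum>i\<in>UNIV. f (i :: 6) :: 'a::comm_monoid_add)"
  by (rule sum.reindex_bij_witness[where i = "\<lambda>i. i - d" and j = "\<lambda>i. i + d"]) auto

text \<open>The sum is the trace of the product of two conjugates.  It depends only on the difference of the
  indices.  For unequal indices the product is a sum of two conjugates, and both have trace one.\<close>

lemma self_dual: "(\<Sum>j\<in>UNIV. cj (i + j) * cj (k + j)) = of_bool (i = k)"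
proof -
  let ?t = "\<lambda>d. \<Sum>j\<in>UNIV. cj j * cj (j + d)"
  have cross: "?t d = 0" if "\<And>i. cj i * cj (i + d) = cj (i + e) + cj (i + f)" for d e f
    by (simp add: that sum.distrib sum_shift_6 K_add_self)
  have t: "?t d = of_bool (d = 0)" for d
  proof -
    have d0: "?t 0 = 1"
      using sum_shift_6[of cj 1] by (simp add: cj_Suc power2_eq_square sum_cj)
    have d123: "?t 1 = 0" "?t 2 = 0" "?t 3 = 0"
      using cross[of 1 0 4] cross[of 2 3 4] cross[of 3 2 5] by (simp_all add: cj_mult)
    have neg: "?t d = ?t (- d)" for d
      using sum_shift_6[of "\<lambda>j. cj j * cj (j + d)" "- d"] by (simp add: mult.commute)
    have "- 2 = (4::6)" "- 1 = (5::6)" by simp_all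
    then have "?t 4 = 0" "?t 5 = 0" using neg[of 2] neg[of 1] d123 by metis+
    with d0 d123 show ?thesis using exhaust_6[of d] by auto
  qed
  have "(\<Sum>j\<in>UNIV. cj (i + j) * cj (k + j)) = ?t (k - i)"
    using sum_shift_6[of "\<lambda>j. cj j * cj (j + (k - i))" i] by (simp add: ac_simps)
  also have "\<dots> = of_bool (i = k)" unfolding t by auto
  finally show ?thesis .
qed

lemma \<beta>_nonzero: "\<beta> \<noteq> 0"
  using \<beta>6 by auto

text \<open>The element \<open>\<beta>\<close> has order 63; 21 and 9 are the maximal proper divisors of 63.  If \<open>\<beta>\<^sup>2\<^sup>1\<close> or \<open>\<beta>\<^sup>9\<close> were 1,
  the multiplication table of the conjugates would make the basis linearly dependent.\<close>

lemma \<beta>_order: "\<beta> ^ 63 = 1" "\<beta> ^ 21 \<noteq> 1" "\<beta> ^ 9 \<noteq> 1"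
proof -
  have "\<beta> * \<beta> ^ 63 = \<beta> * 1" using \<beta>_conjugates(4) by (simp flip: power_Suc)
  then show "\<beta> ^ 63 = 1" using \<beta>_nonzero by simp
  have sum: "\<beta> + \<beta>\<^sup>2 + \<beta> ^ 4 + \<beta> ^ 8 + \<beta> ^ 16 + \<beta> ^ 32 = 1"
    using sum_cj by (simp add: sum_UNIV_6)
  show "\<beta> ^ 21 \<noteq> 1"
  proof
    assume "\<beta> ^ 21 = 1"
    have "\<beta> ^ 21 = (cj 0 * cj 2) * cj 4" by (simp flip: power_add power_Suc)
    also have "\<dots> = cj 3 * cj (3 + 1) + cj 4 * cj 4"
      using cj_mult(2)[of 0] by (simp add: distrib_right)
    also have "\<dots> = cj 3 + cj 1 + cj 5"
      using cj_mult(1)[of 3] cj_Suc[of 4] by (simp add: power2_eq_square del: cj_simps)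
    finally have 1: "cj 1 + cj 3 + cj 5 = 1" using \<open>\<beta> ^ 21 = 1\<close> by (simp add: ac_simps)
    then have "(cj 1 + cj 3 + cj 5)\<^sup>2 = 1" by simp
    then have 2: "cj 0 + cj 2 + cj 4 = 1"
      using cj_Suc[of 1] cj_Suc[of 3] cj_Suc[of 5] by (simp add: K_square_add ac_simps)
    have "(cj 1 + cj 3 + cj 5) + (cj 0 + cj 2 + cj 4) = 1"
      using sum_cj by (simp add: sum_UNIV_6 ac_simps)
    then have "(1::K) + 1 = 1" unfolding 1 2 .
    then show False by (metis K_char2 zero_neq_one)
  qed
  show "\<beta> ^ 9 \<noteq> 1"
  proof
    assume "\<beta> ^ 9 = 1"
    have "\<beta> ^ 9 = cj 0 * cj (0 + 3)" by (simp flip: power_Suc)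
    then have 25: "cj 2 + cj 5 = 1"
      using cj_mult(3)[of 0] \<open>\<beta> ^ 9 = 1\<close> by simp
    then have "(cj 2 + cj 5)\<^sup>2 = 1" by simp
    then have 30: "cj 3 + cj 0 = 1"
      using cj_Suc[of 2] cj_Suc[of 5] by (simp add: K_square_add)
    have "cj 0 * cj 3 + cj 1 = (cj 3 + cj 0) * cj 0"
      by (simp add: algebra_simps power2_eq_square)
    also have "\<dots> = cj 0" unfolding 30 by simp
    finally have "cj 0 * cj 3 + cj 1 = cj 0" .
    moreover have "cj 0 * cj 3 = 1" using \<open>\<beta> ^ 9 = 1\<close> by (simp flip: power_Suc)
    ultimately have "cj 0 + cj 1 = 1" by (metis K_add_self_left add.commute)
    have step: "cj (i + 1) + cj (i + 2) = 1" if "cj i + cj (i + 1) = 1" for i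
    proof -
      have "(cj i + cj (i + 1))\<^sup>2 = 1" using that by simp
      then show ?thesis
        using cj_Suc[of i] cj_Suc[of "i + 1"] by (simp add: K_square_add add.assoc)
    qed
    have "cj 1 + cj 2 = 1" "cj 2 + cj 3 = 1" "cj 3 + cj 4 = 1"
      using step[of 0] step[of 1] step[of 2] \<open>cj 0 + cj 1 = 1\<close> by (simp_all del: cj_simps)
    then have "cj 4 = cj 0"
      using \<open>cj 0 + cj 1 = 1\<close> by (metis K_add_self_left add.commute)
    then have "cj 0 * cj 1 = 0"
      using cj_mult(1)[of 0] by (simp add: K_add_self)
    then show False using \<beta>_nonzero by simp
  qed
qed


section \<open>Extension of scalars\<close>

type_synonym PK = "mon6 \<Rightarrow>\<^sub>0 K"

definition const :: "K \<Rightarrow> PK" where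
  "const r = single 0 r"

definition Zmon :: "mon6 \<Rightarrow> PK" where
  "Zmon m = single m 1"

definition Z :: "6 \<Rightarrow> PK" where
  "Z i = Zmon (single i 1)"

lemma const_ring_hom [simp]:
  "const 0 = 0" "const 1 = 1" "const (r + s) = const r + const s" "const (r * s) = const r * const s"
  by (simp_all add: const_def single_add mult_single)

lemma const_power: "const (r ^ n) = const r ^ n"
  by (induction n) simp_all

lemma PK_char2: "(1::PK) + 1 = 0"
  by (metis K_char2 const_ring_hom(1-3))

lemma PK_add_self: "p + p = (0::PK)"
  by (rule char2_add_self[OF PK_char2])

lemma PK_square_add: "(p + q)\<^sup>2 = p\<^sup>2 + (q::PK)\<^sup>2"
proof -
  have "(p + q)\<^sup>2 = p\<^sup>2 + q\<^sup>2 + (p * q + p * q)"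
    by (simp add: power2_eq_square algebra_simps)
  then show ?thesis by (simp add: PK_add_self)
qed

lemma PK_square_sum: "(\<Sum>i\<in>I. f i)\<^sup>2 = (\<Sum>i\<in>I. (f i :: PK)\<^sup>2)"
  by (induction I rule: infinite_finite_induct) (simp_all add: PK_square_add)

lemma single_eq_const_Zmon: "single m c = const c * Zmon m"
  by (simp add: const_def Zmon_def mult_single)

lemma lookup_const_mult [simp]: "lookup (const c * p) m = c * lookup p m"
  unfolding const_def mult_map_scale_conv_mult[symmetric]
  by (simp add: Poly_Mapping.map.rep_eq when_def)

lemma PK_induct [case_names zero add]:
  assumes "Q 0" and "\<And>m c p. Q p \<Longrightarrow> Q (const c * Zmon m + p)"
  shows "Q (p :: PK)"
proof (induction p rule: update_induct)
  case const
  then show ?case by (rule assms)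
next
  case (update p a b)
  have "Poly_Mapping.update a b p = single a b + p"
    using update by (intro poly_mapping_eqI)
      (auto simp: lookup_update lookup_add lookup_single when_def in_keys_iff)
  then show ?case using assms(2) update by (simp add: single_eq_const_Zmon)
qed

lemma Zmon_add: "Zmon (m + n) = Zmon m * Zmon n"
  by (simp add: Zmon_def mult_single)

lemma Zmon_0 [simp]: "Zmon 0 = 1"
  by (simp add: Zmon_def)

lemma Z_power: "Z i ^ n = Zmon (single i n)"
proof (induction n)
  case (Suc n)
  have "single i (Suc n) = single i 1 + single i n"
    by (simp flip: single_add)
  then show ?case by (simp only: power_Suc Suc.IH Zmon_add) (simp only: Z_def)
qed simp

lemma eval_mon_Z: "eval_mon Z m = Zmon m"
proof -
  have "eval_mon Z m = Zmon (\<Sum>i\<in>UNIV. single i (lookup m i))"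
  proof -
    have "(\<Prod>i\<in>I. Zmon (f i)) = Zmon (\<Sum>i\<in>I. f i)" if "finite I" for I :: "6 set" and f
      using that by (induction I) (simp_all add: Zmon_add)
    then show ?thesis by (simp add: eval_mon_def Z_power)
  qed
  also have "(\<Sum>i\<in>UNIV. single i (lookup m i)) = m"
    by (rule poly_mapping_eqI) (simp add: lookup_sum lookup_single when_def)
  finally show ?thesis .
qed

subsection \<open>Substitution homomorphisms\<close>

text \<open>The ring homomorphism that extends \<open>C\<close> on the constants and sends \<open>Z i\<close> to \<open>\<phi> i\<close>.\<close>

definition hom_ext :: "(K \<Rightarrow> 's::comm_ring_1) \<Rightarrow> (6 \<Rightarrow> 's) \<Rightarrow> PK \<Rightarrow> 's" where
  "hom_ext C \<phi> p = (\<Sum>m\<in>keys p. C (lookup p m) * eval_mon \<phi> m)"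

text \<open>Both targets that occur, the polynomial ring itself and the polynomials in \<open>t\<close> over it, carry their
  constants through a ring homomorphism.\<close>

locale K_algebra =
  fixes C :: "K \<Rightarrow> 's::comm_ring_1"
  assumes C0 [simp]: "C 0 = 0" and C1 [simp]: "C 1 = 1"
    and C_add [simp]: "C (r + s) = C r + C s" and C_mult [simp]: "C (r * s) = C r * C s"
begin

lemma hom_ext_superset:
  assumes "finite S" "keys p \<subseteq> S"
  shows "hom_ext C \<phi> p = (\<Sum>m\<in>S. C (lookup p m) * eval_mon \<phi> m)"
  unfolding hom_ext_def using assms by (intro sum.mono_neutral_left) (auto simp: in_keys_iff)

lemma hom_ext_0 [simp]: "hom_ext C \<phi> 0 = 0"
  by (simp add: hom_ext_def)

lemma hom_ext_add [simp]: "hom_ext C \<phi> (p + q) = hom_ext C \<phi> p + hom_ext C \<phi> q"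
proof -
  let ?S = "keys p \<union> keys q"
  have fin: "finite ?S" by simp
  have "hom_ext C \<phi> (p + q) = (\<Sum>m\<in>?S. C (lookup (p + q) m) * eval_mon \<phi> m)"
    using fin by (rule hom_ext_superset) (rule keys_add)
  then show ?thesis
    by (simp add: lookup_add distrib_right sum.distrib flip: hom_ext_superset[OF fin])
qed

lemma hom_ext_Zmon [simp]: "hom_ext C \<phi> (const c * Zmon m) = C c * eval_mon \<phi> m"
proof -
  have "hom_ext C \<phi> (const c * Zmon m) = (\<Sum>n\<in>{m}. C (lookup (const c * Zmon m) n) * eval_mon \<phi> n)"
    by (rule hom_ext_superset) (auto simp flip: single_eq_const_Zmon)
  then show ?thesis by (simp add: Zmon_def)
qed

lemma hom_ext_mult [simp]: "hom_ext C \<phi> (p * q) = hom_ext C \<phi> p * hom_ext C \<phi> q"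
proof (induction p rule: PK_induct)
  case (add m c p)
  have "hom_ext C \<phi> (const c * Zmon m * q) = C c * eval_mon \<phi> m * hom_ext C \<phi> q"
  proof (induction q rule: PK_induct)
    case (add n d q)
    have "const c * Zmon m * (const d * Zmon n) = const (c * d) * Zmon (m + n)"
      by (simp add: const_def Zmon_def mult_single ac_simps)
    then have "hom_ext C \<phi> (const c * Zmon m * (const d * Zmon n))
        = C c * eval_mon \<phi> m * (C d * eval_mon \<phi> n)"
      by (metis hom_ext_Zmon eval_mon_add C_mult mult.assoc mult.commute)
    with add show ?case by (simp only: distrib_left hom_ext_add hom_ext_Zmon)
  qed simp
  with add show ?case by (simp add: distrib_right)
qed simp

lemma hom_ext_const [simp]: "hom_ext C \<phi> (const c) = C c"
  using hom_ext_Zmon[of \<phi> c 0] by (simp add: Zmon_def)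

lemma hom_ext_1 [simp]: "hom_ext C \<phi> 1 = 1"
  using hom_ext_const[of \<phi> 1] by simp

lemma hom_ext_Zmon' [simp]: "hom_ext C \<phi> (Zmon m) = eval_mon \<phi> m"
  using hom_ext_Zmon[of \<phi> 1 m] by simp

lemma hom_ext_Z [simp]: "hom_ext C \<phi> (Z i) = \<phi> i"
  using eval_mon_single[of \<phi> i] by (simp add: Z_def)

lemma hom_ext_sum [simp]: "hom_ext C \<phi> (\<Sum>i\<in>I. f i) = (\<Sum>i\<in>I. hom_ext C \<phi> (f i))"
  by (induction I rule: infinite_finite_induct) simp_all

end

interpretation const: K_algebra const
  by unfold_locales simp_all

interpretation const_poly: K_algebra "\<lambda>c. [:const c:]"
  by unfold_locales simp_all

subsection \<open>The eigenbasis\<close>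

text \<open>The image of a variable in terms of the eigenbasis.  As the basis of conjugates is self-dual, the
  inverse change of coordinates has the same coefficients (\<open>Z_eq\<close>).\<close>

definition toK :: "P6 \<Rightarrow> PK" where
  "toK = eval_poly (\<lambda>i. \<Sum>j\<in>UNIV. const (cj (i + j)) * Z j)"

lemma toK_simps [simp]:
  "toK 0 = 0" "toK 1 = 1" "toK (f + g) = toK f + toK g" "toK (f * g) = toK f * toK g"
  by (simp_all add: toK_def eval_poly_add[OF PK_char2] eval_poly_mult[OF PK_char2])

lemma toK_X: "toK (X i) = (\<Sum>j\<in>UNIV. const (cj (i + j)) * Z j)"
  by (simp add: toK_def)

lemma toK_sum: "toK (\<Sum>i\<in>I. f i) = (\<Sum>i\<in>I. toK (f i))"
  by (induction I rule: infinite_finite_induct) simp_all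

lemma const_sum: "const (\<Sum>i\<in>I. r i) = (\<Sum>i\<in>I. const (r i))"
  by (induction I rule: infinite_finite_induct) simp_all

lemma Z_eq: "Z j = (\<Sum>i\<in>UNIV. const (cj (i + j)) * toK (X i))"
proof -
  have "(\<Sum>i\<in>UNIV. const (cj (i + j)) * toK (X i))
      = (\<Sum>k\<in>UNIV. \<Sum>i\<in>UNIV. const (cj (i + j)) * (const (cj (i + k)) * Z k))"
    unfolding toK_X sum_distrib_left by (rule sum.swap)
  also have "\<dots> = (\<Sum>k\<in>UNIV. const (\<Sum>i\<in>UNIV. cj (j + i) * cj (k + i)) * Z k)"
    by (simp add: const_sum sum_distrib_right mult.assoc add.commute)
  also have "\<dots> = Z j"
    by (simp add: self_dual of_bool_def if_distrib[of const] if_distrib[of "\<lambda>x. x * _"] cong: if_cong)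
  finally show ?thesis ..
qed

subsection \<open>Steenrod squares and hit elements\<close>

text \<open>The extension of the total square to the larger field is linear over that field.  It sends the
  conjugate coordinate \<open>Z\<^sub>j\<close> to \<open>Z\<^sub>j + Z\<^sub>j\<^sub>-\<^sub>1\<^sup>2 t\<close>: squaring the coefficients of \<open>Z\<^sub>j\<^sub>-\<^sub>1\<close> gives those of \<open>Z\<^sub>j\<close>.\<close>

definition total_SqK :: "PK \<Rightarrow> PK poly" where
  "total_SqK = hom_ext (\<lambda>c. [:const c:]) (\<lambda>j. [:Z j, (Z (j - 1))\<^sup>2:])"

definition SqK :: "nat \<Rightarrow> PK \<Rightarrow> PK" where
  "SqK k p = poly.coeff (total_SqK p) k"

lemma SqK_add: "SqK k (p + q) = SqK k p + SqK k q"
  by (simp add: SqK_def total_SqK_def)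

lemma SqK_0 [simp]: "SqK k 0 = 0"
  by (simp add: SqK_def total_SqK_def)

lemma SqK_const_mult: "SqK k (const c * p) = const c * SqK k p"
  by (simp add: SqK_def total_SqK_def)

lemma SqK_toK: "SqK k (toK f) = toK (Sq k f)"
proof (induction f arbitrary: k rule: P6_ring_induct)
  case one
  then show ?case by (simp add: SqK_def total_SqK_def Sq_one coeff_1)
next
  case (var i)
  have total: "total_SqK (toK (X i)) = (\<Sum>j\<in>UNIV. [:const (cj (i + j)) * Z j, const (cj (i + j)) * (Z (j - 1))\<^sup>2:])"
    by (simp add: toK_X total_SqK_def mult.commute)
  have square: "toK ((X i)\<^sup>2) = (\<Sum>j\<in>UNIV. const (cj (i + j)) * (Z (j - 1))\<^sup>2)"
  proof -
    have "toK ((X i)\<^sup>2) = (toK (X i))\<^sup>2" by (simp add: power2_eq_square)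
    also have "\<dots> = (\<Sum>j\<in>UNIV. const ((cj (i + j))\<^sup>2) * (Z j)\<^sup>2)"
      by (simp add: toK_X PK_square_sum power_mult_distrib const_power)
    also have "\<dots> = (\<Sum>j\<in>UNIV. const (cj (i + (j + 1))) * (Z ((j + 1) - 1))\<^sup>2)"
      by (simp add: add.assoc flip: cj_Suc)
    also have "\<dots> = (\<Sum>j\<in>UNIV. const (cj (i + j)) * (Z (j - 1))\<^sup>2)"
      by (rule sum_shift_6)
    finally show ?thesis .
  qed
  consider "k = 0" | "k = 1" | "k > 1" by linarith
  then show ?case
  proof cases
    case 1
    then show ?thesis unfolding SqK_def total by (simp add: coeff_sum Sq_0 toK_X)
  next
    case 2
    then show ?thesis unfolding SqK_def total by (simp add: coeff_sum Sq_1_X[simplified] square)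
  next
    case 3
    then obtain n where "k = Suc (Suc n)" by (auto simp: less_iff_Suc_add)
    then show ?thesis unfolding SqK_def total by (simp add: coeff_sum Sq_gt_1_X)
  qed
next
  case (mult f g)
  have "SqK k (toK (f * g)) = (\<Sum>i\<le>k. SqK i (toK f) * SqK (k - i) (toK g))"
    by (simp add: SqK_def total_SqK_def coeff_mult)
  then show ?case by (simp add: mult Sq_Cartan toK_sum)
qed (simp_all add: SqK_add Sq_add)

text \<open>The subspace over the large field that the hit elements generate.\<close>

inductive_set hitK :: "PK set" where
  zero: "0 \<in> hitK"
| add: "h \<in> hit \<Longrightarrow> p \<in> hitK \<Longrightarrow> const r * toK h + p \<in> hitK"

lemma hitK_toK: "h \<in> hit \<Longrightarrow> toK h \<in> hitK"
  using hitK.add[OF _ hitK.zero, of h 1] by simp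

lemma hitK_add: "p \<in> hitK \<Longrightarrow> q \<in> hitK \<Longrightarrow> p + q \<in> hitK"
  by (induction rule: hitK.induct) (auto simp: add.assoc intro: hitK.add)

lemma hitK_const_mult: "p \<in> hitK \<Longrightarrow> const c * p \<in> hitK"
proof (induction rule: hitK.induct)
  case (add h p r)
  then show ?case
    using hitK.add[of h "const c * p" "c * r"] by (simp add: distrib_left mult.assoc)
qed (simp add: hitK.zero)

lemma hitK_sum: "(\<And>i. i \<in> I \<Longrightarrow> f i \<in> hitK) \<Longrightarrow> (\<Sum>i\<in>I. f i) \<in> hitK"
  by (induction I rule: infinite_finite_induct) (auto intro: hitK_add hitK.zero)

text \<open>The span of the image of \<open>toK\<close> over the large field.  It is everything, since it is a subring that
  contains the constants and the \<open>Z\<^sub>j\<close>; this reduces statements about squares on the large space to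
  statements about \<open>Sq\<close>.\<close>

inductive_set descended :: "PK set" where
  zero: "0 \<in> descended"
| add: "p \<in> descended \<Longrightarrow> const r * toK f + p \<in> descended"

lemma descended_add: "p \<in> descended \<Longrightarrow> q \<in> descended \<Longrightarrow> p + q \<in> descended"
  by (induction rule: descended.induct) (auto simp: add.assoc intro: descended.add)

lemma descended_sum: "(\<And>i. i \<in> I \<Longrightarrow> f i \<in> descended) \<Longrightarrow> (\<Sum>i\<in>I. f i) \<in> descended"
  by (induction I rule: infinite_finite_induct) (auto intro: descended_add descended.zero)

lemma descended_const_toK: "const r * toK f \<in> descended"
  using descended.add[OF descended.zero] by simp

lemma descended_mult: "p \<in> descended \<Longrightarrow> q \<in> descended \<Longrightarrow> p * q \<in> descended"
proof (induction rule: descended.induct)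
  case (add p r f)
  have "const r * toK f * q \<in> descended"
    using \<open>q \<in> descended\<close>
  proof (induction rule: descended.induct)
    case (add q s g)
    have "const r * toK f * (const s * toK g) = const (r * s) * toK (f * g)" by (simp add: ac_simps)
    then show ?case using add by (simp add: distrib_left descended.add del: const_ring_hom toK_simps)
  qed (simp add: descended.zero)
  with add show ?case by (simp add: distrib_right descended_add)
qed (simp add: descended.zero)

lemma in_descended: "p \<in> descended"
proof (induction p rule: PK_induct)
  case (add m c p)
  have pow: "q ^ n \<in> descended" if "q \<in> descended" for q n
    using that descended_const_toK[of 1 1] by (induction n) (auto intro: descended_mult)
  have "Z j \<in> descended" for j
    unfolding Z_eq by (intro descended_sum descended_const_toK)
  then have "eval_mon Z m \<in> descended"
    unfolding eval_mon_def prod_UNIV_6 by (intro descended_mult pow)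
  moreover have "eval_mon Z m = Zmon m" by (rule eval_mon_Z)
  moreover have "const c \<in> descended" using descended_const_toK[of c 1] by simp
  ultimately show ?case using add by (metis descended_add descended_mult)
qed (rule descended.zero)

text \<open>By linearity over the large field it suffices to consider the image of \<open>toK\<close>.\<close>

lemma SqK_hitK: "k > 0 \<Longrightarrow> SqK k p \<in> hitK"
  using in_descended[of p]
proof (induction rule: descended.induct)
  case (add p r f)
  then show ?case
    by (simp add: SqK_add SqK_const_mult SqK_toK hitK.add steenrod_aug_hit steenrod_aug.Sq)
qed (simp add: hitK.zero)

text \<open>Only the squares of monomials have to be tested, by linearity.\<close>

lemma functional_hitK:
  assumes add: "\<And>p q. L (p + q) = L p + L q" and const: "\<And>c p. L (const c * p) = c * L p"
    and Sq: "\<And>k m. k > 0 \<Longrightarrow> L (SqK k (Zmon m)) = (0::K)"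
    and "p \<in> hitK"
  shows "L p = 0"
proof -
  have L0: "L 0 = 0" using const[of 0 0] by simp
  have SqK: "L (SqK k p) = 0" if "k > 0" for k p
    by (induction p rule: PK_induct)
       (simp_all add: L0 add const SqK_add SqK_const_mult Sq[OF that])
  have aug: "L (toK (\<theta> f)) = 0" if "\<theta> \<in> steenrod_aug" for \<theta> f
    using that by (induction arbitrary: f) (simp_all add: L0 add SqK flip: SqK_toK)
  have hit: "L (toK h) = 0" if "h \<in> hit" for h
    using that unfolding hit_def
  proof (induction rule: P.span_induct_alt)
    case (step c h g)
    then show ?case using aug by (cases c) (auto simp: add)
  qed (simp add: L0)
  show ?thesis
    using \<open>p \<in> hitK\<close> by induction (simp_all add: L0 add const hit)
qed

text \<open>A substitution that is defined over the field with two elements preserves the hit elements.\<close>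

lemma hom_ext_hitK:
  assumes "\<And>f. hom_ext const \<phi> (toK f) = toK (lin_subst A f)" and "p \<in> hitK"
  shows "hom_ext const \<phi> p \<in> hitK"
  using assms(2)
  by induction (auto simp: assms(1) hitK.zero intro: hitK.add lin_subst_hit)

lemma hom_ext_toK:
  assumes "\<And>i. hom_ext const \<phi> (toK (X i)) = toK (lin_subst A (X i))"
  shows "hom_ext const \<phi> (toK f) = toK (lin_subst A f)"
  by (induction f rule: P6_ring_induct) (simp_all add: assms lin_subst_add lin_subst_mult)

subsection \<open>Descent\<close>

text \<open>The element 1 extends to a basis of the large field over the small one.\<close>

lemma ex_retraction: "\<exists>l :: K \<Rightarrow> bit. (\<forall>r s. l (r + s) = l r + l s) \<and> l 1 = 1"
proof -
  define scaleK :: "bit \<Rightarrow> K \<Rightarrow> K" where "scaleK c r = (if c = 1 then r else 0)" for c r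
  interpret K: vector_space scaleK
  proof
    show "scaleK (a + b) x = scaleK a x + scaleK b x" for a b x
      by (cases a; cases b) (simp_all add: scaleK_def K_add_self)
  qed (auto simp: scaleK_def)
  have ind: "K.independent {1}" by (simp add: K.dependent_single)
  let ?B = "K.extend_basis {1}"
  have B: "K.independent ?B" "1 \<in> ?B" "K.span ?B = UNIV"
    using K.independent_extend_basis[OF ind] K.extend_basis_superset[OF ind] K.span_extend_basis[OF ind]
    by auto
  have "K.representation ?B (r + s) 1 = K.representation ?B r 1 + K.representation ?B s 1" for r s
    by (simp only: K.representation_add[OF B(1)] B(3) UNIV_I add.commute)
  moreover have "K.representation ?B 1 1 = 1"
    using K.representation_basis[OF B(1,2)] by simp
  ultimately show ?thesis
    by (intro exI[of _ "\<lambda>r. K.representation ?B r 1"] conjI allI)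
qed

definition retract :: "K \<Rightarrow> bit" where
  "retract = (SOME l. (\<forall>r s. l (r + s) = l r + l s) \<and> l 1 = 1)"

lemma retract_add [simp]: "retract (r + s) = retract r + retract s"
  and retract_1 [simp]: "retract 1 = 1"
  using someI_ex[OF ex_retraction] by (simp_all add: retract_def)

lemma retract_0 [simp]: "retract 0 = 0"
  using retract_add[of 0 0] by simp

definition retract_coeffs :: "PK \<Rightarrow> P6" where
  "retract_coeffs q =
     (\<Sum>m\<in>keys q. single m (retract (lookup q m)))"

lemma lookup_retract_coeffs:
  "lookup (retract_coeffs q) n = retract (lookup q n)"
  unfolding retract_coeffs_def
  by (cases "n \<in> keys q")
     (auto simp: lookup_sum lookup_single when_def in_keys_iff intro!: sum.neutral)

text \<open>The map first expresses the polynomial in the original variables and then retracts its coefficients.\<close>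

definition descend :: "PK \<Rightarrow> P6" where
  "descend p = retract_coeffs (hom_ext const (\<lambda>j. \<Sum>i\<in>UNIV. const (cj (i + j)) * Z i) p)"

lemma descend_add: "descend (p + q) = descend p + descend q"
  unfolding descend_def
  by (rule poly_mapping_eqI) (simp only: lookup_retract_coeffs lookup_add const.hom_ext_add retract_add)

lemma descend_0 [simp]: "descend 0 = 0"
  by (simp add: descend_def retract_coeffs_def)

lemma descend_const_toK: "descend (const r * toK f) = scaleP (retract r) f"
proof -
  let ?\<kappa> = "hom_ext const (\<lambda>j. \<Sum>i\<in>UNIV. const (cj (i + j)) * Z i)"
  have "?\<kappa> (toK f) = eval_poly Z f"
  proof (induction f rule: P6_ring_induct)
    case (var i)
    have "?\<kappa> (toK (X i)) = (\<Sum>k\<in>UNIV. \<Sum>j\<in>UNIV. const (cj (i + j)) * (const (cj (k + j)) * Z k))"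
      unfolding toK_X by (subst sum.swap) (simp add: sum_distrib_left)
    also have "\<dots> = (\<Sum>k\<in>UNIV. const (\<Sum>j\<in>UNIV. cj (i + j) * cj (k + j)) * Z k)"
      by (simp add: const_sum sum_distrib_right mult.assoc)
    also have "\<dots> = Z i"
      by (simp add: self_dual of_bool_def if_distrib[of const] if_distrib[of "\<lambda>x. x * _"] cong: if_cong)
    finally show ?case by simp
  qed (simp_all add: eval_poly_add[OF PK_char2] eval_poly_mult[OF PK_char2])
  moreover have "lookup (eval_poly Z f) m = (if lookup f m = 1 then 1 else 0)" for m
    by (auto simp: eval_poly_def eval_mon_Z lookup_sum Zmon_def lookup_single when_def in_keys_iff)
  ultimately have "lookup (descend (const r * toK f)) m
      = lookup (scaleP (retract r) f) m" for m
    unfolding descend_def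
    by (cases "retract r"; cases "lookup f m") (simp_all add: lookup_retract_coeffs)
  then show ?thesis by (rule poly_mapping_eqI)
qed

text \<open>The retraction is linear over the small field, and hit elements over the large field are combinations
  of hit elements over the small one.\<close>

lemma descend_hitK: "p \<in> hitK \<Longrightarrow> descend p \<in> hit"
  by (induction rule: hitK.induct)
     (auto simp: descend_add descend_const_toK hit_zero intro: hit_add hit_scale)

lemma toK_hitK_iff: "toK f \<in> hitK \<longleftrightarrow> f \<in> hit"
  using descend_hitK[of "toK f"] descend_const_toK[of 1 f] hitK_toK by auto

section \<open>Monomials in the eigenbasis\<close>

definition mon_of :: "nat list \<Rightarrow> mon6" where
  "mon_of a = single 0 (a ! 0) + single 1 (a ! 1) + single 2 (a ! 2)
     + single 3 (a ! 3) + single 4 (a ! 4) + single 5 (a ! 5)"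

definition exps :: "mon6 \<Rightarrow> nat list" where
  "exps m = map (lookup m) [0, 1, 2, 3, 4, 5]"

definition Zl :: "nat list \<Rightarrow> PK" where
  "Zl a = Zmon (mon_of a)"

lemma length_6_cases:
  assumes "length a = 6"
  obtains a0 a1 a2 a3 a4 a5 where "a = [a0, a1, a2, a3, a4, a5]"
  using assms by (auto simp: numeral_eq_Suc length_Suc_conv)

lemma lookup_mon_of [simp]:
  "lookup (mon_of a) 0 = a ! 0" "lookup (mon_of a) 1 = a ! 1"
  "lookup (mon_of a) 2 = a ! 2" "lookup (mon_of a) 3 = a ! 3"
  "lookup (mon_of a) 4 = a ! 4" "lookup (mon_of a) 5 = a ! 5"
  by (simp_all add: mon_of_def lookup_add lookup_single when_def)

lemma mon6_eqI:
  assumes "lookup m 0 = lookup n 0" "lookup m 1 = lookup n 1"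
    "lookup m 2 = lookup n 2" "lookup m 3 = lookup n 3"
    "lookup m 4 = lookup n 4" "lookup m 5 = lookup n 5"
  shows "m = (n :: mon6)"
proof (rule poly_mapping_eqI)
  show "lookup m i = lookup n i" for i
    using exhaust_6[of i] assms by auto
qed

lemma length_exps [simp]: "length (exps m) = 6"
  by (simp add: exps_def)

lemma mon_of_exps [simp]: "mon_of (exps m) = m"
  by (rule mon6_eqI) (simp_all add: exps_def)

lemma exps_mon_of: "length a = 6 \<Longrightarrow> exps (mon_of a) = a"
  by (erule length_6_cases) (simp add: exps_def)

lemma lookup_Zl:
  "length a = 6 \<Longrightarrow> length b = 6 \<Longrightarrow> lookup (Zl b) (mon_of a) = of_bool (a = b)"
  using exps_mon_of[of a] exps_mon_of[of b] by (auto simp: Zl_def Zmon_def lookup_single when_def)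

lemma Zmon_eq_Zl: "Zmon m = Zl (exps m)"
  by (simp add: Zl_def)

lemma eval_mon_mon_of:
  "eval_mon \<phi> (mon_of [a0, a1, a2, a3, a4, a5]) =
     \<phi> 0 ^ a0 * \<phi> 1 ^ a1 * \<phi> 2 ^ a2 * \<phi> 3 ^ a3 * \<phi> 4 ^ a4 * \<phi> 5 ^ a5"
  by (simp add: eval_mon_def prod_UNIV_6)

lemma Zl_eq: "Zl [a0, a1, a2, a3, a4, a5] = Z 0 ^ a0 * Z 1 ^ a1 * Z 2 ^ a2 * Z 3 ^ a3 * Z 4 ^ a4 * Z 5 ^ a5"
  unfolding Zl_def by (metis eval_mon_Z eval_mon_mon_of)

subsection \<open>Squares of eigenmonomials\<close>

text \<open>The term of a square in which \<open>Z\<^sub>i\<close> is replaced \<open>js ! i\<close> times by \<open>Z\<^sub>i\<^sub>-\<^sub>1\<^sup>2\<close>.\<close>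

definition twist :: "nat list \<Rightarrow> nat list \<Rightarrow> nat list" where
  "twist b js = map2 (+) (map2 (-) b js) (map (\<lambda>j. 2 * j) (rotate1 js))"

definition SqK_exponents :: "nat \<Rightarrow> nat list \<Rightarrow> nat list list" where
  "SqK_exponents k b = map (twist b) (lists_with_sum k (map odd_binoms b))"

lemma length_lists_with_sum: "js \<in> set (lists_with_sum k xss) \<Longrightarrow> length js = length xss"
  by (auto simp: set_lists_with_sum dest: list_all2_lengthD)

lemma length_SqK_exponents: "length b = 6 \<Longrightarrow> t \<in> set (SqK_exponents k b) \<Longrightarrow> length t = 6"
  by (auto simp: SqK_exponents_def twist_def dest!: length_lists_with_sum)

lemma pred_0_6: "- 1 = (5::6)"
  by simp

lemma SqK_Zl:
  assumes "length b = 6"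
  shows "SqK k (Zl b) = (\<Sum>t\<leftarrow>SqK_exponents k b. Zl t)"
proof -
  let ?ys = "[Z 0, Z 1, Z 2, Z 3, Z 4, Z 5]"
  let ?ws = "[(Z 5)\<^sup>2, (Z 0)\<^sup>2, (Z 1)\<^sup>2, (Z 2)\<^sup>2, (Z 3)\<^sup>2, (Z 4)\<^sup>2]"
  obtain b0 b1 b2 b3 b4 b5 where b: "b = [b0, b1, b2, b3, b4, b5]"
    using assms by (rule length_6_cases)
  have "total_SqK (Zl b) = pw (map2 (\<lambda>y w. [:y, w:]) ?ys ?ws) b"
    by (simp add: total_SqK_def Zl_def b eval_mon_mon_of pred_0_6 mult.assoc)
  then have "SqK k (Zl b) = (\<Sum>js\<leftarrow>lists_with_sum k (map odd_binoms b). pw ?ys (map2 (-) b js) * pw ?ws js)"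
    by (simp only: SqK_def) (rule coeff_pw_linear[OF PK_char2], simp_all add: b)
  also have "\<dots> = (\<Sum>js\<leftarrow>lists_with_sum k (map odd_binoms b). Zl (twist b js))"
  proof (intro arg_cong[where f = sum_list] map_cong refl)
    fix js assume "js \<in> set (lists_with_sum k (map odd_binoms b))"
    from length_lists_with_sum[OF this] have "length js = 6" by (simp add: b)
    then obtain j0 j1 j2 j3 j4 j5 where "js = [j0, j1, j2, j3, j4, j5]" by (rule length_6_cases)
    then show "pw ?ys (map2 (-) b js) * pw ?ws js = Zl (twist b js)"
      by (simp add: b twist_def Zl_eq power_add mult_ac flip: power_mult)
  qed
  finally show ?thesis by (simp add: SqK_exponents_def o_def)
qed

subsection \<open>Functionals that vanish on hit elements\<close>

text \<open>The inverse of \<open>twist\<close> for a fixed \<open>js\<close>: the exponents of the monomial in whose square \<open>a\<close> is a term.\<close>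

definition untwist :: "nat list \<Rightarrow> nat list \<Rightarrow> nat list" where
  "untwist a js = map2 (+) (map2 (-) a (map (\<lambda>j. 2 * j) (rotate1 js))) js"

text \<open>All pairs of a square \<open>k\<close> and a monomial \<open>b\<close> such that \<open>a\<close> is a term of \<open>SqK k (Zl b)\<close>.  An entry of
  \<open>js\<close> is at most half of the exponent that receives the square, which makes the list finite.\<close>

definition dual_terms :: "nat list \<Rightarrow> (nat \<times> nat list) list" where
  "dual_terms a = map (\<lambda>js. (sum_list js, untwist a js))
     (filter (\<lambda>js. list_all2 (\<lambda>j n. j \<in> set (odd_binoms n)) js (untwist a js))
       (product_lists (map (\<lambda>n. [0..<Suc (n div 2)]) (last a # butlast a))))"

lemma lists_with_sum_eq_filter:
  "lists_with_sum k xss = filter (\<lambda>js. sum_list js = k) (product_lists xss)"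
proof (induction xss arbitrary: k)
  case (Cons xs xss)
  have "filter (\<lambda>js. sum_list js = k) (map ((#) x) (product_lists xss))
      = (if x \<le> k then map ((#) x) (lists_with_sum (k - x) xss) else [])" for x
    unfolding Cons by (auto simp: filter_map o_def intro!: filter_cong)
  then show ?case by (simp add: filter_concat o_def)
qed simp

lemma count_list_map_distinct:
  assumes "distinct xs"
  shows "count_list (map f xs) y = card {x \<in> set xs. f x = y}"
  using assms
proof (induction xs)
  case (Cons x xs)
  have "{z \<in> set (x # xs). f z = y} = (if f x = y then insert x {z \<in> set xs. f z = y} else {z \<in> set xs. f z = y})"
    by auto
  with Cons show ?case by simp
qed simp

lemma count_SqK_exponents:
  assumes "length a = 6" "length b = 6"
  shows "count_list (SqK_exponents k b) a = count_list (dual_terms a) (k, b)"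
proof -
  obtain a0 a1 a2 a3 a4 a5 where a: "a = [a0, a1, a2, a3, a4, a5]"
    using assms(1) by (rule length_6_cases)
  obtain b0 b1 b2 b3 b4 b5 where b: "b = [b0, b1, b2, b3, b4, b5]"
    using assms(2) by (rule length_6_cases)
  have step: "j \<in> set (odd_binoms n) \<and> n - j + 2 * j' = m \<longleftrightarrow>
      j' < Suc (m div 2) \<and> j \<in> set (odd_binoms (m - 2 * j' + j)) \<and> m - 2 * j' + j = n" for j j' m n
    by (cases "j \<le> n") (auto dest: odd_binoms_le)
  have "{js \<in> set (lists_with_sum k (map odd_binoms b)). twist b js = a}
      = {js \<in> set (filter (\<lambda>js. list_all2 (\<lambda>j n. j \<in> set (odd_binoms n)) js (untwist a js))
          (product_lists (map (\<lambda>n. [0..<Suc (n div 2)]) (last a # butlast a)))).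
          (sum_list js, untwist a js) = (k, b)}" (is "?A = ?B")
  proof (rule Set.set_eqI)
    fix js
    show "js \<in> ?A \<longleftrightarrow> js \<in> ?B"
    proof (cases "length js = 6")
      case False
      have "js \<notin> ?A"
      proof
        assume "js \<in> ?A"
        then have "js \<in> set (lists_with_sum k (map odd_binoms b))" by (simp only: mem_Collect_eq)
        from length_lists_with_sum[OF this] show False using False assms(2) by simp
      qed
      moreover have "js \<notin> ?B"
      proof
        assume "js \<in> ?B"
        then have "js \<in> set (product_lists (map (\<lambda>n. [0..<Suc (n div 2)]) (last a # butlast a)))"
          by (simp only: mem_Collect_eq set_filter)
        from in_set_product_lists_length[OF this] show False using False assms(1) by simp
      qed
      ultimately show ?thesis by (simp only:)
    next
      case True
      then obtain j0 j1 j2 j3 j4 j5 where js: "js = [j0, j1, j2, j3, j4, j5]" by (rule length_6_cases)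
      show ?thesis
        using step[of j0 b0 j1 a0] step[of j1 b1 j2 a1] step[of j2 b2 j3 a2]
          step[of j3 b3 j4 a3] step[of j4 b4 j5 a4] step[of j5 b5 j0 a5]
        by (simp only: js a b mem_Collect_eq set_filter set_lists_with_sum product_lists_set
            twist_def untwist_def list.map rotate1.simps append.simps zip_Cons_Cons zip_Nil prod.case
            list_all2_Cons list_all2_Nil set_upt list.inject butlast.simps last.simps if_False if_True
            list.distinct prod.inject atLeastLessThan_iff le0 HOL.simp_thms) blast
    qed
  qed
  moreover have "distinct (lists_with_sum k (map odd_binoms b))"
    unfolding lists_with_sum_eq_filter
    by (intro distinct_filter distinct_product_lists) (auto simp: distinct_odd_binoms)
  moreover have "distinct (filter P (product_lists (map (\<lambda>n. [0..<Suc (n div 2)]) xs)))" for P and xs :: "nat list"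
    by (intro distinct_filter distinct_product_lists) auto
  ultimately show ?thesis
    by (simp only: SqK_exponents_def dual_terms_def count_list_map_distinct)
qed

definition coeff_sum :: "nat list list \<Rightarrow> PK \<Rightarrow> K" where
  "coeff_sum S p = (\<Sum>a\<leftarrow>S. lookup p (mon_of a))"

lemma coeff_sum_add: "coeff_sum S (p + q) = coeff_sum S p + coeff_sum S q"
  by (simp add: coeff_sum_def lookup_add sum_list_addf)

lemma coeff_sum_const_mult: "coeff_sum S (const c * p) = c * coeff_sum S p"
  by (simp add: coeff_sum_def sum_list_const_mult)

lemma even_count_pairs_off: "pairs_off xs \<Longrightarrow> even (count_list xs x)"
proof (induction xs rule: pairs_off.induct)
  case (2 y xs)
  then have "y \<in> set xs" "even (count_list (remove1 y xs) x)" by auto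
  moreover have count: "count_list xs x = (if x = y then 1 else 0) + count_list (remove1 y xs) x"
    if "y \<in> set xs" for xs using that by (induction xs) auto
  ultimately obtain n where "even n" "count_list xs x = (if x = y then 1 else 0) + n"
    by blast
  then show ?case by auto
qed simp

text \<open>The functional vanishes on a square of a monomial \<open>b\<close> if \<open>b\<close> occurs an even number of times among the
  dual terms of the summands.  So one cancellation of lists certifies all the squares at once.\<close>

lemma coeff_sum_hitK:
  assumes "list_all (\<lambda>a. length a = 6) S"
    "pairs_off (filter (\<lambda>(k, b). k \<noteq> 0) (concat (map dual_terms S)))" "p \<in> hitK"
  shows "coeff_sum S p = 0"
proof (rule functional_hitK[where L = "coeff_sum S", OF _ _ _ assms(3)])
  fix k m assume "0 < (k::nat)"
  define b where "b = exps m"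
  then have b: "length b = 6" by simp
  have count: "lookup (\<Sum>t\<leftarrow>ts. Zl t) (mon_of a) = of_nat (count_list ts a)"
    if "length a = 6" "\<And>t. t \<in> set ts \<Longrightarrow> length t = 6" for a ts
    using that by (induction ts) (auto simp: lookup_add lookup_Zl)
  have "coeff_sum S (SqK k (Zmon m)) = (\<Sum>a\<leftarrow>S. of_nat (count_list (dual_terms a) (k, b)))"
    unfolding coeff_sum_def Zmon_eq_Zl b_def[symmetric] SqK_Zl[OF b]
  proof (intro arg_cong[where f = sum_list] map_cong refl)
    fix a assume "a \<in> set S"
    then have a: "length a = 6" using assms(1) by (auto simp: list_all_iff)
    show "lookup (\<Sum>t\<leftarrow>SqK_exponents k b. Zl t) (mon_of a) = of_nat (count_list (dual_terms a) (k, b))"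
      using count[OF a, of "SqK_exponents k b"] length_SqK_exponents[OF b] count_SqK_exponents[OF a b] by simp
  qed
  also have "\<dots> = of_nat (count_list (concat (map dual_terms S)) (k, b))"
    by (induction S) simp_all
  also have "count_list (concat (map dual_terms S)) (k, b)
      = count_list (filter (\<lambda>(k, b). k \<noteq> 0) (concat (map dual_terms S))) (k, b)"
  proof -
    have "count_list xs (k, b) = count_list (filter (\<lambda>(k, b). k \<noteq> 0) xs) (k, b)" for xs :: "(nat \<times> nat list) list"
      using \<open>0 < k\<close> by (induction xs) auto
    then show ?thesis .
  qed
  finally show "coeff_sum S (SqK k (Zmon m)) = 0"
    using even_count_pairs_off[OF assms(2), of "(k, b)"] by (simp add: of_nat_char2[OF K_char2])
qed (simp_all add: coeff_sum_add coeff_sum_const_mult)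

section \<open>Tables of squares and of functionals\<close>

definition rot :: "nat list \<Rightarrow> nat list" where
  "rot a = last a # butlast a"

definition rotations :: "nat list \<Rightarrow> nat list list" where
  "rotations a = [a, rot a, rot (rot a), rot (rot (rot a)), rot (rot (rot (rot a))), rot (rot (rot (rot (rot a))))]"

text \<open>Together with \<open>bottom\<close>, the rotations of these span the monomials of weight zero modulo hit
  elements.\<close>

definition reps :: "nat list list" where
  "reps = [[0, 0, 1, 7, 2, 5], [0, 0, 3, 4, 3, 5], [0, 1, 7, 4, 2, 1], [1, 2, 2, 4, 3, 3], [0, 5, 3, 3, 3, 1]]"

definition bottom :: "nat list" where
  "bottom = [0, 0, 3, 2, 6, 4]"

text \<open>An entry \<open>(a, cs)\<close> states that the squares \<open>cs\<close> express \<open>a\<close> by monomials whose rotation class is that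
  of \<open>bottom\<close>, of a representative or of an earlier entry.  One entry covers a whole rotation class,
  because rotating the variables preserves the hit elements.\<close>

definition reduction_table :: "(nat list \<times> (nat \<times> nat list) list) list" where
  "reduction_table = [
    ([0, 2, 0, 3, 6, 4], [(1, [0, 0, 1, 3, 6, 4])]),
    ([0, 2, 2, 0, 7, 4], [(1, [0, 0, 3, 0, 7, 4])]),
    ([0, 2, 2, 2, 4, 5], [(1, [0, 0, 3, 2, 4, 5])]),
    ([2, 2, 2, 6, 2, 1], [(1, [0, 3, 2, 6, 2, 1])]),
    ([0, 0, 1, 5, 5, 4], [(2, [0, 0, 1, 1, 7, 4])]),
    ([0, 2, 0, 5, 3, 5], [(1, [0, 0, 1, 5, 3, 5])]),
    ([0, 0, 5, 1, 4, 5], [(2, [0, 0, 1, 3, 4, 5])]),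
    ([0, 4, 1, 0, 5, 5], [(2, [0, 0, 3, 0, 5, 5])]),
    ([0, 1, 9, 3, 0, 2], [(4, [0, 1, 1, 7, 0, 2])]),
    ([0, 2, 2, 4, 1, 6], [(1, [0, 0, 1, 7, 0, 6]), (2, [0, 0, 1, 5, 1, 6])]),
    ([0, 0, 3, 6, 0, 6], [(1, [0, 0, 3, 4, 1, 6])]),
    ([0, 2, 0, 7, 0, 6], [(1, [0, 0, 1, 7, 0, 6])]),
    ([2, 2, 6, 0, 4, 1], [(1, [0, 3, 6, 0, 4, 1])]),
    ([0, 0, 7, 0, 2, 6], [(2, [0, 0, 3, 2, 2, 6])]),
    ([0, 2, 4, 1, 2, 6], [(1, [0, 0, 5, 1, 2, 6])]),
    ([4, 1, 4, 1, 4, 1], [(2, [0, 3, 4, 1, 4, 1])]),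
    ([0, 0, 1, 1, 11, 2], [(4, [0, 0, 1, 1, 3, 6])]),
    ([0, 0, 1, 3, 8, 3], [(4, [0, 0, 1, 3, 0, 7])]),
    ([0, 0, 3, 0, 9, 3], [(1, [0, 0, 1, 1, 9, 3])]),
    ([0, 1, 3, 10, 0, 1], [(4, [0, 1, 3, 2, 4, 1])]),
    ([0, 5, 1, 6, 2, 1], [(2, [0, 1, 3, 6, 2, 1])]),
    ([0, 1, 11, 0, 1, 2], [(4, [0, 1, 3, 4, 1, 2])]),
    ([0, 1, 0, 3, 0, 11], [(1, [0, 1, 0, 1, 1, 11])]),
    ([0, 5, 5, 2, 1, 2], [(2, [0, 1, 7, 2, 1, 2])]),
    ([0, 3, 4, 5, 2, 1], [(1, [0, 1, 5, 5, 2, 1])]),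
    ([0, 3, 6, 2, 3, 1], [(1, [0, 3, 4, 3, 3, 1])]),
    ([2, 0, 7, 2, 3, 1], [(1, [0, 1, 7, 2, 3, 1])]),
    ([4, 1, 0, 7, 2, 1], [(2, [0, 3, 0, 7, 2, 1])]),
    ([0, 9, 1, 1, 2, 2], [(4, [0, 1, 5, 1, 2, 2])]),
    ([0, 3, 8, 1, 1, 2], [(1, [0, 1, 9, 1, 1, 2])]),
    ([0, 3, 2, 8, 1, 1], [(1, [0, 1, 3, 8, 1, 1])]),
    ([4, 1, 4, 3, 1, 2], [(2, [0, 3, 4, 3, 1, 2])]),
    ([0, 7, 0, 4, 3, 1], [(1, [0, 5, 1, 4, 3, 1])]),
    ([4, 1, 2, 4, 3, 1], [(2, [0, 3, 2, 4, 3, 1])]),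
    ([0, 5, 3, 1, 6, 0], [(1, [0, 5, 3, 1, 4, 1])]),
    ([0, 1, 9, 1, 3, 1], [(4, [0, 1, 1, 5, 3, 1])]),
    ([0, 1, 5, 7, 1, 1], [(2, [0, 1, 5, 3, 3, 1])])]"

text \<open>Numbers to base 16 in place of lists, so that membership in the long list of known monomials is
  quick to evaluate.\<close>

definition encode :: "nat list \<Rightarrow> nat" where
  "encode a = foldr (\<lambda>x c. x + 16 * c) a 0"

definition digits :: "nat list \<Rightarrow> bool" where
  "digits a = list_all (\<lambda>x. x < 16) a"

fun unknown_terms :: "nat list \<Rightarrow> nat list list \<Rightarrow> nat list list" where
  "unknown_terms known [] = []"
| "unknown_terms known (t # ts) =
     (if digits t \<and> encode t \<in> set known then [] else [t]) @ unknown_terms known ts"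

fun SqK_terms :: "(nat \<times> nat list) list \<Rightarrow> nat list list" where
  "SqK_terms [] = []"
| "SqK_terms ((k, b) # cs) = SqK_exponents k b @ SqK_terms cs"

text \<open>Each entry must cancel against the terms of its squares, up to monomials that are known to be spanned
  when the entry is reached; the rotations of its monomial then become known.\<close>

fun is_reduction :: "nat list \<Rightarrow> (nat list \<times> (nat \<times> nat list) list) list \<Rightarrow> bool" where
  "is_reduction known [] = True"
| "is_reduction known ((a, cs) # tab) =
     (digits a \<and> pairs_off (a # unknown_terms known (SqK_terms cs))
      \<and> is_reduction (map encode (rotations a) @ known) tab)"

lemma is_reduction_table:
  "is_reduction (map encode (concat (map rotations (bottom # reps)))) reduction_table"
  by code_simp

text \<open>The class of \<open>bottom\<close> is fixed by the rotation, so it contributes one dimension and not six.\<close>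

lemma shift_bottom_pairs_off:
  "pairs_off (bottom # rot bottom # concat (map (\<lambda>(k, b). SqK_exponents k b)
     [(3, [0, 0, 1, 1, 5, 5]), (2, [0, 2, 0, 1, 5, 5]), (2, [4, 0, 0, 1, 1, 7]), (1, [4, 0, 2, 0, 1, 7])]))"
  by code_simp

text \<open>An enumeration of the exponent lists with bounded entries, prescribed sum \<open>n\<close> and prescribed
  weighted sum \<open>s\<close>.  The test \<open>s \<le> n * w\<close> cuts the search: the weights decrease along the list.\<close>

fun weighted_exps :: "nat \<Rightarrow> nat list \<Rightarrow> nat \<Rightarrow> nat \<Rightarrow> nat list list" where
  "weighted_exps m [] n s = (if n = 0 \<and> s = 0 then [[]] else [])"
| "weighted_exps m (w # ws) n s = (if s \<le> n * w then
     concat (map (\<lambda>x. if x * w \<le> s then map ((#) x) (weighted_exps m ws (n - x) (s - x * w)) else [])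
       [0..<Suc (min m n)])
     else [])"

definition peaked_exps :: "nat \<Rightarrow> nat list list" where
  "peaked_exps s = concat (map (\<lambda>x. if x * 32 \<le> s
     then map ((#) x) (weighted_exps x [16, 8, 4, 2, 1] (15 - x) (s - x * 32)) else []) [0..<16])"

text \<open>Every rotation class contains such a list, since a largest entry can be rotated to the end.\<close>

definition peaked :: "nat list \<Rightarrow> bool" where
  "peaked a = list_all (\<lambda>x. x \<le> last a) a"

text \<open>The enumeration lists the exponents from the largest weight down, hence \<open>rev\<close>.\<close>

fun covered :: "nat list \<Rightarrow> nat list list \<Rightarrow> bool" where
  "covered known [] = True"
| "covered known (a # as) = (encode (rev a) \<in> set known \<and> covered known as)"

lemma peaked_exps_covered:
  "covered (map encode (filter peaked (concat (map rotations (bottom # reps @ map fst reduction_table)))))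
     (concat (map peaked_exps [63, 126, 189, 252, 315, 378, 441]))"
  by code_simp

text \<open>Functionals dual to the five representatives.\<close>

definition psis :: "nat list list list" where
  "psis = [
    [[0, 0, 1, 7, 2, 5], [0, 2, 0, 5, 3, 5], [0, 3, 4, 5, 2, 1], [0, 3, 6, 2, 3, 1], [1, 0, 1, 5, 7, 1], [1, 2, 0, 7, 2, 3], [2, 0, 5, 5, 2, 1], [2, 0, 7, 2, 3, 1], [4, 1, 0, 7, 2, 1], [6, 0, 0, 5, 3, 1]],
    [[0, 7, 0, 4, 3, 1], [2, 4, 1, 4, 3, 1], [4, 1, 2, 4, 3, 1], [6, 0, 0, 5, 3, 1], [1, 0, 3, 6, 2, 3], [1, 2, 0, 7, 2, 3], [0, 0, 3, 4, 3, 5], [0, 2, 0, 5, 3, 5]],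
    [[0, 1, 5, 7, 1, 1], [0, 1, 7, 4, 2, 1], [0, 3, 4, 5, 2, 1], [0, 5, 1, 6, 2, 1], [4, 1, 0, 7, 2, 1], [0, 3, 6, 2, 3, 1], [0, 7, 0, 4, 3, 1], [4, 1, 2, 4, 3, 1]],
    [[1, 0, 1, 5, 7, 1], [1, 0, 3, 6, 2, 3], [1, 2, 0, 7, 2, 3], [1, 2, 2, 4, 3, 3]],
    [[0, 5, 3, 3, 3, 1]]]"

text \<open>Functionals that vanish on all the spanning monomials, so that they see only the image of an invariant
  under the circulant substitution.\<close>

definition chis :: "nat list list list" where
  "chis = [[[3, 1, 1, 2, 1, 7]], [[0, 4, 7, 3, 1, 0]], [[3, 1, 1, 0, 4, 6], [3, 3, 0, 0, 2, 7]],
     [[2, 7, 3, 1, 2, 0], [4, 6, 3, 1, 0, 1]], [[2, 3, 3, 1, 0, 6], [3, 5, 2, 1, 0, 4]]]"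

lemma pairs_off_psis_chis:
  "list_all (\<lambda>S. pairs_off (filter (\<lambda>(k, b). k \<noteq> 0) (concat (map dual_terms S)))) (psis @ chis)"
  by code_simp

text \<open>Whether \<open>e\<close> occurs an odd number of times in the product of the factors
  \<open>Z\<^sub>i\<^sup>q + Z\<^sub>i\<^sub>+\<^sub>1\<^sup>q + Z\<^sub>i\<^sub>+\<^sub>3\<^sup>q\<close>.\<close>

fun expands :: "(nat \<times> nat) list \<Rightarrow> nat list \<Rightarrow> bool" where
  "expands [] e = list_all (\<lambda>x. x = 0) e"
| "expands ((i, q) # fs) e = ((if q \<le> e ! i then expands fs (e[i := e ! i - q]) else False) \<noteq>
     ((if q \<le> e ! ((i + 1) mod 6) then expands fs (e[(i + 1) mod 6 := e ! ((i + 1) mod 6) - q]) else False) \<noteq>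
      (if q \<le> e ! ((i + 3) mod 6) then expands fs (e[(i + 3) mod 6 := e ! ((i + 3) mod 6) - q]) else False)))"

text \<open>The binary digits of the exponents: \<open>(Z\<^sub>i + Z\<^sub>i\<^sub>+\<^sub>1 + Z\<^sub>i\<^sub>+\<^sub>3)\<^sup>q\<close> splits into \<open>q\<close>-th powers of the
  variables when \<open>q\<close> is a power of two.\<close>

definition bits :: "nat list \<Rightarrow> (nat \<times> nat) list" where
  "bits b = concat (map (\<lambda>i. map (\<lambda>q. (i, q)) (filter (\<lambda>q. odd (b ! i div q)) [8, 4, 2, 1])) [0..<6])"

definition pairing :: "nat list list \<Rightarrow> nat list \<Rightarrow> nat" where
  "pairing S b = length (filter (expands (bits b)) S)"

text \<open>Summed over the rotations of each representative, the values of the functionals on the circulant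
  images form an invertible matrix modulo two, while \<open>bottom\<close> does not contribute.\<close>

lemma pairing_table:
  "map (\<lambda>S. map (\<lambda>b. odd (sum_list (map (pairing S) (rotations b)))) reps) chis =
     [[False, False, False, False, True], [True, True, False, False, True], [True, True, False, True, True],
      [False, False, True, False, True], [True, False, True, False, False]]"
  "list_all (\<lambda>S. even (pairing S bottom)) chis"
  by code_simp+

section \<open>Three elements of the general linear group\<close>

definition column_matrix :: "(6 \<Rightarrow> 6 set) \<Rightarrow> bit^6^6" where
  "column_matrix T = (\<chi> i j. of_bool (i \<in> T j))"

lemma lin_subst_column_matrix: "lin_subst (column_matrix T) (X j) = var_sum (T j)"
  by (simp add: lin_subst_X_var_sum column_matrix_def)

text \<open>Invertibility is witnessed by the columns \<open>S\<close> of the inverse matrix.\<close>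

lemma invertible_column_matrix:
  assumes "\<And>i j. odd (card {k. i \<in> T k \<and> k \<in> S j}) \<longleftrightarrow> i = j"
    "\<And>i j. odd (card {k. i \<in> S k \<and> k \<in> T j}) \<longleftrightarrow> i = j"
  shows "invertible (column_matrix T)"
proof -
  have "column_matrix T ** column_matrix S = mat 1"
    if "\<And>i j. odd (card {k. i \<in> T k \<and> k \<in> S j}) \<longleftrightarrow> i = j" for S T :: "6 \<Rightarrow> 6 set"
  proof -
    have "(column_matrix T ** column_matrix S) $ i $ j = of_bool (odd (card {k. i \<in> T k \<and> k \<in> S j}))" for i j
    proof -
      have "(column_matrix T ** column_matrix S) $ i $ j = (\<Sum>k\<in>UNIV. of_bool (i \<in> T k \<and> k \<in> S j))"
        unfolding matrix_matrix_mult_def column_matrix_def by (auto intro!: sum.cong)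
      also have "\<dots> = of_nat (card {k. i \<in> T k \<and> k \<in> S j})"
        by (subst sum_of_bool_eq) simp_all
      also have "\<dots> = of_bool (odd (card {k. i \<in> T k \<and> k \<in> S j}))"
        by (rule of_nat_char2) simp
      finally show ?thesis .
    qed
    then show ?thesis by (simp add: vec_eq_iff mat_def that)
  qed
  with assms show ?thesis unfolding invertible_def by blast
qed

lemma toK_var_sum: "toK (var_sum T) = (\<Sum>i\<in>T. toK (X i))"
  by (simp add: var_sum_def toK_sum)

text \<open>An equality of homomorphisms has to be tested on the variables only.\<close>

lemma hom_ext_column_matrix:
  assumes "\<And>i. hom_ext const \<phi> (toK (X i)) = (\<Sum>k\<in>T i. toK (X k))"
  shows "hom_ext const \<phi> (toK f) = toK (lin_subst (column_matrix T) f)"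
  by (rule hom_ext_toK) (simp add: assms lin_subst_column_matrix toK_var_sum)

text \<open>Multiplication by \<open>\<beta>\<close> with respect to the normal basis; the entries are read off from \<open>cj_mult\<close>.\<close>

definition torus_columns :: "6 \<Rightarrow> 6 set" where
  "torus_columns i = (if i = 0 then {1} else if i = 1 then {0, 4} else if i = 2 then {3, 4}
     else if i = 3 then {2, 5} else if i = 4 then {1, 2} else {3, 5})"

definition frobenius_columns :: "6 \<Rightarrow> 6 set" where
  "frobenius_columns i = {i - 1}"

text \<open>An element of the group ring of the cyclic group of rotations that is a unit with inverse
  \<open>j \<mapsto> {j + 1, j + 2, j + 5}\<close>.\<close>

definition circulant_columns :: "6 \<Rightarrow> 6 set" where
  "circulant_columns i = {i, i - 1, i - 3}"

definition torus :: "PK \<Rightarrow> PK" where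
  "torus = hom_ext const (\<lambda>j. const (cj j) * Z j)"

definition frobenius :: "PK \<Rightarrow> PK" where
  "frobenius = hom_ext const (\<lambda>j. Z (j + 1))"

definition circulant :: "PK \<Rightarrow> PK" where
  "circulant = hom_ext const (\<lambda>j. Z j + Z (j + 1) + Z (j + 3))"

lemma all_6: "(\<forall>i::6. P i) \<longleftrightarrow> P 0 \<and> P 1 \<and> P 2 \<and> P 3 \<and> P 4 \<and> P 5"
  by (metis exhaust_6)

lemma Collect_6: "{k::6. P k} = (if P 0 then {0} else {}) \<union> (if P 1 then {1} else {}) \<union> (if P 2 then {2} else {})
    \<union> (if P 3 then {3} else {}) \<union> (if P 4 then {4} else {}) \<union> (if P 5 then {5} else {})"
  (is "_ = ?R")
proof (rule Set.set_eqI)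
  show "x \<in> {k. P k} \<longleftrightarrow> x \<in> ?R" for x
    using exhaust_6[of x] by (elim disjE) auto
qed

lemma mult_cj_0: "(\<Sum>k\<in>torus_columns i. cj k) = cj i * cj 0"
proof -
  have "cj 0 * cj 0 = cj 1" using cj_Suc[of 0] by (simp add: power2_eq_square)
  moreover have "cj 1 * cj 0 = cj 0 + cj 4" using cj_mult(1)[of 0] by (simp only: add_0 mult.commute)
  moreover have "cj 2 * cj 0 = cj 3 + cj 4" using cj_mult(2)[of 0] by (simp only: add_0 mult.commute)
  moreover have "cj 3 * cj 0 = cj 2 + cj 5" using cj_mult(3)[of 0] by (simp only: add_0 mult.commute)
  moreover have "cj 4 * cj 0 = cj 1 + cj 2"
  proof -
    have "4 + 2 = (0::6)" "4 + 3 = (1::6)" "4 + 4 = (2::6)" by simp_all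
    then show ?thesis using cj_mult(2)[of 4] by metis
  qed
  moreover have "cj 5 * cj 0 = cj 3 + cj 5"
  proof -
    have "5 + 1 = (0::6)" "5 + 4 = (3::6)" by simp_all
    then show ?thesis using cj_mult(1)[of 5] by (metis add.commute)
  qed
  ultimately show ?thesis
    using exhaust_6[of i] by (auto simp: torus_columns_def simp del: cj_simps)
qed

lemma mult_cj: "(\<Sum>k\<in>torus_columns i. cj (k + j)) = cj (i + j) * cj j"
proof (induction j rule: frobenius_induct_6)
  case 1
  then show ?case using mult_cj_0[of i] by simp
next
  case (2 j)
  have sq: "(\<Sum>k\<in>S. r k)\<^sup>2 = (\<Sum>k\<in>S. (r k)\<^sup>2)" for r :: "6 \<Rightarrow> K" and S
    by (induction S rule: infinite_finite_induct) (simp_all add: K_square_add)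
  have "(\<Sum>k\<in>torus_columns i. cj (k + (j + 1))) = (\<Sum>k\<in>torus_columns i. cj (k + j))\<^sup>2"
    by (simp only: sq cj_Suc add.assoc[symmetric])
  also have "\<dots> = cj (i + (j + 1)) * cj (j + 1)"
    by (simp only: 2 cj_Suc add.assoc[symmetric] power_mult_distrib)
  finally show ?case .
qed

lemma torus_toK: "torus (toK f) = toK (lin_subst (column_matrix torus_columns) f)"
  unfolding torus_def
proof (rule hom_ext_column_matrix)
  fix i
  have "(\<Sum>k\<in>torus_columns i. toK (X k)) = (\<Sum>j\<in>UNIV. const (\<Sum>k\<in>torus_columns i. cj (k + j)) * Z j)"
    unfolding toK_X by (subst sum.swap) (simp add: const_sum sum_distrib_right)
  then show "hom_ext const (\<lambda>j. const (cj j) * Z j) (toK (X i)) = (\<Sum>k\<in>torus_columns i. toK (X k))"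
    by (simp add: mult_cj toK_X mult.assoc)
qed

lemma hom_ext_shift: "hom_ext const (\<lambda>j. Z (j + d)) (toK (X i)) = toK (X (i - d))"
proof -
  have "toK (X (i - d)) = (\<Sum>j\<in>UNIV. const (cj (i - d + (j + d))) * Z (j + d))"
    unfolding toK_X by (rule sum_shift_6[symmetric])
  then show ?thesis by (simp add: toK_X)
qed

lemma frobenius_toK: "frobenius (toK f) = toK (lin_subst (column_matrix frobenius_columns) f)"
  unfolding frobenius_def
  by (rule hom_ext_column_matrix) (simp add: hom_ext_shift frobenius_columns_def)

lemma circulant_toK: "circulant (toK f) = toK (lin_subst (column_matrix circulant_columns) f)"
  unfolding circulant_def
proof (rule hom_ext_column_matrix)
  fix i :: 6
  have "hom_ext const (\<lambda>j. Z j + Z (j + 1) + Z (j + 3)) (toK (X i))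
      = hom_ext const (\<lambda>j. Z (j + 0)) (toK (X i)) + hom_ext const (\<lambda>j. Z (j + 1)) (toK (X i))
        + hom_ext const (\<lambda>j. Z (j + 3)) (toK (X i))"
    by (simp add: toK_X distrib_left sum.distrib)
  also have "\<dots> = toK (X i) + toK (X (i - 1)) + toK (X (i - 3))"
    by (simp only: hom_ext_shift diff_0_right)
  also have "\<dots> = (\<Sum>k\<in>circulant_columns i. toK (X k))"
  proof -
    have "i \<noteq> i - 1" "i \<noteq> i - 3" "i - 1 \<noteq> i - 3"
      using exhaust_6[of i] by auto
    then show ?thesis by (simp add: circulant_columns_def add.assoc)
  qed
  finally show "hom_ext const (\<lambda>j. Z j + Z (j + 1) + Z (j + 3)) (toK (X i)) = (\<Sum>k\<in>circulant_columns i. toK (X k))" .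
qed

lemma invertible_torus: "invertible (column_matrix torus_columns)"
  by (rule invertible_column_matrix[where S = "\<lambda>j. if j = 0 then {0, 1, 2, 3, 4, 5} else if j = 1 then {0}
      else if j = 2 then {0, 4} else if j = 3 then {0, 3, 4, 5} else if j = 4 then {0, 2, 3, 4, 5} else {0, 3, 4}"];
    (subst Collect_6)?; (use exhaust_6 in \<open>auto simp: torus_columns_def\<close>)?)

lemma invertible_frobenius: "invertible (column_matrix frobenius_columns)"
proof (rule invertible_column_matrix[where S = "\<lambda>j. {j + 1}"])
  show "odd (card {k. i \<in> frobenius_columns k \<and> k \<in> {j + 1}}) \<longleftrightarrow> i = j" for i j
  proof -
    have "{k. i \<in> frobenius_columns k \<and> k \<in> {j + 1}} = (if i = j then {j + 1} else {})"
      by (auto simp: frobenius_columns_def)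
    then show ?thesis by simp
  qed
  show "odd (card {k. i \<in> {k + 1} \<and> k \<in> frobenius_columns j}) \<longleftrightarrow> i = j" for i j
  proof -
    have "{k. i \<in> {k + 1} \<and> k \<in> frobenius_columns j} = (if i = j then {j - 1} else {})"
      by (auto simp: frobenius_columns_def)
    then show ?thesis by simp
  qed
qed

lemma invertible_circulant: "invertible (column_matrix circulant_columns)"
proof -
  have "(\<forall>i j. odd (card {k. i \<in> circulant_columns k \<and> k \<in> {j + 1, j + 2, j + 5}}) \<longleftrightarrow> i = j) \<and>
     (\<forall>i j. odd (card {k. i \<in> {k + 1, k + 2, k + 5} \<and> k \<in> circulant_columns j}) \<longleftrightarrow> i = j)"
    unfolding Collect_6 all_6 by (simp add: circulant_columns_def)
  then show ?thesis
    using invertible_column_matrix[where T = circulant_columns and S = "\<lambda>j. {j + 1, j + 2, j + 5}"] by blast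
qed

subsection \<open>Action on eigenmonomials\<close>

text \<open>The exponent of \<open>\<beta>\<close> in the eigenvalue of a monomial, since \<open>Z\<^sub>j\<close> has eigenvalue \<open>\<beta>\<close> to the power \<open>2\<^sup>j\<close>.\<close>

definition weight :: "nat list \<Rightarrow> nat" where
  "weight a = a ! 0 + 2 * a ! 1 + 4 * a ! 2 + 8 * a ! 3 + 16 * a ! 4 + 32 * a ! 5"

lemma rot_simp: "rot [a0, a1, a2, a3, a4, a5] = [a5, a0, a1, a2, a3, a4]"
  by (simp add: rot_def)

lemma length_rot: "length a = 6 \<Longrightarrow> length (rot a) = 6"
  by (erule length_6_cases) (simp add: rot_simp)

lemma torus_Zl: "length a = 6 \<Longrightarrow> torus (Zl a) = const (\<beta> ^ weight a) * Zl a"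
proof (erule length_6_cases)
  fix a0 a1 a2 a3 a4 a5 assume a: "a = [a0, a1, a2, a3, a4, a5]"
  have "torus (Zl a) = (const \<beta> * Z 0) ^ a0 * (const (\<beta> ^ 2) * Z 1) ^ a1 * (const (\<beta> ^ 4) * Z 2) ^ a2
      * (const (\<beta> ^ 8) * Z 3) ^ a3 * (const (\<beta> ^ 16) * Z 4) ^ a4 * (const (\<beta> ^ 32) * Z 5) ^ a5"
    unfolding torus_def a Zl_def const.hom_ext_Zmon' eval_mon_mon_of by simp
  then show "torus (Zl a) = const (\<beta> ^ weight a) * Zl a"
    by (simp only: power_mult_distrib const_power[symmetric] power_mult[symmetric])
       (simp add: a weight_def Zl_eq power_add ac_simps)
qed

lemma frobenius_Zl: "length a = 6 \<Longrightarrow> frobenius (Zl a) = Zl (rot a)"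
proof (erule length_6_cases)
  fix a0 a1 a2 a3 a4 a5 assume a: "a = [a0, a1, a2, a3, a4, a5]"
  have "1 + 1 = (2::6)" "2 + 1 = (3::6)" "3 + 1 = (4::6)" "4 + 1 = (5::6)" "5 + 1 = (0::6)"
    by simp_all
  then have "frobenius (Zl a) = Z 1 ^ a0 * Z 2 ^ a1 * Z 3 ^ a2 * Z 4 ^ a3 * Z 5 ^ a4 * Z 0 ^ a5"
    unfolding frobenius_def a Zl_def const.hom_ext_Zmon' eval_mon_mon_of by (simp only: add_0)
  then show "frobenius (Zl a) = Zl (rot a)"
    by (simp only: a rot_simp Zl_eq) (simp only: ac_simps)
qed

lemma torus_linear: "torus (p + q) = torus p + torus q" "torus (const c * p) = const c * torus p" "torus 0 = 0"
  and frobenius_linear: "frobenius (p + q) = frobenius p + frobenius q"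
    "frobenius (const c * p) = const c * frobenius p" "frobenius 0 = 0"
  and circulant_linear: "circulant (p + q) = circulant p + circulant q"
    "circulant (const c * p) = const c * circulant p" "circulant 0 = 0"
  by (simp_all add: torus_def frobenius_def circulant_def)

lemma torus_hitK: "p \<in> hitK \<Longrightarrow> torus p \<in> hitK"
  using hom_ext_hitK[of "\<lambda>j. const (cj j) * Z j"] torus_toK unfolding torus_def by blast

lemma frobenius_hitK: "p \<in> hitK \<Longrightarrow> frobenius p \<in> hitK"
  using hom_ext_hitK[of "\<lambda>j. Z (j + 1)"] frobenius_toK unfolding frobenius_def by blast

lemma circulant_hitK: "p \<in> hitK \<Longrightarrow> circulant p \<in> hitK"
  using hom_ext_hitK[of "\<lambda>j. Z j + Z (j + 1) + Z (j + 3)"] circulant_toK unfolding circulant_def by blast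

subsection \<open>Averaging over the torus\<close>

lemma PK_expand: "p = (\<Sum>m\<in>keys p. const (lookup p m) * Zmon m)"
proof -
  have "hom_ext const Z p = p"
    by (induction p rule: PK_induct) (simp_all add: eval_mon_Z)
  then show ?thesis by (simp add: hom_ext_def eval_mon_Z)
qed

lemma \<beta>_power_eq_1_iff: "\<beta> ^ n = 1 \<longleftrightarrow> 63 dvd n"
proof
  assume n: "\<beta> ^ n = 1"
  define g where "g = gcd n 63"
  have "\<beta> ^ g = 1"
  proof -
    obtain x y where "63 * x = n * y + g"
      using bezout_nat[of 63 n] by (auto simp: g_def gcd.commute)
    then have "\<beta> ^ (63 * x) = \<beta> ^ (n * y + g)" by simp
    then show ?thesis by (simp add: power_add power_mult n \<beta>_order)
  qed
  have "g dvd 63" by (simp add: g_def)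
  then obtain h where h: "63 = g * h" ..
  consider "g = 63" | "g dvd 21" | "g dvd 9"
  proof (cases "h = 1")
    case False
    then obtain q :: nat where q: "Factorial_Ring.prime q" "q dvd h" using prime_factor_nat by blast
    then have "q dvd 3 * (3 * 7)" using h dvd_mult[of q h g] by simp
    then have "q dvd 3 \<or> q dvd 7" using q(1) by (metis prime_dvd_multD)
    then have "q = 3 \<or> q = 7"
      using primes_dvd_imp_eq[OF q(1), of 3] primes_dvd_imp_eq[OF q(1), of 7] by auto
    moreover obtain k where k: "h = q * k" using q(2) ..
    moreover have "g dvd 21" if "q = 3"
      using h k that by (intro dvdI[of _ _ k]) simp
    moreover have "g dvd 9" if "q = 7"
      using h k that by (intro dvdI[of _ _ k]) simp
    ultimately show thesis using that by blast
  qed (use h that in simp)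
  then show "63 dvd n"
  proof cases
    case 1
    then show ?thesis by (metis g_def gcd_dvd1)
  next
    case 2
    then show ?thesis using \<open>\<beta> ^ g = 1\<close> \<beta>_order(2) by (auto simp: power_mult elim!: dvdE)
  next
    case 3
    then show ?thesis using \<open>\<beta> ^ g = 1\<close> \<beta>_order(3) by (auto simp: power_mult elim!: dvdE)
  qed
qed (auto simp: power_mult \<beta>_order elim!: dvdE)

lemma sum_\<beta>_powers: "(\<Sum>k<63. (\<beta> ^ n) ^ k) = of_bool (63 dvd n)"
proof (cases "63 dvd n")
  case True
  then have "\<beta> ^ n = 1" by (simp add: \<beta>_power_eq_1_iff)
  then have "(\<Sum>k<63. (\<beta> ^ n) ^ k) = of_nat 63" by simp
  also have "\<dots> = 1" by (subst of_nat_char2[OF K_char2]) simp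
  finally show ?thesis using True by simp
next
  case False
  then have "\<beta> ^ n \<noteq> 1" by (simp add: \<beta>_power_eq_1_iff)
  moreover have "(\<beta> ^ n) ^ 63 = 1" by (metis \<beta>_order(1) power_commuting_commutes power_mult power_one mult.commute)
  ultimately show ?thesis using False by (simp add: geometric_sum)
qed

definition weight_zero_part :: "PK \<Rightarrow> PK" where
  "weight_zero_part p = (\<Sum>m\<in>keys p.
     const (lookup p m * of_bool (63 dvd weight (exps m))) * Zmon m)"

text \<open>The sum of the 63 translates of \<open>p\<close> is congruent to \<open>63 p = p\<close>.  In this sum the coefficient of a
  monomial is multiplied by a sum of powers of a root of unity, which vanishes unless its weight is
  divisible by 63.\<close>

lemma torus_average:
  assumes "p + torus p \<in> hitK"
  shows "p + weight_zero_part p \<in> hitK"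
proof -
  let ?c = "\<lambda>m. lookup p m"
  have pow: "(torus ^^ k) p = (\<Sum>m\<in>keys p. const (?c m * (\<beta> ^ weight (exps m)) ^ k) * Zmon m)" for k
  proof (induction k)
    case 0
    then show ?case using PK_expand[of p] by simp
  next
    case (Suc k)
    have lin: "torus (\<Sum>m\<in>I. const (r m) * Zmon m) = (\<Sum>m\<in>I. const (r m * \<beta> ^ weight (exps m)) * Zmon m)" for I r
      by (induction I rule: infinite_finite_induct)
         (simp_all add: torus_linear torus_Zl Zmon_eq_Zl mult.assoc)
    show ?case
      by (simp only: funpow.simps o_apply Suc lin power_Suc) (simp only: ac_simps)
  qed
  have sum: "(\<Sum>k<63. (torus ^^ k) p) = weight_zero_part p"
  proof -
    have "(\<Sum>k<63. (torus ^^ k) p)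
        = (\<Sum>m\<in>keys p. const (\<Sum>k<63. ?c m * (\<beta> ^ weight (exps m)) ^ k) * Zmon m)"
      unfolding pow by (subst sum.swap) (simp only: const_sum sum_distrib_right)
    then show ?thesis
      by (simp only: weight_zero_part_def sum_distrib_left[symmetric] sum_\<beta>_powers)
  qed
  have orbit: "p + (torus ^^ k) p \<in> hitK" for k
  proof (induction k)
    case 0
    then show ?case by (simp add: PK_add_self hitK.zero)
  next
    case (Suc k)
    from torus_hitK[OF this] have "torus p + (torus ^^ Suc k) p \<in> hitK" by (simp add: torus_linear)
    from hitK_add[OF assms this] have "p + (torus p + torus p) + (torus ^^ Suc k) p \<in> hitK"
      by (simp only: add.assoc)
    then show ?case by (simp only: PK_add_self add_0_right)
  qed
  have "(\<Sum>k<n. p + (torus ^^ k) p) = of_nat n * p + (\<Sum>k<n. (torus ^^ k) p)" for n :: nat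
    by (induction n) (simp_all add: algebra_simps)
  from this[of 63] have "(\<Sum>k<63. p + (torus ^^ k) p) = p + weight_zero_part p"
    unfolding sum by (subst (asm) of_nat_char2[OF PK_char2]) simp
  moreover have "(\<Sum>k<63. p + (torus ^^ k) p) \<in> hitK" by (intro hitK_sum orbit)
  ultimately show ?thesis by simp
qed

subsection \<open>Degrees\<close>

definition homogeneousK :: "nat \<Rightarrow> PK set" where
  "homogeneousK d = {p. \<forall>m\<in>keys p. mon_degree m = d}"

lemma mon_degree_add: "mon_degree (m + n) = mon_degree m + mon_degree n"
  by (simp add: mon_degree_def lookup_add sum.distrib)

lemma mon_degree_eq: "mon_degree m = sum_list (exps m)"
  by (simp add: mon_degree_def sum_UNIV_6 exps_def)

lemma homogeneousK_0: "0 \<in> homogeneousK d"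
  by (simp add: homogeneousK_def)

lemma homogeneousK_add: "p \<in> homogeneousK d \<Longrightarrow> q \<in> homogeneousK d \<Longrightarrow> p + q \<in> homogeneousK d"
  using keys_add[of p q] by (auto simp: homogeneousK_def)

lemma homogeneousK_sum: "(\<And>i. i \<in> I \<Longrightarrow> f i \<in> homogeneousK d) \<Longrightarrow> (\<Sum>i\<in>I. f i) \<in> homogeneousK d"
  by (induction I rule: infinite_finite_induct) (auto intro: homogeneousK_add homogeneousK_0)

lemma homogeneousK_mult: "p \<in> homogeneousK d \<Longrightarrow> q \<in> homogeneousK e \<Longrightarrow> p * q \<in> homogeneousK (d + e)"
  using keys_mult[of p q] by (fastforce simp: homogeneousK_def mon_degree_add)

lemma homogeneousK_1: "1 \<in> homogeneousK 0"
  by (auto simp: homogeneousK_def mon_degree_def)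

lemma homogeneousK_power: "p \<in> homogeneousK d \<Longrightarrow> p ^ n \<in> homogeneousK (n * d)"
  by (induction n) (auto intro: homogeneousK_mult homogeneousK_1)

lemma homogeneousK_const_Z: "const c * Z i \<in> homogeneousK 1"
proof -
  have "mon_degree (single i (Suc 0)) = 1"
    using exhaust_6[of i] by (auto simp: mon_degree_def sum_UNIV_6 lookup_single when_def)
  then show ?thesis
    by (auto simp: homogeneousK_def Z_def simp flip: single_eq_const_Zmon split: if_splits)
qed

lemma toK_homogeneous: "f \<in> homogeneous d \<Longrightarrow> toK f \<in> homogeneousK d"
  unfolding toK_def eval_poly_def
proof (rule homogeneousK_sum)
  fix m assume "f \<in> homogeneous d" "m \<in> keys f"
  then have deg: "d = mon_degree m" by (simp add: homogeneous_def)
  have lin: "(\<Sum>j\<in>UNIV. const (cj (i + j)) * Z j) \<in> homogeneousK 1" for i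
    by (intro homogeneousK_sum homogeneousK_const_Z)
  have "(\<Prod>i\<in>I. (\<Sum>j\<in>UNIV. const (cj (i + j)) * Z j) ^ n i) \<in> homogeneousK (\<Sum>i\<in>I. n i)" if "finite I" for I n
    using that
  proof induction
    case (insert i I)
    then show ?case using homogeneousK_mult[OF homogeneousK_power[OF lin, of i "n i"]] by simp
  qed (simp add: homogeneousK_1)
  from this[of UNIV "lookup m"]
  show "eval_mon (\<lambda>i. \<Sum>j\<in>UNIV. const (cj (i + j)) * Z j) m \<in> homogeneousK d"
    by (simp add: eval_mon_def deg mon_degree_def)
qed

section \<open>Reduction of the monomials of weight zero\<close>

definition basis :: "nat list list" where
  "basis = bottom # concat (map rotations reps)"

text \<open>The span of the basis monomials modulo hit elements.\<close>

inductive_set spanned :: "PK set" where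
  hit: "p \<in> hitK \<Longrightarrow> p \<in> spanned"
| base: "b \<in> set basis \<Longrightarrow> const c * Zl b + p \<in> spanned" if "p \<in> spanned"

lemma spanned_0: "0 \<in> spanned"
  by (intro spanned.hit hitK.zero)

lemma spanned_Zl: "b \<in> set basis \<Longrightarrow> Zl b \<in> spanned"
  using spanned.base[OF spanned_0, of b 1] by simp

lemma spanned_add: "p \<in> spanned \<Longrightarrow> q \<in> spanned \<Longrightarrow> p + q \<in> spanned"
proof (induction rule: spanned.induct)
  case (hit p)
  from hit(2,1) show ?case
  proof (induction rule: spanned.induct)
    case (hit q)
    then show ?case by (intro spanned.hit hitK_add)
  next
    case (base q b c)
    then show ?case using spanned.base[of "p + q" b c] by (simp add: ac_simps)
  qed
next
  case (base p b c)
  then show ?case using spanned.base[of "p + q" b c] by (simp add: add.assoc)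
qed

lemma spanned_const_mult: "p \<in> spanned \<Longrightarrow> const d * p \<in> spanned"
proof (induction rule: spanned.induct)
  case (base p b c)
  then show ?case using spanned.base[of "const d * p" b "d * c"] by (simp add: distrib_left mult.assoc)
qed (intro spanned.hit hitK_const_mult)

lemma spanned_sum: "(\<And>i. i \<in> I \<Longrightarrow> f i \<in> spanned) \<Longrightarrow> (\<Sum>i\<in>I. f i) \<in> spanned"
  by (induction I rule: infinite_finite_induct) (auto intro: spanned_add spanned_0)

lemma PK_eq_iff: "p + q = 0 \<longleftrightarrow> p = (q :: PK)"
  by (metis PK_add_self add_left_imp_eq)

lemma PK_two [simp]: "2 * p = (0 :: PK)"
  by (simp only: mult_2 PK_add_self)

lemma PK_cancel: "p + (p + q) = (q :: PK)"
  by (simp only: add.assoc[symmetric] PK_add_self add_0_left)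

lemma SqK_terms_hitK:
  assumes "list_all (\<lambda>(k, b). k \<noteq> 0 \<and> length b = 6) cs"
  shows "(\<Sum>t\<leftarrow>SqK_terms cs. Zl t) \<in> hitK"
  using assms
proof (induction cs rule: SqK_terms.induct)
  case (2 k b cs)
  then show ?case
    using SqK_hitK[of k "Zl b"] by (simp add: SqK_Zl hitK_add)
qed (simp add: hitK.zero)

text \<open>The certificate \<open>shift_bottom_pairs_off\<close> read as a congruence.\<close>

lemma bottom_rot: "Zl bottom + Zl (rot bottom) \<in> hitK"
proof -
  let ?cs = "[(3, [0, 0, 1, 1, 5, 5]), (2, [0, 2, 0, 1, 5, 5]), (2, [4, 0, 0, 1, 1, 7]), (1, [4, 0, 2, 0, 1, 7])]"
  have "(\<Sum>t\<leftarrow>bottom # rot bottom # SqK_terms ?cs. Zl t) = 0"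
    using shift_bottom_pairs_off by (intro sum_list_pairs_off) (simp_all add: PK_add_self del: pairs_off.simps)
  then have "(Zl bottom + Zl (rot bottom)) + (\<Sum>t\<leftarrow>SqK_terms ?cs. Zl t) = 0"
    by (simp only: list.map sum_list.Cons add.assoc)
  then have "Zl bottom + Zl (rot bottom) = (\<Sum>t\<leftarrow>SqK_terms ?cs. Zl t)"
    by (simp only: PK_eq_iff)
  moreover have "(\<Sum>t\<leftarrow>SqK_terms ?cs. Zl t) \<in> hitK" by (rule SqK_terms_hitK) simp
  ultimately show ?thesis by (simp only:)
qed

lemma rot_6: "length a = 6 \<Longrightarrow> rot (rot (rot (rot (rot (rot a))))) = a"
  by (erule length_6_cases) (simp add: rot_simp)

lemma reps_length: "r \<in> set (bottom # reps) \<Longrightarrow> length r = 6"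
  by (auto simp: reps_def bottom_def)

lemma frobenius_spanned: "p \<in> spanned \<Longrightarrow> frobenius p \<in> spanned"
proof (induction rule: spanned.induct)
  case (hit p)
  then show ?case by (intro spanned.hit frobenius_hitK)
next
  case (base p b c)
  have "Zl (rot b) \<in> spanned"
  proof (cases "b = bottom")
    case True
    have "Zl bottom + (Zl bottom + Zl (rot bottom)) \<in> spanned"
      by (intro spanned_add spanned.hit[OF bottom_rot] spanned_Zl) (simp add: basis_def)
    then show ?thesis unfolding True PK_cancel .
  next
    case False
    then obtain r where "r \<in> set reps" "b \<in> set (rotations r)" using base by (auto simp: basis_def)
    then have "rot b \<in> set (rotations r)"
      using rot_6[of r] reps_length[of r] by (auto simp: rotations_def)
    then show ?thesis using \<open>r \<in> set reps\<close> by (intro spanned_Zl) (auto simp: basis_def)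
  qed
  moreover have "length b = 6"
    using base(2) reps_length by (auto simp: basis_def rotations_def length_rot)
  ultimately show ?case
    using base by (simp add: frobenius_linear frobenius_Zl spanned_add spanned_const_mult)
qed

lemma Zl_rot_spanned: "length a = 6 \<Longrightarrow> Zl a \<in> spanned \<Longrightarrow> Zl (rot a) \<in> spanned"
  using frobenius_spanned[of "Zl a"] by (simp add: frobenius_Zl)

lemma Zl_rotations_spanned: "length a = 6 \<Longrightarrow> Zl a \<in> spanned \<Longrightarrow> r \<in> set (rotations a) \<Longrightarrow> Zl r \<in> spanned"
  by (auto simp: rotations_def length_rot Zl_rot_spanned)

lemma encode_inj: "digits a \<Longrightarrow> digits b \<Longrightarrow> length a = length b \<Longrightarrow> encode a = encode b \<Longrightarrow> a = b"
proof (induction a arbitrary: b)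
  case (Cons x a)
  then obtain y b' where b: "b = y # b'" by (cases b) auto
  have "x < 16" "y < 16" "x + 16 * encode a = y + 16 * encode b'"
    using Cons.prems by (auto simp: b digits_def encode_def)
  then have "x = y" "encode a = encode b'" by presburger+
  then show ?case using Cons by (auto simp: b digits_def)
qed simp

lemma digits_rot: "length a = 6 \<Longrightarrow> digits a \<Longrightarrow> digits (rot a)"
  by (erule length_6_cases) (auto simp: rot_simp digits_def)

lemma rotations_length_digits:
  "length a = 6 \<Longrightarrow> r \<in> set (rotations a) \<Longrightarrow> length r = 6"
  "length a = 6 \<Longrightarrow> digits a \<Longrightarrow> r \<in> set (rotations a) \<Longrightarrow> digits r"
  by (auto simp: rotations_def length_rot digits_rot)

text \<open>The invariant of the walk through the reduction table.\<close>

definition known_spanned :: "nat list \<Rightarrow> bool" where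
  "known_spanned known \<longleftrightarrow>
     (\<forall>t. length t = 6 \<longrightarrow> digits t \<longrightarrow> encode t \<in> set known \<longrightarrow> Zl t \<in> spanned)"

lemma known_spanned_append:
  assumes "known_spanned known" "\<And>r. r \<in> set rs \<Longrightarrow> length r = 6 \<and> digits r \<and> Zl r \<in> spanned"
  shows "known_spanned (map encode rs @ known)"
  using assms unfolding known_spanned_def by auto (metis encode_inj)

lemma unknown_terms_sum:
  assumes "known_spanned known" "\<And>t. t \<in> set ts \<Longrightarrow> length t = 6"
  shows "(\<Sum>t\<leftarrow>ts. Zl t) + (\<Sum>t\<leftarrow>unknown_terms known ts. Zl t) \<in> spanned"
  using assms(2)
proof (induction ts)
  case (Cons t ts)
  let ?S = "(\<Sum>t\<leftarrow>ts. Zl t) + (\<Sum>t\<leftarrow>unknown_terms known ts. Zl t)"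
  have IH: "?S \<in> spanned" using Cons by simp
  show ?case
  proof (cases "digits t \<and> encode t \<in> set known")
    case True
    then have "Zl t \<in> spanned" using assms(1) Cons.prems by (auto simp: known_spanned_def)
    then show ?thesis using spanned_add[OF _ IH] True by (simp add: add.assoc)
  next
    case False
    have "(Zl t + sum_list (map Zl ts)) + (Zl t + (\<Sum>t\<leftarrow>unknown_terms known ts. Zl t)) = (Zl t + Zl t) + ?S"
      by (simp only: ac_simps)
    then show ?thesis using IH False by (simp only: unknown_terms.simps if_False append.simps list.map sum_list.Cons PK_add_self add_0_left)
  qed
qed (simp add: spanned_0)

lemma SqK_terms_length:
  "list_all (\<lambda>(k, b). k \<noteq> 0 \<and> length b = 6) cs \<Longrightarrow> t \<in> set (SqK_terms cs) \<Longrightarrow> length t = 6"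
  by (induction cs rule: SqK_terms.induct) (auto dest: length_SqK_exponents)

lemma is_reduction_spanned:
  assumes "is_reduction known tab" "known_spanned known"
    "list_all (\<lambda>(a, cs). length a = 6 \<and> list_all (\<lambda>(k, b). k \<noteq> 0 \<and> length b = 6) cs) tab"
    "a \<in> set (map fst tab)"
  shows "Zl a \<in> spanned \<and> digits a"
  using assms
proof (induction known tab rule: is_reduction.induct)
  case (2 known a' cs tab)
  then have len: "length a' = 6" and cs: "list_all (\<lambda>(k, b). k \<noteq> 0 \<and> length b = 6) cs" and dig: "digits a'"
    and pairs: "pairs_off (a' # unknown_terms known (SqK_terms cs))"
    by auto
  have "(\<Sum>t\<leftarrow>a' # unknown_terms known (SqK_terms cs). Zl t) = 0"
    using pairs by (intro sum_list_pairs_off) (simp_all add: PK_add_self)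
  then have "Zl a' = (\<Sum>t\<leftarrow>unknown_terms known (SqK_terms cs). Zl t)" by (simp add: PK_eq_iff)
  moreover have "(\<Sum>t\<leftarrow>SqK_terms cs. Zl t) + ((\<Sum>t\<leftarrow>SqK_terms cs. Zl t) + (\<Sum>t\<leftarrow>unknown_terms known (SqK_terms cs). Zl t)) \<in> spanned"
    by (intro spanned_add unknown_terms_sum 2 spanned.hit SqK_terms_hitK cs SqK_terms_length[OF cs])
  ultimately have "Zl a' \<in> spanned" by (simp add: PK_add_self flip: add.assoc)
  moreover have "known_spanned (map encode (rotations a') @ known)"
    using \<open>Zl a' \<in> spanned\<close> len dig rotations_length_digits Zl_rotations_spanned
    by (intro known_spanned_append 2) blast
  ultimately show ?case using "2.IH" "2.prems" dig by auto
qed simp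

lemma table_spanned:
  assumes "a \<in> set (bottom # reps @ map fst reduction_table)"
  shows "Zl a \<in> spanned \<and> digits a \<and> length a = 6"
proof (cases "a \<in> set (bottom # reps)")
  case True
  moreover have "list_all digits (bottom # reps)"
    by (simp add: bottom_def reps_def digits_def)
  ultimately show ?thesis
    using reps_length by (auto simp: list_all_iff basis_def rotations_def intro!: spanned_Zl)
next
  case False
  have tab: "list_all (\<lambda>(a, cs). length a = 6 \<and> list_all (\<lambda>(k, b). k \<noteq> 0 \<and> length b = 6) cs) reduction_table"
    by (simp add: reduction_table_def)
  have start: "Zl r \<in> spanned" "digits r" if "r \<in> set (bottom # reps)" for r
    using that by (auto simp: basis_def rotations_def bottom_def reps_def digits_def intro!: spanned_Zl)
  have "known_spanned (map encode (concat (map rotations (bottom # reps))) @ [])"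
  proof (rule known_spanned_append)
    fix s assume "s \<in> set (concat (map rotations (bottom # reps)))"
    then obtain r where "r \<in> set (bottom # reps)" "s \<in> set (rotations r)" by auto
    then show "length s = 6 \<and> digits s \<and> Zl s \<in> spanned"
      using start rotations_length_digits reps_length Zl_rotations_spanned by blast
  qed (simp add: known_spanned_def)
  then have known: "known_spanned (map encode (concat (map rotations (bottom # reps))))"
    by (simp only: append_Nil2)
  have "a \<in> set (map fst reduction_table)" using assms False by auto
  with is_reduction_spanned[OF is_reduction_table known tab] tab show ?thesis
    by (fastforce simp: list_all_iff)
qed

lemma in_concat_map: "y \<in> set (f x) \<Longrightarrow> x \<in> set xs \<Longrightarrow> y \<in> set (concat (map f xs))"
  by auto

text \<open>At each step the remaining weighted sum is at most the remaining sum times the current weight, which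
  is the largest one left.  So the cut of the search loses nothing.\<close>

lemma weighted_exps_complete:
  "length xs = length ws \<Longrightarrow> \<forall>x\<in>set xs. x \<le> m \<Longrightarrow> sorted_wrt (\<ge>) ws \<Longrightarrow>
     xs \<in> set (weighted_exps m ws (sum_list xs) (sum_list (map2 (*) xs ws)))"
proof (induction xs ws rule: list_induct2)
  case (Cons x xs w ws)
  have "sum_list (map2 (*) xs ws) \<le> sum_list xs * w"
    using Cons.hyps Cons.prems(2)
    by (induction xs ws rule: list_induct2) (auto simp: algebra_simps intro!: add_mono)
  then have le: "sum_list (map2 (*) (x # xs) (w # ws)) \<le> sum_list (x # xs) * w"
    by (simp add: algebra_simps)
  have "x # xs \<in> set (if x * w \<le> sum_list (map2 (*) (x # xs) (w # ws))
      then map ((#) x) (weighted_exps m ws (sum_list (x # xs) - x)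
        (sum_list (map2 (*) (x # xs) (w # ws)) - x * w)) else [])"
    using Cons by simp
  moreover have "x \<in> set [0..<Suc (min m (sum_list (x # xs)))]"
    unfolding set_upt using Cons.prems(1) by (simp add: less_Suc_eq_le)
  ultimately show ?case
    unfolding weighted_exps.simps if_P[OF le] by (intro in_concat_map[where x = x])
qed simp

lemma covered_iff: "covered known as \<longleftrightarrow> (\<forall>a\<in>set as. encode (rev a) \<in> set known)"
  by (induction as) auto

text \<open>A rotation doubles the weight modulo 63, and 2 is a unit modulo 63.\<close>

lemma weight_rot: "length a = 6 \<Longrightarrow> 63 dvd weight (rot a) \<longleftrightarrow> 63 dvd weight a"
proof (erule length_6_cases)
  fix a0 a1 a2 a3 a4 a5 assume a: "a = [a0, a1, a2, a3, a4, a5]"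
  have "weight (rot a) + 63 * a5 = 2 * weight a" by (simp add: a rot_simp weight_def)
  then have "63 dvd weight (rot a) \<longleftrightarrow> 63 dvd 2 * weight a"
    by (metis dvd_add_left_iff dvd_triv_left)
  also have "\<dots> \<longleftrightarrow> 63 dvd weight a"
    by (rule coprime_dvd_mult_right_iff) simp
  finally show ?thesis .
qed

text \<open>The multiples of 63 between the extreme weights of degree 15 are the seven that were enumerated.\<close>

lemma peaked_spanned:
  assumes "length a = 6" "sum_list a = 15" "63 dvd weight a" "peaked a"
  shows "Zl a \<in> spanned"
proof -
  obtain a0 a1 a2 a3 a4 a5 where a: "a = [a0, a1, a2, a3, a4, a5]"
    using assms(1) by (rule length_6_cases)
  have le: "a0 \<le> a5" "a1 \<le> a5" "a2 \<le> a5" "a3 \<le> a5" "a4 \<le> a5" using assms(4) by (auto simp: a peaked_def)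
  have sum: "a0 + a1 + a2 + a3 + a4 + a5 = 15" using assms(2) by (simp add: a)
  have "[a4, a3, a2, a1, a0] \<in> set (weighted_exps a5 [16, 8, 4, 2, 1] (sum_list [a4, a3, a2, a1, a0])
      (sum_list (map2 (*) [a4, a3, a2, a1, a0] [16, 8, 4, 2, 1])))"
    using le by (intro weighted_exps_complete) auto
  moreover have "sum_list [a4, a3, a2, a1, a0] = 15 - a5"
    "sum_list (map2 (*) [a4, a3, a2, a1, a0] [16, 8, 4, 2, 1]) = weight a - a5 * 32"
    using sum by (simp_all add: a weight_def)
  ultimately have "[a4, a3, a2, a1, a0] \<in> set (weighted_exps a5 [16, 8, 4, 2, 1] (15 - a5) (weight a - a5 * 32))"
    by (simp only:)
  moreover have "a5 * 32 \<le> weight a" by (simp add: a weight_def)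
  ultimately have "rev a \<in> set (if a5 * 32 \<le> weight a
      then map ((#) a5) (weighted_exps a5 [16, 8, 4, 2, 1] (15 - a5) (weight a - a5 * 32)) else [])"
    by (simp add: a del: weighted_exps.simps)
  moreover have "a5 \<in> set [0..<16]"
    unfolding set_upt using sum by simp
  ultimately have "rev a \<in> set (peaked_exps (weight a))"
    unfolding peaked_exps_def by (intro in_concat_map[where x = a5])
  moreover have "weight a \<in> set [63, 126, 189, 252, 315, 378, 441]"
  proof -
    obtain q where q: "weight a = 63 * q" using assms(3) ..
    have "15 \<le> weight a" "weight a \<le> 480" using sum by (simp_all add: a weight_def)
    then have "1 \<le> q" "q \<le> 7" using q by simp_all
    then have "q = 1 \<or> q = 2 \<or> q = 3 \<or> q = 4 \<or> q = 5 \<or> q = 6 \<or> q = 7" by linarith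
    then show ?thesis using q by auto
  qed
  ultimately have "rev a \<in> set (concat (map peaked_exps [63, 126, 189, 252, 315, 378, 441]))"
    by auto
  with peaked_exps_covered have "encode (rev (rev a)) \<in>
      set (map encode (filter peaked (concat (map rotations (bottom # reps @ map fst reduction_table)))))"
    unfolding covered_iff by blast
  then obtain r s where r: "r \<in> set (bottom # reps @ map fst reduction_table)" "s \<in> set (rotations r)"
      "encode a = encode s"
    by auto
  have "length s = 6" "digits s" "Zl s \<in> spanned"
    using table_spanned[OF r(1)] r(2) rotations_length_digits Zl_rotations_spanned by blast+
  moreover have "digits a" using sum by (simp add: a digits_def)
  ultimately show ?thesis using encode_inj[of a s] r(3) assms(1) by auto
qed

lemma weight_zero_spanned:
  assumes "length a = 6" "sum_list a = 15" "63 dvd weight a"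
  shows "Zl a \<in> spanned"
proof -
  have "\<exists>r\<in>set (rotations a). peaked r"
  proof -
    obtain a0 a1 a2 a3 a4 a5 where a: "a = [a0, a1, a2, a3, a4, a5]"
      using assms(1) by (rule length_6_cases)
    obtain m where "m \<in> set a" "\<forall>x\<in>set a. x \<le> m"
      using Max_in[of "set a"] Max_ge[of "set a"] by (auto simp: a simp del: Max_insert)
    then have "m = a0 \<or> m = a1 \<or> m = a2 \<or> m = a3 \<or> m = a4 \<or> m = a5"
      "a0 \<le> m \<and> a1 \<le> m \<and> a2 \<le> m \<and> a3 \<le> m \<and> a4 \<le> m \<and> a5 \<le> m"
      by (auto simp: a)
    then show ?thesis
      unfolding a rotations_def rot_simp peaked_def by (elim disjE) simp_all
  qed
  then obtain r where r: "r \<in> set (rotations a)" "peaked r" by blast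
  have rot: "length (rot b) = 6 \<and> sum_list (rot b) = 15 \<and> 63 dvd weight (rot b)"
    if "length b = 6 \<and> sum_list b = 15 \<and> 63 dvd weight b" for b
    using that length_rot[of b] weight_rot[of b] by (auto elim!: length_6_cases simp: rot_simp)
  have "length r = 6 \<and> sum_list r = 15 \<and> 63 dvd weight r"
    using r(1) assms rot unfolding rotations_def by (auto simp del: dvd_imp_mod_0)
  with r(2) have "Zl r \<in> spanned" by (intro peaked_spanned) auto
  moreover have "a \<in> set (rotations r)"
    using r(1) rot_6[OF assms(1)] by (auto simp: rotations_def)
  ultimately show ?thesis
    using Zl_rotations_spanned[of r a] \<open>length r = 6 \<and> _\<close> by blast
qed

lemma weight_zero_part_spanned:
  assumes "p \<in> homogeneousK 15"
  shows "weight_zero_part p \<in> spanned"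
  unfolding weight_zero_part_def
proof (rule spanned_sum)
  fix m assume "m \<in> keys p"
  then have "sum_list (exps m) = 15" using assms by (simp add: homogeneousK_def mon_degree_eq)
  then show "const (lookup p m * of_bool (63 dvd weight (exps m))) * Zmon m \<in> spanned"
    by (cases "63 dvd weight (exps m)")
       (simp_all add: Zmon_eq_Zl spanned_const_mult weight_zero_spanned spanned_0)
qed

section \<open>The coefficients of an invariant\<close>

lemma lookup_Zmon_single_mult:
  "lookup (Zmon (single i q) * p) m =
     (if q \<le> lookup m i then lookup p (m - single i q) else 0)"
proof (induction p rule: PK_induct)
  case (add n c p)
  have "single i q + n = m \<longleftrightarrow> q \<le> lookup m i \<and> n = m - single i q"
  proof
    assume "q \<le> lookup m i \<and> n = m - single i q"
    then show "single i q + n = m"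
      by (intro poly_mapping_eqI) (auto simp: lookup_add lookup_minus lookup_single when_def)
  qed (auto simp: lookup_add)
  then have "lookup (Zmon (single i q) * (const c * Zmon n)) m =
     (if q \<le> lookup m i then lookup (const c * Zmon n) (m - single i q) else 0)"
    by (simp add: mult.left_commute[of "Zmon _"] Zmon_add[symmetric])
       (auto simp: Zmon_def lookup_single when_def)
  with add show ?case by (simp add: distrib_left lookup_add)
qed simp

lemma of_nat_mod_6: "of_nat (n mod 6) = (of_nat n :: 6)"
proof -
  have "of_nat n = (of_nat (6 * (n div 6) + n mod 6) :: 6)" by simp
  also have "\<dots> = of_nat (n mod 6)" by (simp only: of_nat_add of_nat_mult) simp
  finally show ?thesis ..
qed

lemma mon_of_minus_single:
  assumes "i < 6" "length e = 6"
  shows "lookup (mon_of e) (of_nat i) = e ! i"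
    "mon_of e - single (of_nat i) q = mon_of (e[i := e ! i - q])"
proof -
  have i: "i = 0 \<or> i = 1 \<or> i = 2 \<or> i = 3 \<or> i = 4 \<or> i = 5" using assms(1) by linarith
  then show "lookup (mon_of e) (of_nat i) = e ! i" by auto
  from i show "mon_of e - single (of_nat i) q = mon_of (e[i := e ! i - q])"
    by (elim disjE) (auto intro!: mon6_eqI simp: lookup_minus lookup_single when_def assms(2))
qed

definition circulant_factor :: "nat \<times> nat \<Rightarrow> PK" where
  "circulant_factor = (\<lambda>(i, q). Z (of_nat i) ^ q + Z (of_nat i + 1) ^ q + Z (of_nat i + 3) ^ q)"

text \<open>Expanding one factor splits the count of \<open>e\<close> into three, and three parities add up to their exclusive
  disjunction.\<close>

lemma lookup_circulant_factors:
  assumes "length e = 6" "\<forall>(i, q)\<in>set fs. i < 6"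
  shows "lookup (prod_list (map circulant_factor fs)) (mon_of e) = of_bool (expands fs e)"
  using assms
proof (induction fs e rule: expands.induct)
  case (1 e)
  then obtain e0 e1 e2 e3 e4 e5 where e: "e = [e0, e1, e2, e3, e4, e5]" by (auto elim: length_6_cases)
  have "exps 0 = [0, 0, 0, 0, 0, 0]" by (simp add: exps_def)
  moreover have "mon_of [0, 0, 0, 0, 0, 0] = 0" by (simp add: mon_of_def)
  ultimately have "mon_of e = 0 \<longleftrightarrow> e = [0, 0, 0, 0, 0, 0]"
    using exps_mon_of[of e] by (auto simp: e simp del: exps_mon_of)
  then have "lookup 1 (mon_of e) = (of_bool (e = [0, 0, 0, 0, 0, 0]) :: K)"
    by (auto simp: lookup_one when_def)
  then show ?case by (simp add: e)
next
  case (2 i q fs e)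
  let ?P = "prod_list (map circulant_factor fs)"
  have i: "i < 6" using 2 by simp
  have step: "lookup (Z (of_nat j) ^ q * ?P) (mon_of e)
      = of_bool (if q \<le> e ! j then expands fs (e[j := e ! j - q]) else False)"
    if "j < 6" "q \<le> e ! j \<Longrightarrow> lookup ?P (mon_of (e[j := e ! j - q])) = of_bool (expands fs (e[j := e ! j - q]))" for j
    using that 2(4) by (simp add: Z_power lookup_Zmon_single_mult mon_of_minus_single)
  have of_nat: "of_nat i + 1 = (of_nat ((i + 1) mod 6) :: 6)" "of_nat i + 3 = (of_nat ((i + 3) mod 6) :: 6)"
    by (simp_all only: of_nat_mod_6 of_nat_add of_nat_1 of_nat_numeral)
  have xor: "of_bool P + of_bool Q + of_bool R = (of_bool (P \<noteq> (Q \<noteq> R)) :: K)" for P Q R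
    by (cases P; cases Q; cases R) (simp_all only: of_bool_eq add_0_left add_0_right K_char2 simp_thms)
  show ?case
    unfolding list.map prod_list.Cons circulant_factor_def prod.case of_nat distrib_right lookup_add
      expands.simps xor[symmetric]
    using i 2 by (intro arg_cong2[where f = "(+)"] step[unfolded circulant_factor_def]) (auto simp: circulant_factor_def)
qed

lemma bits_value:
  fixes F :: "'a::comm_monoid_mult"
  assumes "n < 16"
  shows "prod_list (map (\<lambda>q. F ^ q) (filter (\<lambda>q. odd (n div q)) [8, 4, 2, 1])) = F ^ n"
proof -
  have "n \<in> set [0..<16]" using assms by simp
  also have "[0..<16] = [0, 1, 2, 3, 4, 5, 6, 7, 8, 9, 10, 11, 12, 13, 14, 15::nat]" by (simp add: upt_rec)
  finally have "n = 0 \<or> n = 1 \<or> n = 2 \<or> n = 3 \<or> n = 4 \<or> n = 5 \<or> n = 6 \<or> n = 7 \<or> n = 8 \<or> n = 9 \<or> n = 10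
      \<or> n = 11 \<or> n = 12 \<or> n = 13 \<or> n = 14 \<or> n = 15" by auto
  then show ?thesis by (elim disjE) (simp_all add: power_add[symmetric] power_Suc[symmetric] power_Suc2[symmetric] del: power_Suc)
qed

lemma circulant_Zl:
  assumes "length b = 6" "digits b"
  shows "circulant (Zl b) = prod_list (map circulant_factor (bits b))"
proof -
  obtain b0 b1 b2 b3 b4 b5 where b: "b = [b0, b1, b2, b3, b4, b5]"
    using assms(1) by (rule length_6_cases)
  let ?F = "\<lambda>i::6. Z i + Z (i + 1) + Z (i + 3)"
  have frob: "circulant_factor (i, q) = ?F (of_nat i) ^ q" if "q \<in> {8, 4, 2, 1}" for i q
  proof -
    have sq: "(x + y + z) ^ 2 = x ^ 2 + y ^ 2 + z ^ 2" for x y z :: PK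
      by (simp add: PK_square_add)
    have four: "w ^ 4 = (w ^ 2) ^ 2" and eight: "w ^ 8 = ((w ^ 2) ^ 2) ^ 2" for w :: PK
      by (simp_all flip: power_mult)
    have "(x + y + z) ^ 4 = x ^ 4 + y ^ 4 + z ^ 4" "(x + y + z) ^ 8 = x ^ 8 + y ^ 8 + z ^ 8" for x y z :: PK
      by (simp_all only: sq four eight)
    then show ?thesis using that sq by (auto simp: circulant_factor_def)
  qed
  have factor: "prod_list (map circulant_factor (map (\<lambda>q. (i, q)) (filter (\<lambda>q. odd (b ! i div q)) [8, 4, 2, 1])))
      = ?F (of_nat i) ^ (b ! i)" if "i < 6" for i
  proof -
    have "b ! i < 16" using assms that by (auto simp: digits_def list_all_length)
    have "map circulant_factor (map (\<lambda>q. (i, q)) xs) = map (\<lambda>q. ?F (of_nat i) ^ q) xs"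
      if "set xs \<subseteq> {8, 4, 2, 1}" for xs using that frob by (induction xs) auto
    from this[of "filter (\<lambda>q. odd (b ! i div q)) [8, 4, 2, 1]"] bits_value[OF \<open>b ! i < 16\<close>]
    show ?thesis by auto
  qed
  have "prod_list (map circulant_factor (bits b)) = prod_list (map (\<lambda>i. ?F (of_nat i) ^ (b ! i)) [0..<6])"
  proof -
    have "prod_list (map circulant_factor (concat (map g is))) = prod_list (map (\<lambda>i. prod_list (map circulant_factor (g i))) is)" for g and "is" :: "nat list"
      by (induction "is") simp_all
    then show ?thesis unfolding bits_def
      by (simp only:) (intro arg_cong[where f = prod_list] map_cong refl factor, simp)
  qed
  also have "[0..<6] = [0, 1, 2, 3, 4, 5::nat]" by (simp add: upt_rec)
  also have "prod_list (map (\<lambda>i. ?F (of_nat i) ^ (b ! i)) [0, 1, 2, 3, 4, 5]) = circulant (Zl b)"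
    unfolding circulant_def b Zl_def const.hom_ext_Zmon' eval_mon_mon_of by (simp add: mult.assoc)
  finally show ?thesis ..
qed

lemma coeff_sum_circulant:
  assumes "length b = 6" "digits b" "list_all (\<lambda>e. length e = 6) S"
  shows "coeff_sum S (circulant (Zl b)) = of_nat (pairing S b)"
proof -
  have "\<forall>(i, q)\<in>set (bits b). i < 6" by (auto simp: bits_def)
  then have "lookup (circulant (Zl b)) (mon_of e) = of_bool (expands (bits b) e)" if "length e = 6" for e
    using that by (simp only: circulant_Zl[OF assms(1,2)] lookup_circulant_factors)
  with assms(3) show ?thesis
    unfolding coeff_sum_def pairing_def by (induction S) auto
qed

lemma coeff_sum_Zl:
  assumes "length b = 6" "list_all (\<lambda>e. length e = 6) S"
  shows "coeff_sum S (Zl b) = of_nat (count_list S b)"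
  using assms(2) unfolding coeff_sum_def by (induction S) (auto simp: lookup_Zl assms(1))

lemma coeff_sum_0: "coeff_sum S 0 = 0"
  by (simp add: coeff_sum_def)

lemma coeff_sum_sum: "coeff_sum S (\<Sum>i\<in>I. f i) = (\<Sum>i\<in>I. coeff_sum S (f i))"
  by (induction I rule: infinite_finite_induct) (simp_all add: coeff_sum_add coeff_sum_0)

lemma distinct_basis: "distinct basis"
  by code_simp

text \<open>The duality holds on all the rotations as well, so one functional per rotation class suffices.\<close>

lemma psis_dual:
  "list_all2 (\<lambda>S r. list_all (\<lambda>b. count_list S b = (if b = r then 1 else 0))
     (concat (map rotations (bottom # reps)))) psis reps"
  by code_simp

lemma chis_disjoint: "list_all (\<lambda>S. list_all (\<lambda>b. b \<notin> set basis) S) chis"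
  by code_simp

text \<open>For each \<open>t\<close> there is exactly one basis monomial whose \<open>t\<close>-fold rotation is a given representative;
  this isolates one coefficient of the \<open>t\<close>-fold rotated combination.\<close>

lemma rotations_of_reps:
  "list_all (\<lambda>t. list_all (\<lambda>r. filter (\<lambda>b. (rot ^^ t) b = r) basis = [(rot ^^ (6 - t)) r]) reps) [1, 2, 3, 4, 5]"
  by code_simp

lemma functionals_length: "list_all (list_all (\<lambda>a. length a = 6)) (psis @ chis)"
  by code_simp

lemma basis_length_digits: "list_all (\<lambda>b. length b = 6 \<and> digits b) basis"
  by code_simp

lemma functionals_hitK: "S \<in> set (psis @ chis) \<Longrightarrow> p \<in> hitK \<Longrightarrow> coeff_sum S p = 0"
  using functionals_length pairs_off_psis_chis unfolding list_all_iff by (blast intro: coeff_sum_hitK[unfolded list_all_iff])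

lemma of_nat_K: "of_nat n = (of_bool (odd n) :: K)"
  by (rule of_nat_char2[OF K_char2])

lemma spanned_expand:
  "p \<in> spanned \<Longrightarrow> \<exists>c. p + (\<Sum>b\<in>set basis. const (c b) * Zl b) \<in> hitK"
proof (induction rule: spanned.induct)
  case (hit p)
  then show ?case by (intro exI[of _ "\<lambda>_. 0"]) simp
next
  case (base p b d)
  then obtain c where c: "p + (\<Sum>b\<in>set basis. const (c b) * Zl b) \<in> hitK" by blast
  let ?q = "const d * Zl b"
  have "(\<Sum>x\<in>set basis. const (c x + (if x = b then d else 0)) * Zl x)
      = (\<Sum>x\<in>set basis. const (c x) * Zl x) + (\<Sum>x\<in>set basis. if x = b then ?q else 0)"
    unfolding sum.distrib[symmetric] by (intro sum.cong refl) (simp add: distrib_right)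
  also have "(\<Sum>x\<in>set basis. if x = b then ?q else 0) = ?q" using base(2) by simp
  finally have "?q + p + (\<Sum>x\<in>set basis. const (c x + (if x = b then d else 0)) * Zl x)
      = ?q + (?q + (p + (\<Sum>x\<in>set basis. const (c x) * Zl x)))"
    by (simp only: ac_simps)
  with c show ?case unfolding PK_cancel by (intro exI[of _ "\<lambda>x. c x + (if x = b then d else 0)"]) (simp only:)
qed

lemma basis_superset: "b \<in> set basis \<Longrightarrow> b \<in> set (concat (map rotations (bottom # reps)))"
  by (auto simp: basis_def rotations_def)

lemma rot_power_rotations:
  "r \<in> set (bottom # reps) \<Longrightarrow> b \<in> set (rotations r) \<Longrightarrow> (rot ^^ t) b \<in> set (rotations r)"
proof (induction t)
  case (Suc t)
  then show ?case using rot_6[OF reps_length, of r] by (auto simp: rotations_def)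
qed simp

text \<open>The \<open>t\<close>-fold rotation of \<open>P\<close> is congruent to \<open>P\<close>.  The functional dual to \<open>r\<close> reads the coefficient of
  \<open>r\<close> in the latter and the coefficient of a rotation of \<open>r\<close> in the former.\<close>

lemma frobenius_coeffs:
  assumes "P = (\<Sum>b\<in>set basis. const (c b) * Zl b)" "P + frobenius P \<in> hitK"
    "r \<in> set reps" "b \<in> set (rotations r)"
  shows "c b = c r"
proof -
  obtain \<psi> where \<psi>: "\<psi> \<in> set psis" "\<And>b. b \<in> set (concat (map rotations (bottom # reps))) \<Longrightarrow> count_list \<psi> b = (if b = r then 1 else 0)"
  proof -
    obtain i where i: "i < length reps" "r = reps ! i" using assms(3) by (metis in_set_conv_nth)
    show thesis
      using psis_dual i unfolding list_all2_conv_all_nth list_all_iff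
      by (intro that[of "psis ! i"]) auto
  qed
  have len: "list_all (\<lambda>e. length e = 6) \<psi>"
    using functionals_length \<psi>(1) by (auto simp: list_all_iff)
  have power: "P + (frobenius ^^ t) P \<in> hitK" for t
  proof (induction t)
    case (Suc t)
    have "P + (frobenius ^^ Suc t) P = (P + frobenius P) + frobenius (P + (frobenius ^^ t) P)"
      by (simp add: frobenius_linear add.assoc PK_cancel)
    then show ?case using hitK_add[OF assms(2) frobenius_hitK[OF Suc]] by (simp only:)
  qed (simp add: hitK.zero)
  have frob: "(frobenius ^^ t) P = (\<Sum>b\<in>set basis. const (c b) * Zl ((rot ^^ t) b))" for t
  proof (induction t)
    case (Suc t)
    have sum: "frobenius (\<Sum>b\<in>B. f b) = (\<Sum>b\<in>B. frobenius (f b))" for B :: "nat list set" and f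
      by (induction B rule: infinite_finite_induct) (simp_all add: frobenius_linear)
    have len: "length b = 6 \<Longrightarrow> length ((rot ^^ t) b) = 6" for b
      by (induction t) (simp_all add: length_rot)
    have "(frobenius ^^ Suc t) P = (\<Sum>b\<in>set basis. frobenius (const (c b) * Zl ((rot ^^ t) b)))"
      by (simp add: Suc sum)
    also have "\<dots> = (\<Sum>b\<in>set basis. const (c b) * Zl ((rot ^^ Suc t) b))"
      using basis_length_digits len
      by (intro sum.cong refl) (simp add: frobenius_linear frobenius_Zl list_all_iff)
    finally show ?case .
  qed (simp add: assms(1))
  have coeff: "coeff_sum \<psi> ((frobenius ^^ t) P) = (\<Sum>b | b \<in> set basis \<and> (rot ^^ t) b = r. c b)" for t
  proof -
    have "coeff_sum \<psi> (Zl ((rot ^^ t) b)) = of_bool ((rot ^^ t) b = r)" if b: "b \<in> set basis" for b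
    proof -
      obtain s where s: "s \<in> set (bottom # reps)" "b \<in> set (rotations s)"
        using basis_superset[OF b] by auto
      then have rot: "(rot ^^ t) b \<in> set (rotations s)" by (rule rot_power_rotations)
      then have "length ((rot ^^ t) b) = 6"
        using rotations_length_digits(1) reps_length s(1) by blast
      moreover have "(rot ^^ t) b \<in> set (concat (map rotations (bottom # reps)))" using s(1) rot by auto
      ultimately show ?thesis by (simp only: coeff_sum_Zl[OF _ len] \<psi>(2)) simp
    qed
    then have "coeff_sum \<psi> ((frobenius ^^ t) P) = (\<Sum>b\<in>set basis. if (rot ^^ t) b = r then c b else 0)"
      unfolding frob coeff_sum_sum by (intro sum.cong refl) (simp add: coeff_sum_const_mult)
    then show ?thesis by (simp add: sum.inter_filter)
  qed
  have "c ((rot ^^ (6 - t)) r) = c r" if "t \<in> set [1, 2, 3, 4, 5]" for t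
  proof -
    have "set (filter (\<lambda>b. (rot ^^ t) b = r) basis) = {(rot ^^ (6 - t)) r}"
      using rotations_of_reps that assms(3) unfolding list_all_iff by fastforce
    then have "coeff_sum \<psi> ((frobenius ^^ t) P) = c ((rot ^^ (6 - t)) r)"
      unfolding coeff by simp
    moreover have "r \<in> set basis" using assms(3) by (auto simp: basis_def rotations_def)
    then have "{b. b \<in> set basis \<and> (rot ^^ 0) b = r} = {r}" by auto
    then have "coeff_sum \<psi> P = c r" using coeff[of 0] by simp
    moreover have "coeff_sum \<psi> P + coeff_sum \<psi> ((frobenius ^^ t) P) = 0"
      using functionals_hitK[OF _ power] \<psi>(1) by (simp flip: coeff_sum_add)
    ultimately show ?thesis by (metis K_add_self add_left_imp_eq)
  qed
  from this[of 5] this[of 4] this[of 3] this[of 2] this[of 1] show ?thesis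
    using assms(4) by (auto simp: rotations_def eval_nat_numeral)
qed

text \<open>The functionals \<open>chis\<close> vanish on \<open>P\<close>, hence on its circulant image.  With coefficients constant on
  rotations this is the homogeneous linear system of \<open>pairing_table\<close>, solved by back substitution.\<close>

lemma circulant_coeffs:
  assumes "P = (\<Sum>b\<in>set basis. const (c b) * Zl b)" "P + circulant P \<in> hitK"
    "\<And>r b. r \<in> set reps \<Longrightarrow> b \<in> set (rotations r) \<Longrightarrow> c b = c r" "r \<in> set reps"
  shows "c r = 0"
proof -
  have parity: "(\<Sum>r\<leftarrow>reps. c r * of_bool (odd (sum_list (map (pairing S) (rotations r))))) = 0"
    if "S \<in> set chis" for S
  proof -
    have len: "list_all (\<lambda>e. length e = 6) S"
      using functionals_length that by (auto simp: list_all_iff)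
    have "coeff_sum S (Zl b) = 0" if "b \<in> set basis" for b
    proof -
      have "b \<notin> set S" using chis_disjoint \<open>S \<in> set chis\<close> that by (auto simp: list_all_iff)
      then show ?thesis using basis_length_digits that
        by (simp add: coeff_sum_Zl[OF _ len] list_all_iff count_list_0_iff)
    qed
    then have "coeff_sum S P = 0" by (simp add: assms(1) coeff_sum_sum coeff_sum_const_mult)
    moreover have "coeff_sum S P + coeff_sum S (circulant P) = 0"
      using functionals_hitK[OF _ assms(2)] that by (simp flip: coeff_sum_add)
    ultimately have "0 = coeff_sum S (circulant P)" by simp
    also have "circulant P = (\<Sum>b\<in>set basis. const (c b) * circulant (Zl b))"
    proof -
      have sum: "circulant (\<Sum>b\<in>B. f b) = (\<Sum>b\<in>B. circulant (f b))" for B :: "nat list set" and f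
        by (induction B rule: infinite_finite_induct) (simp_all add: circulant_linear)
      show ?thesis by (simp add: assms(1) sum circulant_linear)
    qed
    also have "coeff_sum S \<dots> = (\<Sum>b\<in>set basis. c b * of_nat (pairing S b))"
      using basis_length_digits unfolding coeff_sum_sum
      by (intro sum.cong refl) (simp add: coeff_sum_const_mult coeff_sum_circulant[OF _ _ len] list_all_iff)
    also have "\<dots> = (\<Sum>b\<leftarrow>basis. c b * of_nat (pairing S b))"
      by (rule sum.distinct_set_conv_list[OF distinct_basis])
    also have "\<dots> = c bottom * of_nat (pairing S bottom)
        + (\<Sum>r\<leftarrow>reps. \<Sum>b\<leftarrow>rotations r. c b * of_nat (pairing S b))"
    proof -
      have "(\<Sum>b\<leftarrow>concat (map rotations rs). g b) = (\<Sum>r\<leftarrow>rs. \<Sum>b\<leftarrow>rotations r. g b)" for rs and g :: "nat list \<Rightarrow> K"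
        by (induction rs) simp_all
      then show ?thesis by (simp add: basis_def)
    qed
    also have "c bottom * of_nat (pairing S bottom) = 0"
      using pairing_table(2) that by (simp add: list_all_iff of_nat_K)
    also have "(\<Sum>r\<leftarrow>reps. \<Sum>b\<leftarrow>rotations r. c b * of_nat (pairing S b))
        = (\<Sum>r\<leftarrow>reps. c r * of_nat (sum_list (map (pairing S) (rotations r))))"
    proof (intro arg_cong[where f = sum_list] map_cong refl)
      fix r assume "r \<in> set reps"
      then have "(\<Sum>b\<leftarrow>rotations r. c b * of_nat (pairing S b)) = (\<Sum>b\<leftarrow>rotations r. c r * of_nat (pairing S b))"
        by (intro arg_cong[where f = sum_list] map_cong refl) (simp add: assms(3))
      also have "\<dots> = c r * of_nat (sum_list (map (pairing S) (rotations r)))"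
      proof -
        have "(\<Sum>b\<leftarrow>bs. d * of_nat (g b)) = d * of_nat (sum_list (map g bs))" for d :: K and g and bs :: "nat list list"
          by (induction bs) (simp_all add: distrib_left)
        then show ?thesis .
      qed
      finally show "(\<Sum>b\<leftarrow>rotations r. c b * of_nat (pairing S b)) = c r * of_nat (sum_list (map (pairing S) (rotations r)))" .
    qed
    finally show ?thesis by (simp only: of_nat_K add_0_left)
  qed
  have rows: "(\<Sum>r\<leftarrow>reps. c r * of_bool (f r)) = 0"
    if f: "map f reps \<in> set (map (\<lambda>S. map (\<lambda>b. odd (sum_list (map (pairing S) (rotations b)))) reps) chis)" for f
  proof -
    obtain S where S: "S \<in> set chis" "map f reps = map (\<lambda>b. odd (sum_list (map (pairing S) (rotations b)))) reps"
      using f by (metis (no_types, lifting) image_iff list.set_map)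
    have "(\<Sum>r\<leftarrow>reps. c r * of_bool (f r)) = (\<Sum>(r, x)\<leftarrow>zip reps (map f reps). c r * of_bool x)" for f
      by (simp add: zip_map2 zip_same_conv_map o_def split_def)
    from this[of f] this[of "\<lambda>b. odd (sum_list (map (pairing S) (rotations b)))"] S parity[OF S(1)]
    show ?thesis by simp
  qed
  (* Names for the five representatives keep their exponent lists out of the linear algebra. *)
  obtain r1 r2 r3 r4 r5 where r: "reps = [r1, r2, r3, r4, r5]" "distinct [r1, r2, r3, r4, r5]"
    by (simp add: reps_def)
  have row: "c r1 * of_bool x1 + (c r2 * of_bool x2 + (c r3 * of_bool x3 + (c r4 * of_bool x4 + c r5 * of_bool x5))) = 0"
    if "[x1, x2, x3, x4, x5] \<in> set [[False, False, False, False, True], [True, True, False, False, True],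
      [True, True, False, True, True], [False, False, True, False, True], [True, False, True, False, False]]" for x1 x2 x3 x4 x5
  proof -
    let ?f = "\<lambda>r. if r = r1 then x1 else if r = r2 then x2 else if r = r3 then x3 else if r = r4 then x4 else x5"
    have ne: "r2 \<noteq> r1" "r3 \<noteq> r1" "r4 \<noteq> r1" "r5 \<noteq> r1" "r3 \<noteq> r2" "r4 \<noteq> r2" "r5 \<noteq> r2"
      "r4 \<noteq> r3" "r5 \<noteq> r3" "r5 \<noteq> r4"
      using r(2) by auto
    have "map ?f reps = [x1, x2, x3, x4, x5]" by (simp add: r(1) ne)
    with rows[of ?f] that have "(\<Sum>r\<leftarrow>reps. c r * of_bool (?f r)) = 0" unfolding pairing_table(1) by (simp only:)
    then show ?thesis by (simp add: r(1) ne)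
  qed
  have "c r5 = 0" using row[of False False False False True] by simp
  moreover have "c r3 = 0" using calculation row[of False False True False True] by simp
  moreover have "c r1 = 0" using calculation row[of True False True False False] by simp
  moreover have "c r2 = 0" using calculation row[of True True False False True] by simp
  moreover have "c r4 = 0" using calculation row[of True True False True True] by simp
  ultimately show ?thesis using assms(4) by (auto simp: r(1))
qed

lemma spanned_invariant:
  assumes "p \<in> spanned" "p + frobenius p \<in> hitK" "p + circulant p \<in> hitK"
  shows "\<exists>d. p + const d * Zl bottom \<in> hitK"
proof -
  obtain c where c: "p + (\<Sum>b\<in>set basis. const (c b) * Zl b) \<in> hitK"
    using spanned_expand[OF assms(1)] by blast
  define P where "P = (\<Sum>b\<in>set basis. const (c b) * Zl b)"
  have "(p + frobenius p) + ((p + P) + frobenius (p + P)) \<in> hitK"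
    by (rule hitK_add[OF assms(2) hitK_add[OF c frobenius_hitK[OF c]], folded P_def])
  also have "(p + frobenius p) + ((p + P) + frobenius (p + P)) = (p + (p + (frobenius p + (frobenius p + (P + frobenius P)))))"
    by (simp only: frobenius_linear ac_simps)
  finally have frob: "P + frobenius P \<in> hitK" unfolding PK_cancel .
  have "(p + circulant p) + ((p + P) + circulant (p + P)) \<in> hitK"
    by (rule hitK_add[OF assms(3) hitK_add[OF c circulant_hitK[OF c]], folded P_def])
  also have "(p + circulant p) + ((p + P) + circulant (p + P)) = (p + (p + (circulant p + (circulant p + (P + circulant P)))))"
    by (simp only: circulant_linear ac_simps)
  finally have circ: "P + circulant P \<in> hitK" unfolding PK_cancel .
  have rot: "c b = c r" if "r \<in> set reps" "b \<in> set (rotations r)" for r b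
    using that by (rule frobenius_coeffs[OF P_def frob])
  have "c b = 0" if b: "b \<in> set basis" "b \<noteq> bottom" for b
  proof -
    obtain r where r: "r \<in> set reps" "b \<in> set (rotations r)" using b by (auto simp: basis_def)
    then show ?thesis using rot[OF r] circulant_coeffs[OF P_def circ rot r(1)] by simp
  qed
  then have "P = (\<Sum>b\<in>set basis. if b = bottom then const (c bottom) * Zl bottom else 0)"
    unfolding P_def by (intro sum.cong refl) auto
  also have "\<dots> = const (c bottom) * Zl bottom" by (simp add: basis_def)
  finally show ?thesis using c by (auto simp: P_def)
qed

lemma invariant_toK:
  assumes "f \<in> homogeneous 15" "\<And>A. invertible A \<Longrightarrow> lin_subst A f - f \<in> hit"
  shows "\<exists>d. toK f + const d * Zl bottom \<in> hitK"
proof -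
  have *: "toK f + toK (lin_subst A f) \<in> hitK" if "invertible A" for A
  proof -
    have "toK (lin_subst A f) = toK f + toK (lin_subst A f - f)"
      by (simp flip: toK_simps)
    then have "toK f + toK (lin_subst A f) = toK (lin_subst A f - f)" by (simp only: PK_cancel)
    then show ?thesis using hitK_toK[OF assms(2)[OF that]] by (simp only:)
  qed
  have "toK f + weight_zero_part (toK f) \<in> hitK"
    using *[OF invertible_torus] by (intro torus_average) (simp add: torus_toK)
  then have "(toK f + weight_zero_part (toK f)) + weight_zero_part (toK f) \<in> spanned"
    by (intro spanned_add spanned.hit weight_zero_part_spanned toK_homogeneous assms(1))
  then have "toK f \<in> spanned" by (simp add: add.assoc)
  then show ?thesis
    using *[OF invertible_frobenius] *[OF invertible_circulant]
    by (intro spanned_invariant) (simp_all add: frobenius_toK circulant_toK)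
qed

section \<open>Monomials of the blocks\<close>

text \<open>The monomial of the block of size \<open>card I\<close> on the variables in \<open>I\<close>, the exponents placed in increasing
  order of the variables.\<close>

definition block_mon :: "6 set \<Rightarrow> mon6" where
  "block_mon I = sum_list (map2 single (sorted_list_of_set I) (block_exps (card I)))"

lemma pw_X:
  "length is = length a \<Longrightarrow> pw (map X is) a = single (sum_list (map2 single is a)) 1"
proof (induction "is" a rule: list_induct2)
  case (Cons i "is" n a)
  have "X i ^ n = single (single i n) 1"
    by (induction n) (simp_all add: X_def mult_single flip: single_add)
  then show ?case using Cons by (simp add: mult_single)
qed simp

lemma card_le_6: "card (I :: 6 set) \<le> 6"
  using card_mono[of "UNIV::6 set" I] by simp

lemma pw_X_block: "pw (map X (sorted_list_of_set I)) (block_exps (card I)) = single (block_mon I) 1"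
  unfolding block_mon_def by (rule pw_X) (simp add: length_block_exps card_le_6)

lemma lookup_sum_list_single_notin:
  "length is = length a \<Longrightarrow> i \<notin> set is \<Longrightarrow>
     lookup (sum_list (map2 single is a)) i = 0"
  by (induction "is" a rule: list_induct2) (auto simp: lookup_add lookup_single)

lemma lookup_sum_list_single_nth:
  assumes "distinct is" "length is = length a" "j < length is"
  shows "lookup (sum_list (map2 single is a)) (is ! j) = a ! j"
  using assms(2,1,3)
proof (induction "is" a arbitrary: j rule: list_induct2)
  case (Cons i "is" n a)
  then show ?case
    using lookup_sum_list_single_notin[of "is" a i] by (cases j) (auto simp: lookup_add lookup_single when_def)
qed simp

lemma lookup_block_mon:
  "map (lookup (block_mon I)) (sorted_list_of_set I) = block_exps (card I)"
  "i \<notin> I \<Longrightarrow> lookup (block_mon I) i = 0"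
proof -
  have len: "length (sorted_list_of_set I) = length (block_exps (card I))"
    by (simp add: length_block_exps card_le_6)
  then show "map (lookup (block_mon I)) (sorted_list_of_set I) = block_exps (card I)"
    unfolding block_mon_def by (intro nth_equalityI) (simp_all add: lookup_sum_list_single_nth)
  show "lookup (block_mon I) i = 0" if "i \<notin> I"
    unfolding block_mon_def by (rule lookup_sum_list_single_notin[OF len]) (use that in simp)
qed

lemma block_exps_pos: "n \<le> 6 \<Longrightarrow> 0 \<notin> set (block_exps n)"
proof -
  assume "n \<le> 6"
  then consider "n = 0" | "n = 1" | "n = 2" | "n = 3" | "n = 4" | "n = 5" | "n = 6" by linarith
  then show ?thesis by cases simp_all
qed

lemma support_block_mon: "{i. lookup (block_mon I) i \<noteq> 0} = I"
proof -
  have "lookup (block_mon I) i \<noteq> 0" if "i \<in> I" for i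
  proof -
    have "lookup (block_mon I) i \<in> set (map (lookup (block_mon I)) (sorted_list_of_set I))"
      using that by simp
    then have "lookup (block_mon I) i \<in> set (block_exps (card I))"
      by (simp only: lookup_block_mon(1))
    then show ?thesis
      by (rule contrapos_pn) (simp only: block_exps_pos card_le_6 not_False_eq_True)
  qed
  moreover have "i \<in> I" if "lookup (block_mon I) i \<noteq> 0" for i
    using that lookup_block_mon(2)[of i I] by (rule contrapos_np)
  ultimately show ?thesis by (intro Set.set_eqI iffI) simp_all
qed

text \<open>The set can be recovered as the support.\<close>

lemma inj_block_mon: "inj block_mon"
  by (rule injI) (metis support_block_mon)

lemma keys_sum_block_mon:
  "keys (\<Sum>I\<in>S. single (block_mon I) (1::bit)) = block_mon ` S"
proof -
  have "lookup (\<Sum>I\<in>S. single (block_mon I) (1::bit)) m = of_bool (m \<in> block_mon ` S)" for m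
  proof (cases "m \<in> block_mon ` S")
    case True
    then obtain J where J: "J \<in> S" "m = block_mon J" by blast
    have "lookup (\<Sum>I\<in>S. single (block_mon I) (1::bit)) m
        = (\<Sum>I\<in>S. if I = J then 1 else 0)"
      by (auto simp: lookup_sum lookup_single when_def J(2) inj_eq[OF inj_block_mon] intro!: sum.cong)
    then show ?thesis using True J(1) by simp
  qed (auto simp: lookup_sum lookup_single when_def intro!: sum.neutral)
  then show ?thesis by (auto simp: in_keys_iff)
qed

lemma M_eq_block_mon: "n \<le> 6 \<Longrightarrow> M (block_exps n) = (\<Sum>I | card I = n. single (block_mon I) 1)"
  unfolding M_block_exps by (intro sum.cong refl) (auto simp flip: pw_X_block)

lemma keys_M: "n \<le> 6 \<Longrightarrow> keys (M (block_exps n)) = block_mon ` {I. card I = n}"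
  by (simp only: M_eq_block_mon keys_sum_block_mon)

lemma \<xi>_eq_block_mon: "\<xi> = (\<Sum>I | I \<noteq> {}. single (block_mon I) 1)"
proof -
  have "\<xi> = (\<Sum>n\<in>{1..6}. \<Sum>I | card I = n. single (block_mon I) 1)"
    unfolding \<xi>_blocks by (intro sum.cong refl M_eq_block_mon) simp
  then show ?thesis by (simp only: sum_set_card)
qed

lemma keys_\<xi>: "keys \<xi> = block_mon ` {I. I \<noteq> {}}"
  by (simp only: \<xi>_eq_block_mon keys_sum_block_mon)

lemma mset_lookup_block_mon:
  "image_mset (lookup (block_mon I)) (mset_set UNIV)
     = mset (block_exps (card I)) + replicate_mset (6 - card I) 0"
proof -
  have "(UNIV :: 6 set) = I \<union> - I" by auto
  then have "mset_set (UNIV :: 6 set) = mset_set I + mset_set (- I)"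
    by (metis Compl_disjoint finite mset_set_Union)
  moreover have "image_mset (lookup (block_mon I)) (mset_set I) = mset (block_exps (card I))"
    by (simp flip: lookup_block_mon(1)) (simp add: mset_set_set[symmetric])
  moreover have "image_mset (lookup (block_mon I)) (mset_set (- I)) = image_mset (\<lambda>_. 0) (mset_set (- I))"
    by (intro image_mset_cong) (simp add: lookup_block_mon(2))
  moreover have "card (- I) = 6 - card I" by (simp add: Compl_eq_Diff_UNIV card_Diff_subset)
  ultimately show ?thesis by (simp add: image_mset_const_eq)
qed

definition block_type :: "nat \<Rightarrow> nat list" where
  "block_type n = rev (sorted_list_of_multiset (mset (block_exps n) + replicate_mset (6 - n) 0))"

lemma partition_type_block_mon: "partition_type (block_mon I) = block_type (card I)"
  by (simp add: partition_type_def mset_lookup_block_mon block_type_def)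

lemma block_type_eq: "block_type n = rev (sort (block_exps n @ replicate (6 - n) 0))"
  by (simp add: block_type_def flip: sorted_list_of_multiset_mset)

lemma block_type_simps:
  "block_type 1 = [15, 0, 0, 0, 0, 0]" "block_type 2 = [14, 1, 0, 0, 0, 0]" "block_type 3 = [12, 2, 1, 0, 0, 0]"
  "block_type 4 = [8, 4, 2, 1, 0, 0]" "block_type 5 = [4, 4, 4, 2, 1, 0]" "block_type 6 = [4, 4, 2, 2, 2, 1]"
  unfolding block_type_eq by code_simp+

section \<open>Orbits and stabilizers\<close>

lemma order_\<Sigma>\<^sub>6: "order \<Sigma>\<^sub>6 = 720"
proof -
  have "carrier \<Sigma>\<^sub>6 = {p. p permutes (UNIV :: 6 set)}"
    by (auto simp: BijGroup_def Bij_def permutes_bij intro: bij_imp_permutes)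
  then have "order \<Sigma>\<^sub>6 = fact 6"
    using card_permutations[of "UNIV :: 6 set" 6] by (simp add: order_def)
  then show ?thesis by (simp add: fact_numeral)
qed

lemma mem_stabilizer: "\<sigma> \<in> stabilizer \<Sigma>\<^sub>6 perm_mon m \<longleftrightarrow>
    bij \<sigma> \<and> (\<forall>i. lookup m (\<sigma> i) = lookup m i)"
proof -
  have "perm_mon \<sigma> m = m \<longleftrightarrow> (\<forall>i. lookup m (\<sigma> i) = lookup m i)" if "bij \<sigma>"
  proof
    assume "perm_mon \<sigma> m = m"
    then show "\<forall>i. lookup m (\<sigma> i) = lookup m i"
      using that by (metis lookup_perm_mon bij_is_inj inv_f_f)
  next
    assume *: "\<forall>i. lookup m (\<sigma> i) = lookup m i"
    show "perm_mon \<sigma> m = m"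
      by (rule poly_mapping_eqI) (metis * lookup_perm_mon that bij_is_surj surj_f_inv_f)
  qed
  then show ?thesis by (auto simp: stabilizer_def BijGroup_def Bij_def)
qed

lemma mult_\<Sigma>\<^sub>6: "bij \<sigma> \<Longrightarrow> bij \<tau> \<Longrightarrow> \<sigma> \<otimes>\<^bsub>\<Sigma>\<^sub>6\<^esub> \<tau> = \<sigma> \<circ> \<tau>"
  by (auto simp: BijGroup_def Bij_def compose_def)

lemma carrier_update: "carrier (G\<lparr>carrier := S\<rparr>) = S"
  by simp

lemma orbit_card:
  assumes "order (\<Sigma>\<^sub>6\<lparr>carrier := stabilizer \<Sigma>\<^sub>6 perm_mon m\<rparr>) = s" "s > 0"
  shows "card (Group_Action.orbit \<Sigma>\<^sub>6 perm_mon m) = 720 div s"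
proof -
  interpret group_action \<Sigma>\<^sub>6 UNIV perm_mon by (rule perm_mon_group_action)
  have "card (Group_Action.orbit \<Sigma>\<^sub>6 perm_mon m) * s = 720"
    using orbit_stabilizer_theorem[of m] assms(1) by (simp add: order_\<Sigma>\<^sub>6[unfolded order_def] order_def)
  then show ?thesis using assms(2) by (metis nonzero_mult_div_cancel_right not_gr0)
qed

text \<open>The permutation \<open>\<sigma>\<close> of \<open>A\<close>, moved along the enumeration \<open>g\<close> to \<open>{1..card A}\<close>.\<close>

definition transport :: "'a set \<Rightarrow> ('a \<Rightarrow> nat) \<Rightarrow> ('a \<Rightarrow> 'a) \<Rightarrow> nat \<Rightarrow> nat" where
  "transport A g \<sigma> = (\<lambda>x. if x \<in> {1..card A} then g (\<sigma> (inv_into A g x)) else x)"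

lemma transport_comp:
  assumes "bij_betw g A {1..card A}" "\<tau> ` A \<subseteq> A"
  shows "transport A g (\<sigma> \<circ> \<tau>) = transport A g \<sigma> \<circ> transport A g \<tau>"
proof
  fix x
  show "transport A g (\<sigma> \<circ> \<tau>) x = (transport A g \<sigma> \<circ> transport A g \<tau>) x"
  proof (cases "x \<in> {1..card A}")
    case True
    then have "inv_into A g x \<in> A" using assms(1) by (metis bij_betw_imp_surj_on inv_into_into)
    then have *: "\<tau> (inv_into A g x) \<in> A" using assms(2) by blast
    then have "g (\<tau> (inv_into A g x)) \<in> {1..card A}" using assms(1) by (metis bij_betwE)
    moreover have "inv_into A g (g (\<tau> (inv_into A g x))) = \<tau> (inv_into A g x)"
      using * assms(1) by (simp add: bij_betw_inv_into_left)
    ultimately show ?thesis using True by (simp add: transport_def)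
  qed (auto simp: transport_def)
qed

lemma bij_betw_transport:
  "bij_betw g A {1..card A} \<Longrightarrow>
     bij_betw (transport A g) {\<sigma>. \<sigma> permutes A} (carrier (sym_group (card A)))"
  unfolding transport_def sym_group_carrier' sym_group_def using bij_betw_permutations[of g A "{1..card A}"] by simp

lemma ex_enumeration: "\<exists>g. bij_betw g (A :: 6 set) {1..card A}"
  by (rule finite_same_card_bij) auto

lemma card_sym_group: "card (carrier (sym_group n)) = fact n"
  by (simp add: sym_group_def card_permutations)

text \<open>All the other fibres are points, so a stabilizing permutation moves only elements of \<open>A\<close>.\<close>

lemma stabilizer_one_fibre:
  assumes "\<And>i j. lookup m i = lookup m j \<longleftrightarrow> i = j \<or> i \<in> A \<and> j \<in> A"
  shows "order (\<Sigma>\<^sub>6\<lparr>carrier := stabilizer \<Sigma>\<^sub>6 perm_mon m\<rparr>) = fact (card A)"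
    "\<Sigma>\<^sub>6\<lparr>carrier := stabilizer \<Sigma>\<^sub>6 perm_mon m\<rparr> \<cong> sym_group (card A)"
proof -
  have stab: "stabilizer \<Sigma>\<^sub>6 perm_mon m = {\<sigma>. \<sigma> permutes A}"
  proof (rule Set.set_eqI)
    fix \<sigma>
    show "\<sigma> \<in> stabilizer \<Sigma>\<^sub>6 perm_mon m \<longleftrightarrow> \<sigma> \<in> {\<sigma>. \<sigma> permutes A}"
    proof
      assume \<sigma>: "\<sigma> \<in> stabilizer \<Sigma>\<^sub>6 perm_mon m"
      then have "\<forall>i. i \<notin> A \<longrightarrow> \<sigma> i = i" using assms by (auto simp: mem_stabilizer)
      then show "\<sigma> \<in> {\<sigma>. \<sigma> permutes A}"
        using \<sigma> by (simp add: mem_stabilizer permutes_def bij_iff)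
    next
      assume "\<sigma> \<in> {\<sigma>. \<sigma> permutes A}"
      then have \<sigma>: "\<sigma> permutes A" by simp
      have "lookup m (\<sigma> i) = lookup m i" for i
        using permutes_in_image[OF \<sigma>, of i] permutes_not_in[OF \<sigma>, of i] by (cases "i \<in> A") (auto simp: assms)
      then show "\<sigma> \<in> stabilizer \<Sigma>\<^sub>6 perm_mon m" using permutes_bij[OF \<sigma>] by (simp add: mem_stabilizer)
    qed
  qed
  obtain g where g: "bij_betw g A {1..card A}" using ex_enumeration by blast
  have "transport A g \<in> iso (\<Sigma>\<^sub>6\<lparr>carrier := stabilizer \<Sigma>\<^sub>6 perm_mon m\<rparr>) (sym_group (card A))"
    unfolding iso_def
  proof (intro CollectI IntI homI conjI)
    have bij: "bij_betw (transport A g) (carrier (\<Sigma>\<^sub>6\<lparr>carrier := stabilizer \<Sigma>\<^sub>6 perm_mon m\<rparr>)) (carrier (sym_group (card A)))"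
      unfolding carrier_update stab by (rule bij_betw_transport[OF g])
    then show "bij_betw (transport A g) (carrier (\<Sigma>\<^sub>6\<lparr>carrier := stabilizer \<Sigma>\<^sub>6 perm_mon m\<rparr>)) (carrier (sym_group (card A)))" .
    show "transport A g \<sigma> \<in> carrier (sym_group (card A))"
      if "\<sigma> \<in> carrier (\<Sigma>\<^sub>6\<lparr>carrier := stabilizer \<Sigma>\<^sub>6 perm_mon m\<rparr>)" for \<sigma>
      using bij_betwE[OF bij] that by blast
    show "transport A g (\<sigma> \<otimes>\<^bsub>\<Sigma>\<^sub>6\<lparr>carrier := stabilizer \<Sigma>\<^sub>6 perm_mon m\<rparr>\<^esub> \<tau>)
        = transport A g \<sigma> \<otimes>\<^bsub>sym_group (card A)\<^esub> transport A g \<tau>"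
      if "\<sigma> \<in> carrier (\<Sigma>\<^sub>6\<lparr>carrier := stabilizer \<Sigma>\<^sub>6 perm_mon m\<rparr>)"
        "\<tau> \<in> carrier (\<Sigma>\<^sub>6\<lparr>carrier := stabilizer \<Sigma>\<^sub>6 perm_mon m\<rparr>)" for \<sigma> \<tau>
    proof -
      have p: "\<sigma> permutes A" "\<tau> permutes A" using that by (simp_all add: stab)
      then have "bij \<sigma>" "bij \<tau>" "\<tau> ` A \<subseteq> A" by (simp_all add: permutes_bij permutes_image)
      then show ?thesis using transport_comp[OF g] by (simp add: mult_\<Sigma>\<^sub>6 sym_group_def)
    qed
  qed
  then show iso: "\<Sigma>\<^sub>6\<lparr>carrier := stabilizer \<Sigma>\<^sub>6 perm_mon m\<rparr> \<cong> sym_group (card A)"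
    unfolding is_iso_def by blast
  show "order (\<Sigma>\<^sub>6\<lparr>carrier := stabilizer \<Sigma>\<^sub>6 perm_mon m\<rparr>) = fact (card A)"
    using card_permutations[of A "card A"] by (simp add: order_def stab)
qed

text \<open>A stabilizing permutation is determined by its restrictions to the two fibres with several points, and
  these restrictions can be prescribed independently.\<close>

lemma stabilizer_two_fibres:
  assumes fibres: "\<And>i j. lookup m i = lookup m j \<longleftrightarrow> i = j \<or> i \<in> A \<and> j \<in> A \<or> i \<in> B \<and> j \<in> B"
    and disj: "A \<inter> B = {}"
  shows "order (\<Sigma>\<^sub>6\<lparr>carrier := stabilizer \<Sigma>\<^sub>6 perm_mon m\<rparr>) = fact (card A) * fact (card B)"
    "\<Sigma>\<^sub>6\<lparr>carrier := stabilizer \<Sigma>\<^sub>6 perm_mon m\<rparr> \<cong> sym_group (card A) \<times>\<times> sym_group (card B)"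
proof -
  let ?G = "\<Sigma>\<^sub>6\<lparr>carrier := stabilizer \<Sigma>\<^sub>6 perm_mon m\<rparr>"
  let ?S = "\<lambda>A. {\<sigma>. \<sigma> permutes A}"
  define res :: "6 set \<Rightarrow> (6 \<Rightarrow> 6) \<Rightarrow> 6 \<Rightarrow> 6" where "res C \<sigma> = (\<lambda>i. if i \<in> C then \<sigma> i else i)" for C \<sigma>
  have maps: "\<sigma> i \<in> C" if "\<sigma> \<in> stabilizer \<Sigma>\<^sub>6 perm_mon m" "i \<in> C" "C = A \<or> C = B" for \<sigma> i C
  proof (rule ccontr)
    assume "\<sigma> i \<notin> C"
    moreover have "lookup m (\<sigma> i) = lookup m i" using that(1) by (simp add: mem_stabilizer)
    ultimately show False using fibres[of "\<sigma> i" i] that(2,3) disj by auto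
  qed
  have fixes_outside: "\<sigma> i = i" if "\<sigma> \<in> stabilizer \<Sigma>\<^sub>6 perm_mon m" "i \<notin> A" "i \<notin> B" for \<sigma> i
    using that fibres[of "\<sigma> i" i] by (auto simp: mem_stabilizer)
  have res: "res C \<sigma> permutes C" if "\<sigma> \<in> stabilizer \<Sigma>\<^sub>6 perm_mon m" "C = A \<or> C = B" for \<sigma> C
  proof (rule bij_imp_permutes)
    have "inj_on \<sigma> C" using that(1) by (auto simp: mem_stabilizer bij_def intro: inj_on_subset)
    then have "inj_on (res C \<sigma>) C" by (auto simp: res_def inj_on_def)
    moreover have "res C \<sigma> ` C \<subseteq> C" using maps that by (auto simp: res_def)
    ultimately show "bij_betw (res C \<sigma>) C C"
      by (metis bij_betw_def endo_inj_surj finite)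
  qed (auto simp: res_def)
  have bij: "bij_betw (\<lambda>\<sigma>. (res A \<sigma>, res B \<sigma>)) (stabilizer \<Sigma>\<^sub>6 perm_mon m) (?S A \<times> ?S B)"
  proof (rule bij_betw_byWitness[where f' = "\<lambda>(\<sigma>, \<tau>). \<sigma> \<circ> \<tau>"])
    show "\<forall>\<sigma>\<in>stabilizer \<Sigma>\<^sub>6 perm_mon m. (\<lambda>(\<sigma>, \<tau>). \<sigma> \<circ> \<tau>) (res A \<sigma>, res B \<sigma>) = \<sigma>"
    proof
      fix \<sigma> assume \<sigma>: "\<sigma> \<in> stabilizer \<Sigma>\<^sub>6 perm_mon m"
      have "(res A \<sigma> \<circ> res B \<sigma>) i = \<sigma> i" for i
        using maps[OF \<sigma>, of i B] fixes_outside[OF \<sigma>, of i] disj by (auto simp: res_def)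
      then show "(\<lambda>(\<sigma>, \<tau>). \<sigma> \<circ> \<tau>) (res A \<sigma>, res B \<sigma>) = \<sigma>" by auto
    qed
    show "\<forall>c\<in>?S A \<times> ?S B. (\<lambda>\<sigma>. (res A \<sigma>, res B \<sigma>)) ((\<lambda>(\<sigma>, \<tau>). \<sigma> \<circ> \<tau>) c) = c"
    proof (intro ballI, elim SigmaE CollectE)
      fix c \<sigma> \<tau> assume p: "\<sigma> permutes A" "\<tau> permutes B" and c: "c = (\<sigma>, \<tau>)"
      have "res A (\<sigma> \<circ> \<tau>) = \<sigma>" "res B (\<sigma> \<circ> \<tau>) = \<tau>"
        using permutes_in_image[OF p(2)] disj permutes_not_in[OF p(1)] permutes_not_in[OF p(2)]
        by (auto simp: res_def fun_eq_iff disjoint_iff)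
      then show "(\<lambda>\<sigma>. (res A \<sigma>, res B \<sigma>)) ((\<lambda>(\<sigma>, \<tau>). \<sigma> \<circ> \<tau>) c) = c"
        by (simp add: c)
    qed
    show "(\<lambda>\<sigma>. (res A \<sigma>, res B \<sigma>)) ` stabilizer \<Sigma>\<^sub>6 perm_mon m \<subseteq> ?S A \<times> ?S B"
      using res by auto
    show "(\<lambda>(\<sigma>, \<tau>). \<sigma> \<circ> \<tau>) ` (?S A \<times> ?S B) \<subseteq> stabilizer \<Sigma>\<^sub>6 perm_mon m"
    proof clarify
      fix \<sigma> \<tau> assume p: "\<sigma> permutes A" "\<tau> permutes B"
      have inv: "lookup m (\<rho> i) = lookup m i" if "\<rho> permutes C" "C = A \<or> C = B" for \<rho> C i
        using permutes_in_image[OF that(1), of i] permutes_not_in[OF that(1), of i] that(2)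
        by (cases "i \<in> C") (auto simp: fibres)
      show "\<sigma> \<circ> \<tau> \<in> stabilizer \<Sigma>\<^sub>6 perm_mon m"
        using p inv[OF p(1)] inv[OF p(2)] by (simp add: mem_stabilizer permutes_bij bij_comp)
    qed
  qed
  obtain g where g: "bij_betw g A {1..card A}" using ex_enumeration by blast
  obtain h where h: "bij_betw h B {1..card B}" using ex_enumeration by blast
  have transport_res: "transport C g (res C \<sigma>) = transport C g \<sigma>" if "bij_betw g C {1..card C}" for C g \<sigma>
  proof
    fix x
    show "transport C g (res C \<sigma>) x = transport C g \<sigma> x"
      using that inv_into_into[of x g C] by (auto simp: transport_def res_def bij_betw_def)
  qed
  let ?\<Phi> = "\<lambda>\<sigma>. (transport A g \<sigma>, transport B h \<sigma>)"
  have bij\<Phi>: "bij_betw ?\<Phi> (carrier ?G) (carrier (sym_group (card A) \<times>\<times> sym_group (card B)))"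
  proof -
    have "bij_betw (map_prod (transport A g) (transport B h)) (?S A \<times> ?S B)
        (carrier (sym_group (card A)) \<times> carrier (sym_group (card B)))"
      by (intro bij_betw_map_prod bij_betw_transport g h)
    from bij_betw_trans[OF bij this] show ?thesis
      by (simp add: o_def transport_res[OF g] transport_res[OF h])
  qed
  have "?\<Phi> \<in> iso ?G (sym_group (card A) \<times>\<times> sym_group (card B))"
    unfolding iso_def
  proof (intro CollectI IntI homI conjI bij\<Phi>)
    show "?\<Phi> \<sigma> \<in> carrier (sym_group (card A) \<times>\<times> sym_group (card B))" if "\<sigma> \<in> carrier ?G" for \<sigma>
      using bij_betwE[OF bij\<Phi>] that by blast
    show "?\<Phi> (\<sigma> \<otimes>\<^bsub>?G\<^esub> \<tau>) = ?\<Phi> \<sigma> \<otimes>\<^bsub>sym_group (card A) \<times>\<times> sym_group (card B)\<^esub> ?\<Phi> \<tau>"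
      if "\<sigma> \<in> carrier ?G" "\<tau> \<in> carrier ?G" for \<sigma> \<tau>
    proof -
      have "bij \<sigma>" "bij \<tau>" "\<tau> ` A \<subseteq> A" "\<tau> ` B \<subseteq> B"
        using that maps by (auto simp: mem_stabilizer)
      then show ?thesis
        using transport_comp[OF g] transport_comp[OF h] by (simp add: mult_\<Sigma>\<^sub>6 sym_group_def)
    qed
  qed
  then show "?G \<cong> sym_group (card A) \<times>\<times> sym_group (card B)"
    unfolding is_iso_def by blast
  show "order ?G = fact (card A) * fact (card B)"
    using bij_betw_same_card[OF bij\<Phi>] by (simp add: order_def card_sym_group card_cartesian_product)
qed

section \<open>The class of \<xi> is not zero\<close>

lemma odd_binoms_15: "list_all (\<lambda>b. 15 - b \<notin> set (odd_binoms b)) [0..<15]"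
  by code_simp

text \<open>A square that produced the fifteenth power of a variable would come from a lower power of that variable
  alone, with an odd coefficient \<open>b choose (15 - b)\<close> for some \<open>b < 15\<close>; there is none.\<close>

lemma Sq_exponents_spike:
  assumes "a \<in> set (Sq_exponents k b)" "length b = 6" "k > 0"
  shows "a \<noteq> [15, 0, 0, 0, 0, 0]"
proof
  assume a: "a = [15, 0, 0, 0, 0, 0]"
  obtain js where js: "a = map2 (+) b js" "list_all2 (\<lambda>j xs. j \<in> set xs) js (map odd_binoms b)" "sum_list js = k"
    using assms(1) by (auto simp: Sq_exponents_def set_lists_with_sum)
  then have "length js = 6" using assms(2) by (simp add: list_all2_lengthD)
  then obtain j0 j1 j2 j3 j4 j5 where j: "js = [j0, j1, j2, j3, j4, j5]" by (rule length_6_cases)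
  obtain b0 b1 b2 b3 b4 b5 where b: "b = [b0, b1, b2, b3, b4, b5]" using assms(2) by (rule length_6_cases)
  have "b0 + j0 = 15" "j0 > 0" "j0 \<in> set (odd_binoms b0)"
    using js assms(3) by (simp_all add: a b j)
  then have "b0 < 15" "15 - b0 \<in> set (odd_binoms b0)" by (auto simp flip: \<open>b0 + j0 = 15\<close>)
  then show False using odd_binoms_15 by (simp add: list_all_iff)
qed

lemma pw_X_mon_of: "length a = 6 \<Longrightarrow> pw (map X [0, 1, 2, 3, 4, 5]) a = single (mon_of a) 1"
  by (erule length_6_cases) (simp add: pw_X del: pw_Cons list.map, simp add: mon_of_def add.assoc)

text \<open>The functional that reads this coefficient vanishes on all squares, hence on all compositions of them.\<close>

lemma lookup_hit_spike:
  assumes "h \<in> hit"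
  shows "lookup h (mon_of [15, 0, 0, 0, 0, 0]) = 0"
proof -
  let ?L = "\<lambda>f. lookup f (mon_of [15, 0, 0, 0, 0, 0]) :: bit"
  have Sq: "?L (Sq k f) = 0" if "k > 0" for k f
  proof (induction f rule: P6_induct)
    case (add m f)
    let ?b = "exps m"
    have b: "length ?b = 6" "mon_of ?b = m" by simp_all
    have len: "length a = 6" if "a \<in> set (Sq_exponents k ?b)" for a
      using that by (auto simp: Sq_exponents_def set_lists_with_sum list_all2_conv_all_nth)
    have "Sq k (single m 1) = Sq k (pw (map X [0, 1, 2, 3, 4, 5]) ?b)"
      by (simp only: pw_X_mon_of b)
    also have "\<dots> = (\<Sum>a\<leftarrow>Sq_exponents k ?b. pw (map X [0, 1, 2, 3, 4, 5]) a)"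
      by (rule Sq_pw) (simp_all add: linear_form_X del: pw_Cons)
    also have "\<dots> = (\<Sum>a\<leftarrow>Sq_exponents k ?b. single (mon_of a) 1)"
      by (intro arg_cong[where f = sum_list] map_cong refl pw_X_mon_of len)
    finally have "?L (Sq k (single m 1)) = (\<Sum>a\<leftarrow>Sq_exponents k ?b. ?L (single (mon_of a) 1))"
    proof (simp only:)
      show "?L (\<Sum>a\<leftarrow>as. g a) = (\<Sum>a\<leftarrow>as. ?L (g a))" for "as" :: "nat list list" and g :: "nat list \<Rightarrow> P6"
        by (induction "as") (simp_all add: lookup_add)
    qed
    also have "\<dots> = (\<Sum>a\<leftarrow>Sq_exponents k ?b. 0)"
    proof (intro arg_cong[where f = sum_list] map_cong refl)
      fix a assume a: "a \<in> set (Sq_exponents k ?b)"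
      then have "mon_of a \<noteq> mon_of [15, 0, 0, 0, 0, 0]"
        using Sq_exponents_spike[OF a b(1) that] exps_mon_of[OF len[OF a]] exps_mon_of[of "[15, 0, 0, 0, 0, 0]"] by auto
      then show "?L (single (mon_of a) 1) = 0" by (simp add: lookup_single)
    qed
    finally have "?L (Sq k (single m 1)) = 0" by simp
    with add show ?case by (simp add: Sq_add lookup_add)
  qed simp
  have aug: "?L (\<theta> f) = 0" if "\<theta> \<in> steenrod_aug" for \<theta> f
    using that by (induction arbitrary: f) (simp_all add: Sq lookup_add)
  show ?thesis
    using assms unfolding hit_def
  proof (induction rule: P.span_induct_alt)
    case (step c h g)
    then show ?case using aug by (cases c) (auto simp: lookup_add)
  qed simp
qed

lemma \<xi>_not_hit: "\<xi> \<notin> hit"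
proof
  assume "\<xi> \<in> hit"
  then have "mon_of [15, 0, 0, 0, 0, 0] \<notin> keys \<xi>"
    by (simp only: lookup_hit_spike in_keys_iff) simp
  moreover have "block_mon {0} = mon_of [15, 0, 0, 0, 0, 0]"
    by (simp add: block_mon_def mon_of_def)
  ultimately show False by (simp add: keys_\<xi> image_iff) (metis insert_not_empty)
qed

lemma \<xi>_homogeneous: "\<xi> \<in> homogeneous 15"
proof -
  have "mon_degree (block_mon I) = 15" if "I \<noteq> {}" for I
  proof -
    have "mon_degree (block_mon I) = sum_mset (image_mset (lookup (block_mon I)) (mset_set UNIV))"
      by (simp add: mon_degree_def sum_unfold_sum_mset)
    also have "\<dots> = sum_list (block_exps (card I))"
      by (simp add: mset_lookup_block_mon sum_mset_sum_list)
    also have "card I \<noteq> 0" using that by simp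
    then have "card I = 1 \<or> card I = 2 \<or> card I = 3 \<or> card I = 4 \<or> card I = 5 \<or> card I = 6"
      using card_le_6[of I] by linarith
    then have "sum_list (block_exps (card I)) = 15" by (elim disjE) simp_all
    finally show ?thesis .
  qed
  then show ?thesis by (auto simp: homogeneous_def keys_\<xi>)
qed

section \<open>The space of invariants\<close>

lemma GL_act_qclass: "GL_act A (qclass f) = qclass (lin_subst A f)"
  by transfer (simp add: hit_zero)

lemma scaleQ_qclass: "scaleQ c (qclass f) = qclass (scaleP c f)"
  by transfer (simp add: hit_zero)

text \<open>An invariant and \<open>\<xi>\<close> are both multiples of \<open>bottom\<close> over the large field, and the multiple for \<open>\<xi>\<close> is
  not zero.  Hence the invariant is a multiple of \<open>\<xi>\<close> there, and the retraction descends this relation.\<close>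

lemma QP6_invariants_15: "QP6_invariants 15 = Q.span {qclass \<xi>}"
proof (intro equalityI subsetI)
  fix q assume "q \<in> QP6_invariants 15"
  then obtain f where f: "q = qclass f" "f \<in> homogeneous 15" and "\<forall>A. invertible A \<longrightarrow> GL_act A q = q"
    by (auto simp: QP6_invariants_def QP6_deg_def)
  then have inv: "lin_subst A f - f \<in> hit" if "invertible A" for A
    using that by (simp add: GL_act_qclass qclass_eq_iff)
  obtain d where d: "toK f + const d * Zl bottom \<in> hitK"
    using invariant_toK[OF f(2) inv] by blast
  have "lin_subst A \<xi> - \<xi> \<in> hit" if "invertible A" for A
    using qclass_lin_subst_\<xi>_eq[OF that] by (simp add: qclass_eq_iff)
  then obtain e where e: "toK \<xi> + const e * Zl bottom \<in> hitK"
    using invariant_toK[OF \<xi>_homogeneous] by blast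
  have "e \<noteq> 0"
  proof
    assume "e = 0"
    with e have "toK \<xi> \<in> hitK" by simp
    then show False using \<xi>_not_hit by (simp only: toK_hitK_iff)
  qed
  define r where "r = d / e"
  have "const d = const r * const e" using \<open>e \<noteq> 0\<close> by (simp add: r_def flip: const_ring_hom)
  then have "(toK f + const d * Zl bottom) + const r * (toK \<xi> + const e * Zl bottom)
      = const d * Zl bottom + (const d * Zl bottom + (const 1 * toK f + const r * toK \<xi>))"
    by (simp add: distrib_left ac_simps)
  with hitK_add[OF d hitK_const_mult[OF e, of r]] have "const 1 * toK f + const r * toK \<xi> \<in> hitK"
    by (simp only: PK_cancel)
  then have "descend (const 1 * toK f + const r * toK \<xi>) \<in> hit" by (rule descend_hitK)
  then have "f + scaleP (retract r) \<xi> \<in> hit" by (simp only: descend_add descend_const_toK retract_1 P.scale_one)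
  then have "qclass (f + scaleP (retract r) \<xi>) + qclass (scaleP (retract r) \<xi>) = qclass (scaleP (retract r) \<xi>)"
    by (simp flip: qclass_eq_0_iff)
  then have "q = scaleQ (retract r) (qclass \<xi>)"
    unfolding f(1) scaleQ_qclass by (simp add: add.assoc P6_add_self flip: qclass_add)
  then show "q \<in> Q.span {qclass \<xi>}" unfolding Q.span_singleton by blast
next
  fix q assume "q \<in> Q.span {qclass \<xi>}"
  then obtain c where "q = scaleQ c (qclass \<xi>)" by (auto simp: Q.span_singleton)
  then consider "q = qclass 0" | "q = qclass \<xi>" by (cases c) simp_all
  then show "q \<in> QP6_invariants 15"
  proof cases
    case 1
    have "0 \<in> homogeneous 15" by (simp add: homogeneous_def)
    then show ?thesis unfolding 1 QP6_invariants_def QP6_deg_def by (auto simp: GL_act_qclass simp del: qclass_zero)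
  next
    case 2
    then show ?thesis
      using \<xi>_homogeneous qclass_lin_subst_\<xi>_eq by (auto simp: QP6_invariants_def QP6_deg_def GL_act_qclass)
  qed
qed

lemma dim_QP6_invariants_15: "Q.dim (QP6_invariants 15) = 1"
proof -
  have ind: "Q.independent {qclass \<xi>}" using \<xi>_not_hit by (simp add: Q.dependent_single qclass_eq_0_iff)
  show ?thesis unfolding QP6_invariants_15 by (subst Q.dim_span_eq_card_independent[OF ind]) simp
qed

section \<open>The data of the blocks\<close>

lemma card_fibre: "card {i. lookup m i = v} = count (mset (partition_type m)) v"
  by (simp add: partition_type_def count_image_mset vimage_def)

text \<open>A value outside \<open>V\<close> occurs only once in the partition type, so its fibre is a point.\<close>

lemma simple_value_fibre:
  assumes "distinct (filter (\<lambda>x. x \<notin> V) (partition_type m))"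
    "lookup m i = lookup m j"
  shows "i = j \<or> lookup m i \<in> V"
proof (rule disjCI)
  let ?v = "lookup m i"
  assume "?v \<notin> V"
  then have "count (mset (partition_type m)) ?v = count (mset (filter (\<lambda>x. x \<notin> V) (partition_type m))) ?v"
    by simp
  also have "\<dots> \<le> 1" using assms(1) by (simp add: distinct_count_atmost_1)
  finally have "card {k. lookup m k = ?v} \<le> 1" by (simp only: card_fibre)
  then show "i = j" using assms(2) by (auto simp: card_le_Suc0_iff_eq)
qed

lemma keys_\<xi>_of_type:
  assumes "n \<in> {1..6}"
  shows "card {m \<in> keys \<xi>. partition_type m = block_type n} = 6 choose n"
proof -
  have "distinct (map block_type [1, 2, 3, 4, 5, 6])" unfolding block_type_eq by code_simp
  then have inj: "inj_on block_type (set [1, 2, 3, 4, 5, 6])" by (simp only: distinct_map)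
  have range: "k \<in> set [1, 2, 3, 4, 5, 6]" if "k \<in> {1..6}" for k :: nat
    using that by auto
  have type_eq: "block_type (card I) = block_type n \<longleftrightarrow> card I = n" if "I \<noteq> {}" for I :: "6 set"
    using inj_on_eq_iff[OF inj range[of "card I"] range[of n]] assms that card_le_6[of I] by (simp add: Suc_le_eq card_gt_0_iff)
  have "I \<noteq> {} \<and> block_type (card I) = block_type n \<longleftrightarrow> card I = n" for I :: "6 set"
    using type_eq[of I] assms by (cases "I = {}") simp_all
  then have "{I. I \<noteq> {} \<and> block_type (card I) = block_type n} = {I :: 6 set. card I = n}" by simp
  moreover have "{m \<in> keys \<xi>. partition_type m = block_type n}
      = block_mon ` {I. I \<noteq> {} \<and> block_type (card I) = block_type n}"
    by (auto simp: keys_\<xi> partition_type_block_mon)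
  ultimately have "{m \<in> keys \<xi>. partition_type m = block_type n} = block_mon ` {I. card I = n}"
    by (simp only:)
  also have "card \<dots> = card {I :: 6 set. card I = n}"
    by (rule card_image) (rule inj_on_subset[OF inj_block_mon subset_UNIV])
  also have "\<dots> = 6 choose n" using n_subsets[of "UNIV :: 6 set" n] by simp
  finally show ?thesis .
qed

text \<open>The orbit of a monomial has \<open>720 / s\<close> elements, and the monomials of one type in \<open>\<xi>\<close> correspond to the
  sets of the size of the block.\<close>

lemma block_dataI:
  assumes "n \<in> {1..6}" "s > 0"
    "\<And>m. partition_type m = block_type n \<Longrightarrow> order (\<Sigma>\<^sub>6\<lparr>carrier := stabilizer \<Sigma>\<^sub>6 perm_mon m\<rparr>) = s
       \<and> \<Sigma>\<^sub>6\<lparr>carrier := stabilizer \<Sigma>\<^sub>6 perm_mon m\<rparr> \<cong> H"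
  shows "block_data (block_exps n) (block_type n) (6 choose n) (720 div s) s H"
  unfolding block_data_def
proof (intro conjI allI ballI impI)
  show "partition_type m = block_type n" if "m \<in> keys (M (block_exps n))" for m
    using that assms(1) keys_M[of n] by (auto simp: partition_type_block_mon)
  show "card {m \<in> keys \<xi>. partition_type m = block_type n} = 6 choose n"
    by (rule keys_\<xi>_of_type[OF assms(1)])
  fix m assume m: "partition_type m = block_type n"
  show "card (Group_Action.orbit \<Sigma>\<^sub>6 perm_mon m) = 720 div s"
    using assms(3)[OF m] by (intro orbit_card[OF _ assms(2)]) (rule conjunct1)
qed (use assms(3) in blast)+

lemma block_data_one_fibre:
  assumes "n \<in> {1..6}" "distinct (filter (\<lambda>x. x \<notin> {v}) (block_type n))" "count (mset (block_type n)) v = k"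
  shows "block_data (block_exps n) (block_type n) (6 choose n) (720 div fact k) (fact k) (sym_group k)"
proof (rule block_dataI[OF assms(1) fact_gt_zero])
  fix m assume m: "partition_type m = block_type n"
  let ?A = "{i. lookup m i = v}"
  have k: "card ?A = k" using assms(3) by (simp add: card_fibre m)
  have "lookup m i = lookup m j \<longleftrightarrow> i = j \<or> i \<in> ?A \<and> j \<in> ?A" (is "_ \<longleftrightarrow> ?R") for i j
  proof
    assume eq: "lookup m i = lookup m j"
    show ?R
      using simple_value_fibre[OF assms(2)[folded m] eq] eq by auto
  qed auto
  from stabilizer_one_fibre[OF this]
  show "order (\<Sigma>\<^sub>6\<lparr>carrier := stabilizer \<Sigma>\<^sub>6 perm_mon m\<rparr>) = fact k
     \<and> \<Sigma>\<^sub>6\<lparr>carrier := stabilizer \<Sigma>\<^sub>6 perm_mon m\<rparr> \<cong> sym_group k"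
    unfolding k by blast
qed

lemma block_data_two_fibres:
  assumes "n \<in> {1..6}" "distinct (filter (\<lambda>x. x \<notin> {v, w}) (block_type n))" "v \<noteq> w"
    "count (mset (block_type n)) v = k" "count (mset (block_type n)) w = l"
  shows "block_data (block_exps n) (block_type n) (6 choose n) (720 div (fact k * fact l)) (fact k * fact l)
    (sym_group k \<times>\<times> sym_group l)"
proof (rule block_dataI[OF assms(1)])
  show "0 < fact k * (fact l :: nat)" by simp
  fix m assume m: "partition_type m = block_type n"
  let ?A = "{i. lookup m i = v}" and ?B = "{i. lookup m i = w}"
  have kl: "card ?A = k" "card ?B = l" using assms(4,5) by (simp_all add: card_fibre m)
  have fibres: "lookup m i = lookup m j \<longleftrightarrow>
      i = j \<or> i \<in> ?A \<and> j \<in> ?A \<or> i \<in> ?B \<and> j \<in> ?B" (is "_ \<longleftrightarrow> ?R") for i j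
  proof
    assume eq: "lookup m i = lookup m j"
    show ?R
      using simple_value_fibre[OF assms(2)[folded m] eq] eq by auto
  qed auto
  have "?A \<inter> ?B = {}" using assms(3) by auto
  from stabilizer_two_fibres[OF fibres this]
  show "order (\<Sigma>\<^sub>6\<lparr>carrier := stabilizer \<Sigma>\<^sub>6 perm_mon m\<rparr>) = fact k * fact l
     \<and> \<Sigma>\<^sub>6\<lparr>carrier := stabilizer \<Sigma>\<^sub>6 perm_mon m\<rparr> \<cong> sym_group k \<times>\<times> sym_group l"
    unfolding kl by blast
qed

lemma fact_table: "fact 2 = (2::nat)" "fact 3 = (6::nat)" "fact 4 = (24::nat)" "fact 5 = (120::nat)"
  by (simp_all add: fact_numeral)

lemma choose_table: "6 choose 1 = (6::nat)" "6 choose 2 = (15::nat)" "6 choose 3 = (20::nat)"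
  "6 choose 4 = (15::nat)" "6 choose 5 = (6::nat)" "6 choose 6 = (1::nat)"
  by code_simp+

theorem proposition1p5:
  shows "Q.dim (QP6_invariants 15) = 1
    \<and> QP6_invariants 15 = Q.span {qclass \<xi>}
    \<and> block_data [15] [15, 0, 0, 0, 0, 0] 6 6 120 (sym_group 5)
    \<and> block_data [1, 14] [14, 1, 0, 0, 0, 0] 15 30 24 (sym_group 4)
    \<and> block_data [1, 2, 12] [12, 2, 1, 0, 0, 0] 20 120 6 (sym_group 3)
    \<and> block_data [1, 2, 4, 8] [8, 4, 2, 1, 0, 0] 15 360 2 (sym_group 2)
    \<and> block_data [1, 2, 4, 4, 4] [4, 4, 4, 2, 1, 0] 6 120 6 (sym_group 3)
    \<and> block_data [1, 2, 2, 2, 4, 4] [4, 4, 2, 2, 2, 1] 1 60 12 (sym_group 3 \<times>\<times> sym_group 2)"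
proof (intro conjI)
  show "Q.dim (QP6_invariants 15) = 1" by (rule dim_QP6_invariants_15)
  show "QP6_invariants 15 = Q.span {qclass \<xi>}" by (rule QP6_invariants_15)
  show "block_data [15] [15, 0, 0, 0, 0, 0] 6 6 120 (sym_group 5)"
    using block_data_one_fibre[of 1 0 5] unfolding block_type_simps choose_table fact_table by simp
  show "block_data [1, 14] [14, 1, 0, 0, 0, 0] 15 30 24 (sym_group 4)"
    using block_data_one_fibre[of 2 0 4] unfolding block_type_simps choose_table fact_table by simp
  show "block_data [1, 2, 12] [12, 2, 1, 0, 0, 0] 20 120 6 (sym_group 3)"
    using block_data_one_fibre[of 3 0 3] unfolding block_type_simps choose_table fact_table by simp
  show "block_data [1, 2, 4, 8] [8, 4, 2, 1, 0, 0] 15 360 2 (sym_group 2)"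
    using block_data_one_fibre[of 4 0 2] unfolding block_type_simps choose_table fact_table by simp
  show "block_data [1, 2, 4, 4, 4] [4, 4, 4, 2, 1, 0] 6 120 6 (sym_group 3)"
    using block_data_one_fibre[of 5 4 3] unfolding block_type_simps choose_table fact_table by simp
  show "block_data [1, 2, 2, 2, 4, 4] [4, 4, 2, 2, 2, 1] 1 60 12 (sym_group 3 \<times>\<times> sym_group 2)"
    using block_data_two_fibres[of 6 2 4 3 2] unfolding block_type_simps choose_table fact_table by simp
qed

end
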